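(* For complex $q$ with $0<|q|<1$, $$f_{4,4,3}(q^3,q^2;q)=J_{1}\,\psi(q),$$ and there is a function $\Theta(q)$ which is a sum of quotients of theta functions such that, for all $0<|q|<1$, $$f_{4,4,3}(-q^3,-q^2;q)=\frac{1}{4}\overline{J}_{0,3}\,\mu(q^3)-\frac{1}{2}\overline{J}_{1,3}\,\phi(q)+\Theta(q),$$ where $\psi$ is the third-order, $\mu$ the second-order, and $\phi$ the sixth-order mock theta function.
   Context: Notation: $(x;q)_n:=\prod_{i=0}^{n-1}(1-q^ix)$, $(x;q)_\infty:=\prod_{i=0}^{\infty}(1-q^ix)$. Theta functions: $j(x;q):=(x;q)_\infty(q/x;q)_\infty(q;q)_\infty=\sum_{n\in\mathbb{Z}}(-1)^nq^{\binom n2}x^n$ for $x\neq0$; $J_{a,m}:=j(q^a;q^m)$, $\overline{J}_{a,m}:=j(-q^a;q^m)$, $J_m:=J_{m,3m}=\prod_{i\ge1}(1-q^{mi})$. Type I double-sum: $$f_{a,b,c}(x,y;q):=\Big(\sum_{r,s\ge 0}-\sum_{r,s<0}\Big)(-1)^{r+s}x^ry^sq^{a\binom r2+brs+c\binom s2},$$ where $r,s$ run over integers (both $\ge0$ in the first sum, both $<0$ in the second), and $\binom{r}{2}=r(r-1)/2$. Mock theta functions: $$\psi(q):=\sum_{n=0}^\infty\frac{q^{n^2}}{(q;q^2)_n},\qquad \mu(q):=\sum_{n=0}^\infty\frac{(-1)^nq^{n^2}(q;q^2)_n}{\big((-q^2;q^2)_n\big)^2},\qquad \phi(q):=\sum_{n=0}^\infty\frac{(-1)^nq^{n^2}(q;q^2)_n}{(-q;q)_{2n}}.$$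 "A sum of quotients of theta functions" means a finite linear combination, with rational coefficients, of functions of the form $$q^{k}\,\frac{\prod_{i=1}^{u} j(\varepsilon_i q^{a_i};q^{m_i})}{\prod_{i=1}^{v} j(\delta_i q^{b_i};q^{n_i})}$$ with $k,a_i,b_i\in\mathbb{Z}$, $m_i,n_i$ positive integers, $\varepsilon_i,\delta_i\in\{1,-1\}$, $u,v\ge0$, and all denominators nonvanishing for $0<|q|<1$. *)

theory Defs
  imports "HOL-Analysis.Analysis"
begin

definition qpoch :: "complex \<Rightarrow> complex \<Rightarrow> nat \<Rightarrow> complex" where
  "qpoch x q n = (\<Prod>i<n. 1 - q ^ i * x)"

definition qpoch_inf :: "complex \<Rightarrow> complex \<Rightarrow> complex" where
  "qpoch_inf x q = (\<Prod>i. 1 - q ^ i * x)"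

text \<open>The theta function \<open>j(x;q)\<close>, meant for \<open>x \<noteq> 0\<close> and \<open>0 < norm q < 1\<close>.\<close>

definition theta_j :: "complex \<Rightarrow> complex \<Rightarrow> complex" where
  "theta_j x q = qpoch_inf x q * qpoch_inf (q / x) q * qpoch_inf q q"

text \<open>Usually written \<open>J\<close> and overlined \<open>J\<close> with indices \<open>a,m\<close>, and \<open>J\<close> with
  the single index \<open>m\<close>, respectively; the nome \<open>q\<close> is an explicit argument.\<close>

definition theta_J :: "int \<Rightarrow> nat \<Rightarrow> complex \<Rightarrow> complex" where
  "theta_J a m q = theta_j (q powi a) (q ^ m)"

definition theta_Jbar :: "int \<Rightarrow> nat \<Rightarrow> complex \<Rightarrow> complex" where
  "theta_Jbar a m q = theta_j (- (q powi a)) (q ^ m)"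

definition theta_J1 :: "nat \<Rightarrow> complex \<Rightarrow> complex" where
  "theta_J1 m q = theta_J (int m) (3 * m) q"

text \<open>The type I double-sum \<open>f\<^bsub>a,b,c\<^esub>(x,y;q)\<close>. Both sums are unordered; \<open>r * (r - 1) div 2\<close> is the
  exact value of the binomial coefficient also for negative \<open>r\<close>.\<close>

definition fabc_term :: "int \<Rightarrow> int \<Rightarrow> int \<Rightarrow> complex \<Rightarrow> complex \<Rightarrow> complex \<Rightarrow> int \<Rightarrow> int \<Rightarrow> complex" where
  "fabc_term a b c x y q r s =
     (-1) powi (r + s) * x powi r * y powi s *
     q powi (a * (r * (r - 1) div 2) + b * r * s + c * (s * (s - 1) div 2))"

definition fabc :: "int \<Rightarrow> int \<Rightarrow> int \<Rightarrow> complex \<Rightarrow> complex \<Rightarrow> complex \<Rightarrow> complex" where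
  "fabc a b c x y q =
     (\<Sum>\<^sub>\<infinity>(r, s)\<in>{0..} \<times> {0..}. fabc_term a b c x y q r s) -
     (\<Sum>\<^sub>\<infinity>(r, s)\<in>{..<0} \<times> {..<0}. fabc_term a b c x y q r s)"

text \<open>Mock theta functions of orders three, two and six. Here \<open>\<psi>\<close> includes the term \<open>n = 0\<close>.\<close>

definition mock_psi :: "complex \<Rightarrow> complex" where
  "mock_psi q = (\<Sum>n. q ^ (n\<^sup>2) / qpoch q (q\<^sup>2) n)"

definition mock_mu :: "complex \<Rightarrow> complex" where
  "mock_mu q =
     (\<Sum>n. (-1) ^ n * q ^ (n\<^sup>2) * qpoch q (q\<^sup>2) n / (qpoch (- (q\<^sup>2)) (q\<^sup>2) n)\<^sup>2)"

definition mock_phi :: "complex \<Rightarrow> complex" where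
  "mock_phi q =
     (\<Sum>n. (-1) ^ n * q ^ (n\<^sup>2) * qpoch q (q\<^sup>2) n / qpoch (- q) q (2 * n))"

text \<open>A triple \<open>(\<epsilon>, a, m)\<close> encodes the factor \<open>j(\<epsilon> q\<^sup>a; q\<^sup>m)\<close>.\<close>

definition theta_factor :: "int \<times> int \<times> nat \<Rightarrow> complex \<Rightarrow> complex" where
  "theta_factor = (\<lambda>(\<epsilon>, a, m) q. theta_j (of_int \<epsilon> * q powi a) (q ^ m))"

definition valid_factor :: "int \<times> int \<times> nat \<Rightarrow> bool" where
  "valid_factor = (\<lambda>(\<epsilon>, a, m). \<epsilon> \<in> {1, -1} \<and> 0 < m)"

text \<open>Only the values on the punctured unit disc matter in the following two predicates.\<close>

definition is_theta_quotient :: "(complex \<Rightarrow> complex) \<Rightarrow> bool" where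
  "is_theta_quotient F \<longleftrightarrow>
     (\<exists>(k::int) us vs.
        (\<forall>t \<in> set us \<union> set vs. valid_factor t) \<and>
        (\<forall>t \<in> set vs. \<forall>q. 0 < norm q \<and> norm q < 1 \<longrightarrow> theta_factor t q \<noteq> 0) \<and>
        (\<forall>q. 0 < norm q \<and> norm q < 1 \<longrightarrow>
           F q = q powi k * (\<Prod>t\<leftarrow>us. theta_factor t q) / (\<Prod>t\<leftarrow>vs. theta_factor t q)))"

definition is_sum_of_theta_quotients :: "(complex \<Rightarrow> complex) \<Rightarrow> bool" where
  "is_sum_of_theta_quotients F \<longleftrightarrow>
     (\<exists>(N::nat) (c :: nat \<Rightarrow> rat) G.
        (\<forall>i<N. is_theta_quotient (G i)) \<and>
        (\<forall>q. 0 < norm q \<and> norm q < 1 \<longrightarrow> F q = (\<Sum>i<N. of_rat (c i) * G i q)))"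

end

theory Submission
  imports Defs "HOL-Complex_Analysis.Complex_Analysis"
begin

text \<open>
  Both identities rest on Bailey pairs relative to \<open>a = 1\<close>, written as sums over all integers.
  For \<open>\<psi>\<close> the pair with \<open>\<beta>\<^sub>n = 1/(q;q\<^sup>2)\<^sub>n\<close> gives the double sum directly, since summing
  \<open>f\<^bsub>4,4,3\<^esub>\<close> along \<open>n = r + s\<close> produces the same series.

  For the second identity the quadratic form \<open>2n\<^sup>2 - s\<^sup>2/2\<close> of \<open>f\<^bsub>4,4,3\<^esub>\<close> splits over the rationals:
  with \<open>u = 2n - s\<close> the terms with fixed \<open>u\<close> form a finite geometric series, and \<open>f\<^bsub>4,4,3\<^esub>(-q\<^sup>3,-q\<^sup>2;q)\<close>
  becomes theta functions minus half of \<open>B = \<Sum> q\<^bsup>u(3u+1)/2\<^esup>/(1 + q\<^sup>u)\<close> over all integers \<open>u\<close>. Writing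
  \<open>1/(1 + X) = (1 - X + X\<^sup>2)/(1 + X\<^sup>3)\<close> gives \<open>B = 2P(q) - R(q\<^sup>3)\<close> with
  \<open>P = \<Sum> q\<^bsup>u(3u+1)/2\<^esup>/(1 + q\<^bsup>3u\<^esup>)\<close> and \<open>R = \<Sum> q\<^bsup>u(u+1)/2\<^esup>/(1 + q\<^sup>u)\<close>.
  The terms of \<open>R\<close> with even \<open>u\<close> are Watson's series for \<open>\<mu>\<close>, and the alternating version of \<open>R\<close> is a theta
  quotient. Finally \<open>2P\<close> is a theta function times \<open>\<phi>\<close>: the double sum of \<open>\<phi>\<close> is the value at \<open>y = -q\<close> of a
  Laurent series \<open>g(y)\<close>, and \<open>g\<close> and the corresponding Appell sum both satisfy
  \<open>g(q\<^sup>3y) = -y g(y) + (y - 1/y) j(y;q)\<close>, whose solution holomorphic near the puncture \<open>y = 0\<close> is unique.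
\<close>

subsection \<open>Sums over the integers\<close>

text \<open>Only a(r) + a(-r) enters a Bailey sum, so the sequence may be chosen freely on all of Z.
  It is chosen so that the two quadrants of a double sum become the two halves of one bilateral
  series. The weights come from one limiting q-Gauss sum with a parameter d: d = 0 gives q^(n^2) for
  psi, and d = 1/q in base q^2 gives (-1)^n q^(n^2) (q;q^2)_n for mu and phi. The obstacle is phi:
  the rows of its double sum are tails of a partial theta series, not Lambert terms. The extra
  variable y supplies a functional equation instead. Uniqueness holds because h(q^3 y) = -y h(y)
  forces Laurent coefficients growing like q^(-3 n(n+1)/2), which leaves no annulus of convergence.
  The Appell sum has poles at y = q^(3r+1); half of a theta factor removes those inside |y| <
  |q|^(-2), a disc containing the required point y = -q. The theta part is explicit: j(-q;q^3) +
  J_1^3 / (2 j(-1;q)) - J_3^3 / (2 j(-1;q^3)). Its two cubes come from the alternating Lambert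
  series in base q and in base q^3.\<close>

lemma has_sum_int_split:
  fixes f :: "int \<Rightarrow> 'a :: {topological_comm_monoid_add, t2_space}"
  assumes "((\<lambda>n::nat. f (int n)) has_sum a) UNIV" "((\<lambda>n::nat. f (- 1 - int n)) has_sum b) UNIV"
  shows "(f has_sum (a + b)) UNIV"
proof -
  have 1: "(f has_sum a) {0..}"
    using assms(1) by (subst has_sum_reindex_bij_witness[of _ int nat UNIV "\<lambda>n. f (int n)" f]) auto
  have 2: "(f has_sum b) {..<0}"
    using assms(2)
    by (subst has_sum_reindex_bij_witness[of _ "\<lambda>n. - 1 - int n" "\<lambda>k. nat (- 1 - k)" UNIV "\<lambda>n. f (- 1 - int n)" f]) auto
  have "{0::int..} \<inter> {..<0} = {}" "{0::int..} \<union> {..<0} = UNIV" by auto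
  with has_sum_Un_disjoint[OF 1 2] show ?thesis by simp
qed

lemma summable_on_int_split:
  fixes f :: "int \<Rightarrow> 'a :: {topological_comm_monoid_add, t2_space}"
  assumes "(\<lambda>n::nat. f (int n)) summable_on UNIV" "(\<lambda>n::nat. f (- 1 - int n)) summable_on UNIV"
  shows "f summable_on UNIV"
  using assms has_sum_int_split unfolding summable_on_def by blast

lemma summable_on_int_shift:
  fixes f :: "int \<Rightarrow> 'a :: {topological_comm_monoid_add, t2_space}"
  shows "(\<lambda>n. f (n + k)) summable_on UNIV \<longleftrightarrow> f summable_on UNIV"
  by (rule summable_on_reindex_bij_witness[of _ "\<lambda>n. n - k" "\<lambda>n. n + k"]) auto

lemma infsum_int_shift:
  fixes f :: "int \<Rightarrow> 'a :: {topological_comm_monoid_add, t2_space}"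
  shows "(\<Sum>\<^sub>\<infinity>n. f (n + k)) = (\<Sum>\<^sub>\<infinity>n. f n)"
  by (rule infsum_reindex_bij_witness[of _ "\<lambda>n. n - k" "\<lambda>n. n + k"]) auto

lemma infsum_int_uminus:
  fixes f :: "int \<Rightarrow> 'a :: {topological_comm_monoid_add, t2_space}"
  shows "(\<Sum>\<^sub>\<infinity>n. f (- n)) = (\<Sum>\<^sub>\<infinity>n. f n)"
  by (rule infsum_reindex_bij_witness[of _ uminus uminus]) auto

lemma summable_on_int_uminus:
  fixes f :: "int \<Rightarrow> 'a :: {topological_comm_monoid_add, t2_space}"
  shows "(\<lambda>n. f (- n)) summable_on UNIV \<longleftrightarrow> f summable_on UNIV"
  by (rule summable_on_reindex_bij_witness[of _ uminus uminus]) auto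

lemma summable_on_norm_bound:
  fixes f :: "'a \<Rightarrow> 'b :: banach"
  assumes "g summable_on A" "\<And>x. x \<in> A \<Longrightarrow> norm (f x) \<le> g x"
  shows "f summable_on A"
  by (rule abs_summable_summable) (rule Infinite_Sum.abs_summable_on_comparison_test'[OF assms])

text \<open>Tannery's theorem for unordered sums: the majorant \<open>M\<close> makes the finite
  partial sums converge uniformly in \<open>n\<close>, which permits exchanging the two limits. It
  serves the limits of Bailey sums and the q-Gauss sum.\<close>

lemma tannery_infsum:
  fixes f :: "nat \<Rightarrow> 'a \<Rightarrow> 'b :: banach"
  assumes "M summable_on A" "\<And>n x. x \<in> A \<Longrightarrow> norm (f n x) \<le> M x"
    "\<And>x. x \<in> A \<Longrightarrow> (\<lambda>n. f n x) \<longlonglongrightarrow> g x"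
  shows "(\<lambda>n. \<Sum>\<^sub>\<infinity>x\<in>A. f n x) \<longlonglongrightarrow> (\<Sum>\<^sub>\<infinity>x\<in>A. g x)"
proof -
  have u: "uniform_limit UNIV (\<lambda>X n. \<Sum>x\<in>X. f n x) (\<lambda>n. \<Sum>\<^sub>\<infinity>x\<in>A. f n x) (finite_subsets_at_top A)"
    by (rule Weierstrass_m_test_general[of A UNIV "\<lambda>x n. f n x" M]) (use assms in auto)
  have "norm (g x) \<le> M x" if "x \<in> A" for x
    by (rule tendsto_upperbound[OF tendsto_norm[OF assms(3)[OF that]]]) (use assms(2) that in auto)
  then have "g summable_on A" by (rule summable_on_norm_bound[OF assms(1)])
  then have g: "((\<lambda>X. \<Sum>x\<in>X. g x) \<longlongrightarrow> (\<Sum>\<^sub>\<infinity>x\<in>A. g x)) (finite_subsets_at_top A)"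
    using has_sum_infsum unfolding has_sum_def by blast
  show ?thesis
  proof (rule swap_uniform_limit'[OF _ g u])
    show "\<forall>\<^sub>F X in finite_subsets_at_top A. ((\<lambda>n. \<Sum>x\<in>X. f n x) \<longlongrightarrow> (\<Sum>x\<in>X. g x)) sequentially"
      unfolding eventually_finite_subsets_at_top
      by (rule exI[of _ "{}"]) (auto intro!: tendsto_sum assms(3))
  qed simp_all
qed

lemma holomorphic_infsum:
  fixes f :: "'a \<Rightarrow> complex \<Rightarrow> complex"
  assumes "open S" "\<And>x. f x holomorphic_on S"
    "\<And>z. z \<in> S \<Longrightarrow> \<exists>d>0. \<exists>M. M summable_on UNIV \<and> (\<forall>x. \<forall>w\<in>cball z d. norm (f x w) \<le> M x)"
  shows "(\<lambda>z. \<Sum>\<^sub>\<infinity>x. f x z) holomorphic_on S"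
proof -
  have "\<exists>\<epsilon>>0. (\<lambda>z. \<Sum>\<^sub>\<infinity>x. f x z) holomorphic_on ball z \<epsilon>" if z: "z \<in> S" for z
  proof -
    obtain e where e: "e > 0" "cball z e \<subseteq> S" using assms(1) z open_contains_cball by blast
    obtain d M where d: "d > 0" "M summable_on UNIV" "\<And>x w. w \<in> cball z d \<Longrightarrow> norm (f x w) \<le> M x"
      using assms(3)[OF z] by blast
    define r where "r = min e d"
    have sub: "cball z r \<subseteq> S" using e(2) unfolding r_def by (metis subset_trans min.cobounded1 subset_cball)
    have u: "uniform_limit (cball z r) (\<lambda>X w. \<Sum>x\<in>X. f x w) (\<lambda>w. \<Sum>\<^sub>\<infinity>x. f x w) (finite_subsets_at_top UNIV)"
      by (rule Weierstrass_m_test_general[OF _ d(2)]) (use d(3) in \<open>auto simp: r_def\<close>)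
    have "continuous_on (cball z r) (\<lambda>w. \<Sum>x\<in>X. f x w) \<and> (\<lambda>w. \<Sum>x\<in>X. f x w) holomorphic_on ball z r" for X
    proof -
      have "(\<lambda>w. \<Sum>x\<in>X. f x w) holomorphic_on S" using assms(2) by (intro holomorphic_intros)
      then show ?thesis using sub
        by (meson ball_subset_cball holomorphic_on_imp_continuous_on holomorphic_on_subset subset_trans)
    qed
    then obtain "continuous_on (cball z r) (\<lambda>w. \<Sum>\<^sub>\<infinity>x. f x w)" "(\<lambda>w. \<Sum>\<^sub>\<infinity>x. f x w) holomorphic_on ball z r"
      using holomorphic_uniform_limit[OF _ u] by auto
    then show ?thesis using e d by (intro exI[of _ r]) (auto simp: r_def)
  qed
  then show ?thesis
    by (meson analytic_on_def analytic_imp_holomorphic)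
qed

section \<open>Triangular numbers and Gaussian series over the integers\<close>

abbreviation tri :: "int \<Rightarrow> int" where "tri n \<equiv> n * (n - 1) div 2"

lemma triangle_Suc: "n * (n + 1) div 2 = tri n + n"
proof -
  have "n * (n + 1) = n * (n - 1) + n * 2" by algebra
  then show ?thesis by simp
qed

lemma triangle_double: "2 * tri n = n * (n - 1)"
  by (rule dvd_mult_div_cancel) auto

lemma triangle_nonneg: "0 \<le> tri n"
proof -
  have "0 \<le> n * (n - 1)"
  proof (cases "n \<le> 0")
    case True then show ?thesis by (intro mult_nonpos_nonpos) auto
  next
    case False then show ?thesis by (intro mult_nonneg_nonneg) auto
  qed
  then show ?thesis by simp
qed

lemma triangle_uminus: "tri (- n) = tri n + n"
proof -
  have "(- n) * (- n - 1) = n * (n + 1)" by algebra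
  then show ?thesis using triangle_Suc by presburger
qed

lemma summable_gauss_nat:
  fixes r C :: real
  assumes "0 < r" "r < 1" "0 \<le> C"
  shows "(\<lambda>n::nat. C ^ n * r powi (tri (int n))) summable_on UNIV"
proof (rule summable_nonneg_imp_summable_on)
  let ?f = "\<lambda>n::nat. C ^ n * r powi (tri (int n))"
  have "(\<lambda>n. C * r ^ n) \<longlonglongrightarrow> C * 0"
    by (intro tendsto_intros LIMSEQ_realpow_zero) (use assms in auto)
  then have "eventually (\<lambda>n. C * r ^ n < 1 / 2) sequentially" by (rule order_tendstoD) simp
  then obtain N where N: "\<And>n. n \<ge> N \<Longrightarrow> C * r ^ n < 1 / 2" unfolding eventually_sequentially by blast
  show "summable ?f"
  proof (rule summable_ratio_test)
    show "1 / 2 < (1::real)" by simp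
    fix n assume n: "n \<ge> N"
    have "tri (int (Suc n)) = tri (int n) + int n"
      using triangle_Suc[of "int n"] by (simp add: mult.commute add.commute)
    then have e: "?f (Suc n) = (C * r ^ n) * ?f n"
      using assms by (simp add: power_int_add)
    show "norm (?f (Suc n)) \<le> 1 / 2 * norm (?f n)"
      unfolding e norm_mult[of "C * r ^ n"]
      using N[OF n] assms by (intro mult_right_mono) (auto simp: norm_mult)
  qed
qed (use assms in \<open>auto intro!: mult_nonneg_nonneg\<close>)

lemma summable_gauss:
  fixes r C :: real
  assumes "0 < r" "r < 1" "0 < C"
  shows "(\<lambda>n::int. C powi n * r powi (tri n)) summable_on UNIV"
proof (rule summable_on_int_split)
  show "(\<lambda>n::nat. C powi (int n) * r powi (tri (int n))) summable_on UNIV"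
    using summable_gauss_nat[of r C] assms by simp
  \<comment> \<open>Since tri (-1 - n) = tri n + 2 n + 1, the negative half is the nonnegative half
    with \<open>C\<close> replaced by r^2 / C, up to the factor r / C.\<close>
  have "(\<lambda>n::nat. (r\<^sup>2/C) ^ n * r powi (tri (int n)) * (r / C)) summable_on UNIV"
    by (intro summable_on_cmult_left summable_gauss_nat) (use assms in auto)
  also have "(\<lambda>n::nat. (r\<^sup>2/C) ^ n * r powi (tri (int n)) * (r / C)) =
     (\<lambda>n. C powi (- 1 - int n) * r powi ((- 1 - int n) * (- 1 - int n - 1) div 2))"
  proof
    fix n :: nat
    have "(- 1 - int n) * (- 1 - int n - 1) = (int n + 1) * (int n + 1 + 1)" by algebra
    then have "tri (- 1 - int n) = tri (int n) + int n + (int n + 1)"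
      using triangle_Suc[of "int n + 1"] triangle_Suc[of "int n"] by (simp add: algebra_simps)
    then have e: "tri (- 1 - int n) = tri (int n) + int (2 * n + 1)"
      by simp
    have "C powi (- 1 - int n) = 1 / C ^ Suc n"
      using assms by (simp add: power_int_diff power_int_minus field_simps)
    moreover have "r powi (tri (int n) + int (2 * n + 1)) = r powi (tri (int n)) * ((r\<^sup>2) ^ n * r)"
      using assms by (subst power_int_add) (auto simp: power_mult simp del: of_nat_add of_nat_mult of_nat_Suc)
    ultimately show "(r\<^sup>2/C) ^ n * r powi (tri (int n)) * (r / C)
        = C powi (- 1 - int n) * r powi ((- 1 - int n) * (- 1 - int n - 1) div 2)"
      using assms unfolding e by (simp add: power_divide mult_ac)
  qed
  finally show "(\<lambda>n::nat. C powi (- 1 - int n) * r powi ((- 1 - int n) * (- 1 - int n - 1) div 2)) summable_on UNIV" .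
qed

subsection \<open>Infinite products\<close>

lemma qpoch_0 [simp]: "qpoch x q 0 = 1" by (simp add: qpoch_def)

lemma qpoch_Suc: "qpoch x q (Suc n) = qpoch x q n * (1 - q ^ n * x)" by (simp add: qpoch_def)

lemma qpoch_split: "qpoch x q (m + n) = qpoch x q m * qpoch (q ^ m * x) q n"
  by (induction n) (auto simp: qpoch_Suc power_add algebra_simps)

lemma qpoch_Suc_shift: "qpoch x q (Suc n) = (1 - x) * qpoch (q * x) q n"
  using qpoch_split[of x q 1 n] by (simp add: qpoch_Suc)

lemma convergent_prod_qpoch:
  fixes q x :: complex
  assumes "norm q < 1"
  shows "convergent_prod (\<lambda>i. 1 - q ^ i * x)"
proof -
  have "summable (\<lambda>i. norm q ^ i * norm x)"
    using assms by (intro summable_mult2 summable_geometric) simp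
  then have "summable (\<lambda>i. norm (1 - q ^ i * x - 1))"
    by (simp add: norm_mult norm_power)
  then show ?thesis
    by (intro abs_convergent_prod_imp_convergent_prod summable_imp_abs_convergent_prod)
qed

lemma qpoch_tendsto:
  assumes "norm q < 1"
  shows "qpoch x q \<longlonglongrightarrow> qpoch_inf x q"
  using convergent_prod_LIMSEQ[OF convergent_prod_qpoch[OF assms, of x]]
  unfolding qpoch_def qpoch_inf_def by (simp add: LIMSEQ_lessThan_iff_atMost)

lemma qpoch_inf_split:
  assumes "norm q < 1"
  shows "qpoch_inf x q = qpoch x q n * qpoch_inf (q ^ n * x) q"
proof (rule LIMSEQ_unique)
  show "(\<lambda>m. qpoch x q (n + m)) \<longlonglongrightarrow> qpoch_inf x q"
    using LIMSEQ_ignore_initial_segment[OF qpoch_tendsto[OF assms, of x], of n] by (simp add: add.commute)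
  show "(\<lambda>m. qpoch x q (n + m)) \<longlonglongrightarrow> qpoch x q n * qpoch_inf (q ^ n * x) q"
    unfolding qpoch_split by (intro tendsto_intros qpoch_tendsto assms)
qed

lemma qpoch_inf_shift:
  assumes "norm q < 1"
  shows "qpoch_inf x q = (1 - x) * qpoch_inf (q * x) q"
  using qpoch_inf_split[OF assms, of x 1] by (simp add: qpoch_Suc)

lemma qpoch_inf_nonzero_iff:
  assumes "norm q < 1"
  shows "qpoch_inf x q \<noteq> 0 \<longleftrightarrow> (\<forall>i. q ^ i * x \<noteq> 1)"
  using has_prod_eq_0_iff[OF convergent_prod_has_prod[OF convergent_prod_qpoch[OF assms, of x]]]
  unfolding qpoch_inf_def by auto

lemma power_mult_ne_1:
  fixes q x :: complex
  assumes "norm q < 1" "norm x < 1"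
  shows "q ^ i * x \<noteq> 1"
proof
  assume "q ^ i * x = 1"
  then have "norm q ^ i * norm x = 1" by (metis norm_mult norm_one norm_power)
  moreover have "norm q ^ i * norm x \<le> 1 * norm x" using assms by (intro mult_right_mono power_le_one) auto
  ultimately show False using assms by simp
qed

lemma qpoch_inf_nonzero: "norm q < 1 \<Longrightarrow> norm x < 1 \<Longrightarrow> qpoch_inf x q \<noteq> 0"
  using qpoch_inf_nonzero_iff power_mult_ne_1 by blast

lemma qpoch_nonzero: "norm q < 1 \<Longrightarrow> norm x < 1 \<Longrightarrow> qpoch x q n \<noteq> 0"
  unfolding qpoch_def using power_mult_ne_1 by auto

lemma norm_power_less_1: "norm (q::complex) < 1 \<Longrightarrow> n > 0 \<Longrightarrow> norm (q ^ n) < 1"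
  by (simp add: norm_power power_Suc_less_one power_less_one_iff)

lemma norm_power2_less_1: "norm (q::complex) < 1 \<Longrightarrow> norm (q\<^sup>2) < 1"
  by (rule norm_power_less_1) auto

lemma norm_power3_less_1: "norm (q::complex) < 1 \<Longrightarrow> norm (q ^ 3) < 1"
  by (rule norm_power_less_1) auto

lemma qpoch_dissect: "qpoch x q (m * n) = (\<Prod>k<m. qpoch (q ^ k * x) (q ^ m) n)"
proof (induction n)
  case (Suc n)
  have "qpoch x q (m * n + m) = qpoch x q (m * n) * (\<Prod>k<m. 1 - (q ^ m) ^ n * (q ^ k * x))"
    unfolding qpoch_split qpoch_def[of "q ^ (m * n) * x"] by (simp add: power_mult mult_ac)
  then show ?case by (simp add: Suc qpoch_Suc prod.distrib add.commute)
qed simp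

lemma qpoch_inf_dissect:
  assumes "norm q < 1" "0 < m"
  shows "qpoch_inf x q = (\<Prod>k<m. qpoch_inf (q ^ k * x) (q ^ m))"
proof (rule LIMSEQ_unique)
  have "strict_mono (\<lambda>n. m * n)" using assms(2) by (simp add: strict_mono_def)
  from LIMSEQ_subseq_LIMSEQ[OF qpoch_tendsto[OF assms(1)] this]
  show "(\<lambda>n. qpoch x q (m * n)) \<longlonglongrightarrow> qpoch_inf x q" by (simp add: o_def)
  show "(\<lambda>n. qpoch x q (m * n)) \<longlonglongrightarrow> (\<Prod>k<m. qpoch_inf (q ^ k * x) (q ^ m))"
    unfolding qpoch_dissect by (intro tendsto_prod qpoch_tendsto norm_power_less_1 assms)
qed

lemma qpoch_inf_dissect2:
  assumes "norm q < 1"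
  shows "qpoch_inf x q = qpoch_inf x (q\<^sup>2) * qpoch_inf (q * x) (q\<^sup>2)"
  using qpoch_inf_dissect[OF assms, of 2 x] by (simp add: lessThan_nat_numeral mult_ac)

lemma qpoch_inf_dissect3:
  assumes "norm q < 1"
  shows "qpoch_inf x q = qpoch_inf x (q ^ 3) * qpoch_inf (q * x) (q ^ 3) * qpoch_inf (q\<^sup>2 * x) (q ^ 3)"
  using qpoch_inf_dissect[OF assms, of 3 x] by (simp add: lessThan_nat_numeral mult_ac)

lemma qpoch_inf_mult_uminus:
  assumes "norm q < 1"
  shows "qpoch_inf x q * qpoch_inf (- x) q = qpoch_inf (x\<^sup>2) (q\<^sup>2)"
proof (rule LIMSEQ_unique)
  show "(\<lambda>n. qpoch x q n * qpoch (- x) q n) \<longlonglongrightarrow> qpoch_inf x q * qpoch_inf (- x) q"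
    by (intro tendsto_intros qpoch_tendsto assms)
  have "qpoch x q n * qpoch (- x) q n = qpoch (x\<^sup>2) (q\<^sup>2) n" for n
  proof (induction n)
    case (Suc n)
    have "(q\<^sup>2) ^ n = (q ^ n)\<^sup>2" by (simp add: power_mult[symmetric] mult.commute)
    then have "(1 - q ^ n * x) * (1 - q ^ n * - x) = 1 - (q\<^sup>2) ^ n * x\<^sup>2"
      by (simp add: power2_eq_square algebra_simps)
    then show ?case using Suc by (simp add: qpoch_Suc algebra_simps)
  qed simp
  then show "(\<lambda>n. qpoch x q n * qpoch (- x) q n) \<longlonglongrightarrow> qpoch_inf (x\<^sup>2) (q\<^sup>2)"
    using qpoch_tendsto[OF norm_power2_less_1[OF assms]] by simp
qed

lemma norm_qpoch_le:
  assumes "norm q < 1" "norm x \<le> X"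
  shows "norm (qpoch x q n) \<le> exp (X / (1 - norm q))"
proof -
  have "norm (qpoch x q n) \<le> (\<Prod>i<n. 1 + norm q ^ i * X)"
    unfolding qpoch_def prod_norm[symmetric]
  proof (rule prod_mono, intro conjI norm_ge_zero)
    fix i
    have "norm (1 - q ^ i * x) \<le> norm (1::complex) + norm (q ^ i * x)" by (rule norm_triangle_ineq4)
    also have "\<dots> \<le> 1 + norm q ^ i * X" using assms by (auto simp: norm_mult norm_power intro!: mult_left_mono)
    finally show "norm (1 - q ^ i * x) \<le> 1 + norm q ^ i * X" .
  qed
  also have "\<dots> \<le> exp (\<Sum>i<n. norm q ^ i * X)"
    by (rule prod_le_exp_sum) (use assms order_trans[OF norm_ge_zero assms(2)] in auto)
  also have "(\<Sum>i<n. norm q ^ i * X) \<le> (\<Sum>i. norm q ^ i * X)"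
    using assms order_trans[OF norm_ge_zero assms(2)]
    by (intro sum_le_suminf summable_mult2 summable_geometric) auto
  also have "(\<Sum>i. norm q ^ i * X) = X / (1 - norm q)"
    using assms by (simp add: suminf_mult2[symmetric] suminf_geometric summable_geometric)
  finally show ?thesis by simp
qed

lemma norm_qpoch_inf_le:
  assumes "norm q < 1" "norm x \<le> X"
  shows "norm (qpoch_inf x q) \<le> exp (X / (1 - norm q))"
  by (rule tendsto_upperbound[OF tendsto_norm[OF qpoch_tendsto]]) (use norm_qpoch_le assms in auto)

lemma holomorphic_qpoch [holomorphic_intros]:
  "f holomorphic_on S \<Longrightarrow> (\<lambda>z. qpoch (f z) q n) holomorphic_on S"
  unfolding qpoch_def by (intro holomorphic_intros)

lemma holomorphic_qpoch_inf:
  assumes "norm q < 1"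
  shows "(\<lambda>x. qpoch_inf x q) holomorphic_on UNIV"
proof (rule holomorphic_uniform_sequence)
  fix z :: complex
  have "uniformly_convergent_on (cball z 1) (\<lambda>N x. \<Prod>n<N. 1 - q ^ n * x)"
  proof (rule uniformly_convergent_on_prod')
    show "uniformly_convergent_on (cball z 1) (\<lambda>N x. \<Sum>n<N. norm (1 - q ^ n * x - 1))"
    proof (rule Weierstrass_m_test'[where M = "\<lambda>n. norm q ^ n * (norm z + 1)"])
      show "norm (norm (1 - q ^ n * x - 1)) \<le> norm q ^ n * (norm z + 1)" if "x \<in> cball z 1" for n x
      proof -
        have "norm x \<le> norm z + 1" using that by (simp add: dist_norm) (metis norm_triangle_sub norm_minus_commute add_left_mono order_trans)
        then show ?thesis by (simp add: norm_mult norm_power mult_left_mono)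
      qed
      show "summable (\<lambda>n. norm q ^ n * (norm z + 1))"
        using assms by (intro summable_mult2 summable_geometric) auto
    qed
  qed (auto intro!: continuous_intros)
  then have "uniform_limit (cball z 1) (\<lambda>N x. qpoch x q N) (\<lambda>x. lim (\<lambda>N. qpoch x q N)) sequentially"
    unfolding qpoch_def uniformly_convergent_uniform_limit_iff .
  moreover have "lim (\<lambda>N. qpoch x q N) = qpoch_inf x q" for x
    using qpoch_tendsto[OF assms] limI by blast
  ultimately show "\<exists>d>0. cball z d \<subseteq> UNIV \<and> uniform_limit (cball z d) (\<lambda>N x. qpoch x q N) (\<lambda>x. qpoch_inf x q) sequentially"
    by (intro exI[of _ 1]) simp
qed (auto intro!: holomorphic_intros)

subsection \<open>Bailey pairs\<close>

lemma powi_double: "x \<noteq> 0 \<Longrightarrow> (x::complex) powi (2 * k) = x powi k * x powi k"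
  by (metis mult_2 power_int_add)

text \<open>Setting the reciprocal of \<open>(q;q)\<^sub>k\<close> to zero for negative \<open>k\<close> makes the recurrence
  \<open>iqp_rec\<close> hold for all integers, so that sums over \<open>\<bar>r\<bar> \<le> n\<close> become sums over all integers.\<close>

definition iqp :: "complex \<Rightarrow> int \<Rightarrow> complex" where
  "iqp q k = (if k < 0 then 0 else 1 / qpoch q q (nat k))"

lemma iqp_neg [simp]: "k < 0 \<Longrightarrow> iqp q k = 0" by (simp add: iqp_def)

lemma iqp_nat: "iqp q (int n) = 1 / qpoch q q n" by (simp add: iqp_def)

lemma iqp_rec:
  assumes "norm q < 1"
  shows "iqp q (k - 1) = (1 - q powi k) * iqp q k"
proof (cases "k \<le> 0")
  case True
  then show ?thesis by (cases "k = 0") auto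
next
  case False
  then obtain m where m: "k = int (Suc m)" by (metis gr0_implies_Suc not_le zero_less_imp_eq_int)
  have "1 - q ^ m * q \<noteq> 0" using power_mult_ne_1[OF assms assms, of m] by auto
  moreover have "nat (int (Suc m) - 1) = m" "nat (int (Suc m)) = Suc m" "q powi (int (Suc m)) = q ^ m * q" by (simp_all del: of_nat_Suc)
  ultimately show ?thesis unfolding m
    by (simp add: iqp_def qpoch_Suc mult.commute del: of_nat_Suc nat_int)
qed

lemma iqp_rec': "norm q < 1 \<Longrightarrow> k' = k - 1 \<Longrightarrow> iqp q k' = (1 - q powi k) * iqp q k"
  using iqp_rec by simp

lemma iqp_tendsto:
  assumes "norm q < 1"
  shows "(\<lambda>n. iqp q (int n + k)) \<longlonglongrightarrow> 1 / qpoch_inf q q"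
proof -
  have "(\<lambda>n. 1 / qpoch q q n) \<longlonglongrightarrow> 1 / qpoch_inf q q"
    by (intro tendsto_intros qpoch_tendsto qpoch_inf_nonzero assms)
  then have "(\<lambda>n. iqp q (int n)) \<longlonglongrightarrow> 1 / qpoch_inf q q" by (simp add: iqp_nat)
  then have "(\<lambda>n. iqp q (int (n + nat k))) \<longlonglongrightarrow> 1 / qpoch_inf q q"
    by (rule LIMSEQ_ignore_initial_segment)
  moreover have "int (n + nat (- k)) + k = int (n + nat k)" for n by simp
  ultimately have "(\<lambda>n. iqp q (int (n + nat (- k)) + k)) \<longlonglongrightarrow> 1 / qpoch_inf q q" by (simp only:)
  then show ?thesis by (rule LIMSEQ_offset)
qed

lemma qpoch_recip_bounded:
  assumes "norm q < 1" "norm x < 1"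
  shows "\<exists>M>0. \<forall>n. norm (1 / qpoch x q n) \<le> M"
proof -
  have "(\<lambda>n. 1 / qpoch x q n) \<longlonglongrightarrow> 1 / qpoch_inf x q"
    by (intro tendsto_intros qpoch_tendsto qpoch_inf_nonzero assms)
  then have "Bseq (\<lambda>n. 1 / qpoch x q n)" using convergentI convergent_imp_Bseq by blast
  then show ?thesis by (metis BseqE)
qed

lemma iqp_bounded:
  assumes "norm q < 1"
  shows "\<exists>M>0. \<forall>k. norm (iqp q k) \<le> M"
proof -
  obtain M where "M > 0" "\<And>n. norm (1 / qpoch q q n) \<le> M"
    using qpoch_recip_bounded[OF assms assms] by blast
  then show ?thesis by (intro exI[of _ M]) (auto simp: iqp_def)
qed

abbreviation iqp2 :: "complex \<Rightarrow> int \<Rightarrow> int \<Rightarrow> complex" where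
  "iqp2 q n r \<equiv> iqp q (n - r) * iqp q (n + r)"

text \<open>The \<beta>_n of a Bailey pair relative to 1, with \<alpha>_0 = a 0 and \<alpha>_r = a r
  + a (- r) for r > 0. The kernel vanishes for |r| > n, so the sum over all integers is
  finite.\<close>

definition bailey :: "complex \<Rightarrow> (int \<Rightarrow> complex) \<Rightarrow> int \<Rightarrow> complex" where
  "bailey q a n = (\<Sum>\<^sub>\<infinity>r. a r * iqp2 q n r)"

lemma summable_bailey:
  fixes m :: int
  assumes "\<And>r. r < - m \<Longrightarrow> f r = 0" "\<And>r. r > m \<Longrightarrow> f r = (0::complex)"
  shows "f summable_on UNIV"
proof (rule finite_nonzero_values_imp_summable_on)
  have "{r \<in> UNIV. f r \<noteq> 0} \<subseteq> {- m..m}" using assms by force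
  then show "finite {r \<in> UNIV. f r \<noteq> 0}" using finite_subset by blast
qed

lemma summable_bailey' [simp]:
  "(\<lambda>r. a r * iqp2 q n r) summable_on UNIV"
  by (rule summable_bailey[of "\<bar>n\<bar>"]) auto

lemma bailey_0: "bailey q a 0 = a 0"
proof -
  have "bailey q a 0 = (\<Sum>\<^sub>\<infinity>r\<in>{0}. a r * (iqp q (0 - r) * iqp q (0 + r)))"
    unfolding bailey_def by (rule infsum_cong_neutral) (auto simp: iqp_def)
  then show ?thesis by (simp add: iqp_def)
qed

lemma bailey_pred:
  assumes "norm q < 1"
  shows "bailey q a (n - 1) =
    (\<Sum>\<^sub>\<infinity>r. a r * ((1 - q powi (n - r)) * (1 - q powi (n + r))) * iqp2 q n r)"
  unfolding bailey_def
proof (rule infsum_cong)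
  fix r
  show "a r * (iqp q (n - 1 - r) * iqp q (n - 1 + r)) =
    a r * ((1 - q powi (n - r)) * (1 - q powi (n + r))) * iqp2 q n r"
    using iqp_rec'[OF assms, of "n - 1 - r" "n - r"] iqp_rec'[OF assms, of "n - 1 + r" "n + r"] by simp
qed

text \<open>Both levels are written over the kernel at level \<open>n\<close>, so a first-order
  recurrence in \<open>n\<close> reduces to the vanishing of one finite sum over
  \<open>r\<close>.\<close>

lemma bailey_diff_eq_0:
  assumes "norm q < 1"
    and "(\<Sum>\<^sub>\<infinity>r. a r * ((1 - q powi (n - r)) * (1 - q powi (n + r)) - k) * iqp2 q n r) = 0"
  shows "bailey q a (n - 1) = k * bailey q a n"
proof -
  have "bailey q a (n - 1) - k * bailey q a n =
    (\<Sum>\<^sub>\<infinity>r. a r * ((1 - q powi (n - r)) * (1 - q powi (n + r))) * iqp2 q n r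
       + (- k * a r) * iqp2 q n r)"
    unfolding bailey_pred[OF assms(1)]
    by (subst infsum_add, (rule summable_bailey')+) (simp add: bailey_def infsum_cmult_right' mult.assoc infsum_uminus)
  also have "\<dots> = 0" unfolding assms(2)[symmetric] by (rule infsum_cong) (simp add: algebra_simps)
  finally show ?thesis by simp
qed

lemma infsum_telescope:
  fixes f :: "int \<Rightarrow> complex"
  assumes "f summable_on UNIV"
  shows "(\<Sum>\<^sub>\<infinity>r. f (r + 1) - f r) = 0"
proof -
  have "(\<lambda>r. f (r + 1)) summable_on UNIV" using assms by (simp add: summable_on_int_shift)
  then show ?thesis using assms
    using infsum_add[of "\<lambda>r. f (r + 1)" UNIV "\<lambda>r. - f r"]
    by (simp add: infsum_uminus infsum_int_shift summable_on_uminus)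
qed

text \<open>Each kernel factor tends to 1 / (q;q)_\<infinity> and is bounded uniformly. Read
  backwards, a closed form for \<beta>_n evaluates the bilateral sum of \<open>a\<close>; this gives
  the triple product and later \<open>infsum_mu_alpha\<close>.\<close>

lemma bailey_tendsto:
  assumes "norm q < 1" "a summable_on UNIV"
  shows "(\<lambda>n. bailey q a (int n)) \<longlonglongrightarrow> (\<Sum>\<^sub>\<infinity>r. a r) / (qpoch_inf q q)\<^sup>2"
proof -
  obtain M where M: "M > 0" "\<And>k. norm (iqp q k) \<le> M" using iqp_bounded[OF assms(1)] by blast
  have "(\<lambda>n. bailey q a (int n)) \<longlonglongrightarrow> (\<Sum>\<^sub>\<infinity>r. a r * (1 / qpoch_inf q q * (1 / qpoch_inf q q)))"
    unfolding bailey_def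
  proof (rule tannery_infsum)
    have "(\<lambda>r. norm (a r)) summable_on UNIV"
      using assms(2) by (simp add: summable_on_iff_abs_summable_on_complex)
    then show "(\<lambda>r. norm (a r) * (M * M)) summable_on UNIV" by (rule summable_on_cmult_left)
    show "norm (a r * iqp2 q (int n) r) \<le> norm (a r) * (M * M)" for n r
      using M by (auto simp: norm_mult intro!: mult_left_mono mult_mono)
    show "(\<lambda>n. a r * iqp2 q (int n) r) \<longlonglongrightarrow> a r * (1 / qpoch_inf q q * (1 / qpoch_inf q q))" for r
      using iqp_tendsto[OF assms(1), of "- r"] by (intro tendsto_mult tendsto_const iqp_tendsto assms) simp
  qed
  then show ?thesis by (subst (asm) infsum_cmult_left') (simp add: power2_eq_square)
qed

text \<open>Jacobi's triple product, as the limit n \<rightarrow> \<infinity> of its finite form: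
  the Bailey sum of (-x)^r q^(r(r-1)/2) is (x;q)_n (q/x;q)_n / (q;q)_{2n}, by a first-order
  recurrence in n.\<close>

lemma theta_series:
  fixes q x :: complex
  assumes "0 < norm q" "norm q < 1" "x \<noteq> 0"
  shows "((\<lambda>n. (- x) powi n * q powi (tri n)) has_sum theta_j x q) UNIV"
proof -
  let ?a = "\<lambda>n. (- x) powi n * q powi (tri n)"
  have q: "q \<noteq> 0" using assms by auto
  have summ: "?a summable_on UNIV"
    by (rule summable_on_norm_bound[OF summable_gauss[of "norm q" "norm x"]])
       (use assms in \<open>auto simp: norm_mult norm_power_int\<close>)
  have rec: "(1 - q powi (2 * n - 1)) * (1 - q powi (2 * n)) * bailey q ?a n
      = (1 - x * q powi (n - 1)) * (1 - q powi n / x) * bailey q ?a (n - 1)" for n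
  proof -
    let ?c = "iqp2 q"
    have s: "(\<lambda>r. ?a (r - 1) * ?c (n - 1) (r - 1)) summable_on UNIV" "(\<lambda>r. ?a (r + 1) * ?c (n - 1) (r + 1)) summable_on UNIV"
      using summable_on_int_shift[of "\<lambda>r. ?a r * ?c (n - 1) r" "-1"] summable_on_int_shift[of "\<lambda>r. ?a r * ?c (n - 1) r" "1"]
      by simp_all
    \<comment> \<open>Expanding the factor (1 - x q^(n-1)) (1 - q^n / x) leaves terms in x and 1/x.
      Shifting \<open>r\<close> by one in the matching copies of the sum realigns the powers of x,
      so the recurrence can be checked for each \<open>r\<close> separately.\<close>
    have 1: "bailey q ?a (n - 1) = (\<Sum>\<^sub>\<infinity>r. ?a (r - 1) * ?c (n - 1) (r - 1))"
      unfolding bailey_def using infsum_int_shift[of "\<lambda>r. ?a r * ?c (n - 1) r" "-1"] by simp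
    have 2: "bailey q ?a (n - 1) = (\<Sum>\<^sub>\<infinity>r. ?a (r + 1) * ?c (n - 1) (r + 1))"
      unfolding bailey_def using infsum_int_shift[of "\<lambda>r. ?a r * ?c (n - 1) r" "1"] by simp
    have e: "(1 - x * q powi (n - 1)) * (1 - q powi n / x) =
        (1 + q powi (2 * n - 1)) + (- x * q powi (n - 1)) + (- (q powi n / x))"
      using q assms(3) by (simp add: power_int_diff powi_double) (simp add: field_simps)
    have "(1 - x * q powi (n - 1)) * (1 - q powi n / x) * bailey q ?a (n - 1)
      = (1 + q powi (2 * n - 1)) * bailey q ?a (n - 1)
        + (- x * q powi (n - 1)) * (\<Sum>\<^sub>\<infinity>r. ?a (r - 1) * ?c (n - 1) (r - 1))
        + (- (q powi n / x)) * (\<Sum>\<^sub>\<infinity>r. ?a (r + 1) * ?c (n - 1) (r + 1))"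
      unfolding e 1[symmetric] 2[symmetric] by (simp only: distrib_right)
    also have "\<dots> = (\<Sum>\<^sub>\<infinity>r. (1 + q powi (2 * n - 1)) * (?a r * ?c (n - 1) r)
        + (- x * q powi (n - 1)) * (?a (r - 1) * ?c (n - 1) (r - 1))
        + (- (q powi n / x)) * (?a (r + 1) * ?c (n - 1) (r + 1)))"
      unfolding bailey_def
      by (subst infsum_add, (intro summable_on_add summable_on_cmult_right s summable_bailey')+)+
         (simp only: infsum_cmult_right')
    also have "\<dots> = (\<Sum>\<^sub>\<infinity>r. (1 - q powi (2 * n - 1)) * (1 - q powi (2 * n)) * (?a r * ?c n r))"
    proof (rule infsum_cong)
      fix r
      have c: "?c (n - 1) r = (1 - q powi (n - r)) * (1 - q powi (n + r)) * ?c n r"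
        "?c (n - 1) (r - 1) = (1 - q powi (n + r)) * (1 - q powi (n + r - 1)) * ?c n r"
        "?c (n - 1) (r + 1) = (1 - q powi (n - r)) * (1 - q powi (n - r - 1)) * ?c n r"
        using iqp_rec'[OF assms(2), of "n - 1 - r" "n - r"] iqp_rec'[OF assms(2), of "n - 1 + r" "n + r"]
          iqp_rec'[OF assms(2), of "n - 1 - (r + 1)" "n - r - 1"] iqp_rec'[OF assms(2), of "n - r - 1" "n - r"]
          iqp_rec'[OF assms(2), of "n - 1 + (r - 1)" "n + r - 1"] iqp_rec'[OF assms(2), of "n + r - 1" "n + r"]
        by simp_all
      have t: "tri (r - 1) = tri r + (1 - r)" "tri (r + 1) = tri r + r"
        using triangle_Suc[of "r - 1"] triangle_Suc[of r] by (simp_all add: mult.commute)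
      have a: "?a (r - 1) = - ?a r * q / (x * q powi r)" "?a (r + 1) = - ?a r * x * q powi r"
        unfolding t using q assms(3) by (simp_all add: power_int_diff power_int_add)
      have "(1 - q powi (2 * n - 1)) * (1 - q powi (2 * n)) =
        (1 + q powi (2 * n - 1)) * ((1 - q powi (n - r)) * (1 - q powi (n + r)))
        + q powi (n - r) * ((1 - q powi (n + r)) * (1 - q powi (n + r - 1)))
        + q powi (n + r) * ((1 - q powi (n - r)) * (1 - q powi (n - r - 1)))"
        using q by (simp add: power_int_diff power_int_add powi_double) (simp add: field_simps)
      moreover have "- x * q powi (n - 1) * (- q / (x * q powi r)) = q powi (n - r)"
        "- (q powi n / x) * (- x * q powi r) = q powi (n + r)"
        using q assms(3) by (simp_all add: power_int_diff power_int_add)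
      ultimately show "(1 + q powi (2 * n - 1)) * (?a r * ?c (n - 1) r)
        + (- x * q powi (n - 1)) * (?a (r - 1) * ?c (n - 1) (r - 1))
        + (- (q powi n / x)) * (?a (r + 1) * ?c (n - 1) (r + 1)) =
          (1 - q powi (2 * n - 1)) * (1 - q powi (2 * n)) * (?a r * ?c n r)"
        unfolding c a by algebra
    qed
    also have "\<dots> = (1 - q powi (2 * n - 1)) * (1 - q powi (2 * n)) * bailey q ?a n"
      unfolding bailey_def by (simp only: infsum_cmult_right')
    finally show ?thesis by simp
  qed
  have fin: "qpoch q q (2 * n) * bailey q ?a (int n) = qpoch x q n * qpoch (q / x) q n" for n
  proof (induction n)
    case 0
    show ?case by (simp add: bailey_0)
  next
    case (Suc n)
    have e: "2 * int (Suc n) - 1 = int (Suc (2 * n))" "2 * int (Suc n) = int (Suc (Suc (2 * n)))" by simp_all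
    have "q powi (2 * int (Suc n) - 1) = q ^ (2 * n) * q" "q powi (2 * int (Suc n)) = q ^ Suc (2 * n) * q"
      using e by (simp_all only: power_int_of_nat power_Suc2)
    then have "qpoch q q (2 * Suc n) * bailey q ?a (int (Suc n))
       = qpoch q q (2 * n) * ((1 - q powi (2 * int (Suc n) - 1)) * (1 - q powi (2 * int (Suc n))) * bailey q ?a (int (Suc n)))"
      by (simp add: qpoch_Suc mult.assoc)
    also have "\<dots> = (1 - x * q ^ n) * (1 - q ^ n * q / x) * (qpoch q q (2 * n) * bailey q ?a (int n))"
      unfolding rec using q by (simp add: mult_ac power_int_add)
    also have "\<dots> = qpoch x q (Suc n) * qpoch (q / x) q (Suc n)"
      unfolding Suc by (simp add: qpoch_Suc mult_ac)
    finally show ?case .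
  qed
  have "strict_mono (\<lambda>n::nat. 2 * n)" by (simp add: strict_mono_def)
  from LIMSEQ_subseq_LIMSEQ[OF qpoch_tendsto[OF assms(2), of q] this]
  have "(\<lambda>n. qpoch q q (2 * n) * bailey q ?a (int n)) \<longlonglongrightarrow> qpoch_inf q q * ((\<Sum>\<^sub>\<infinity>r. ?a r) / (qpoch_inf q q)\<^sup>2)"
    by (intro tendsto_mult bailey_tendsto assms summ) (simp add: o_def)
  moreover have "(\<lambda>n. qpoch q q (2 * n) * bailey q ?a (int n)) \<longlonglongrightarrow> qpoch_inf x q * qpoch_inf (q / x) q"
    unfolding fin by (intro tendsto_mult qpoch_tendsto assms)
  ultimately have "qpoch_inf q q * ((\<Sum>\<^sub>\<infinity>r. ?a r) / (qpoch_inf q q)\<^sup>2) = qpoch_inf x q * qpoch_inf (q / x) q"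
    by (rule LIMSEQ_unique)
  then have "(\<Sum>\<^sub>\<infinity>r. ?a r) = theta_j x q"
    using qpoch_inf_nonzero[OF assms(2,2)] by (simp add: theta_j_def power2_eq_square field_simps)
  with summ show ?thesis by (simp add: has_sum_iff)
qed

subsection \<open>Bailey's lemma\<close>

text \<open>For d \<noteq> 0 this is (-d)^n q^(n(n-1)/2) (1/d;q)_n, and for d = 0 it is q^(n(n-1)):
  the numerator of the q-Gauss series after one parameter has gone to infinity.\<close>

definition gauss_prod :: "complex \<Rightarrow> complex \<Rightarrow> nat \<Rightarrow> complex" where
  "gauss_prod q d n = (\<Prod>i<n. q ^ i * (q ^ i - d))"

lemma gauss_prod_0 [simp]: "gauss_prod q d 0 = 1" by (simp add: gauss_prod_def)

lemma gauss_prod_Suc: "gauss_prod q d (Suc n) = gauss_prod q d n * (q ^ n * (q ^ n - d))"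
  by (simp add: gauss_prod_def)

lemma norm_gauss_prod_le:
  assumes "norm q < 1" "q \<noteq> 0"
  shows "norm (gauss_prod q d n) \<le> (1 + norm d) ^ n * norm q powi (tri (int n))"
proof (induction n)
  case (Suc n)
  have t: "tri (int (Suc n)) = tri (int n) + int n"
    using triangle_Suc[of "int n"] by (simp add: mult.commute add.commute)
  have "norm (q ^ n - d) \<le> norm (q ^ n) + norm d" by (rule norm_triangle_ineq4)
  also have "\<dots> \<le> 1 + norm d" using assms by (simp add: norm_power power_le_one)
  finally have "norm (gauss_prod q d n) * (norm q ^ n * norm (q ^ n - d))
     \<le> ((1 + norm d) ^ n * norm q powi (tri (int n))) * (norm q ^ n * (1 + norm d))"
    by (intro mult_mono Suc) auto
  then show ?case unfolding t using assms
    by (simp add: gauss_prod_Suc norm_mult norm_power power_int_add mult_ac)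
qed simp

lemma summable_gauss_prod:
  assumes "norm q < 1" "q \<noteq> 0" "0 \<le> C"
  shows "(\<lambda>n. norm (gauss_prod q d n) * C ^ n) summable_on UNIV"
proof (rule summable_on_norm_bound)
  show "(\<lambda>n. ((1 + norm d) * C) ^ n * norm q powi (tri (int n))) summable_on UNIV"
    by (rule summable_gauss_nat) (use assms in auto)
  show "norm (norm (gauss_prod q d n) * C ^ n) \<le> ((1 + norm d) * C) ^ n * norm q powi (tri (int n))" for n
    using mult_right_mono[OF norm_gauss_prod_le[OF assms(1,2), of d n], of "C ^ n"] assms(3)
    by (simp add: power_mult_distrib mult_ac)
qed

text \<open>The limiting case of the \<open>q\<close>-Gauss sum, with the numerator parameter \<open>1 / d\<close> scaled so
  that \<open>d = 0\<close> is allowed. Both sides satisfy the same first-order recurrence under \<open>c \<mapsto> c q\<close>.\<close>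

lemma limiting_q_gauss:
  assumes "norm q < 1" "q \<noteq> 0" "norm c < 1"
  shows "((\<lambda>n. gauss_prod q d n * c ^ n / (qpoch q q n * qpoch c q n)) has_sum
     (qpoch_inf (c * d) q / qpoch_inf c q)) UNIV"
proof -
  define t where "t = (\<lambda>c n. gauss_prod q d n * c ^ n / (qpoch q q n * qpoch c q n))"
  obtain M where M: "M > 0" "\<And>n. norm (1 / qpoch q q n) \<le> M" using qpoch_recip_bounded[OF assms(1,1)] by blast
  obtain K where K: "K > 0" "\<And>n. norm (1 / qpoch c q n) \<le> K" using qpoch_recip_bounded[OF assms(1,3)] by blast
  define L where "L = exp (norm c / (1 - norm q))"
  have ck: "norm (q ^ k * c) < 1" for k
  proof -
    have "norm (q ^ k * c) \<le> 1 * norm c" unfolding norm_mult norm_power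
      by (intro mult_right_mono power_le_one) (use assms in auto)
    then show ?thesis using assms by simp
  qed
  have nz: "qpoch (q ^ k * c) q n \<noteq> 0" "qpoch q q n \<noteq> 0" for k n
    using qpoch_nonzero[OF assms(1) ck] qpoch_nonzero[OF assms(1) assms(1)] by auto
  have rb: "norm (1 / qpoch (q ^ k * c) q n) \<le> L * K" for k n
  proof -
    have "1 / qpoch (q ^ k * c) q n = qpoch c q k * (1 / qpoch c q (k + n))"
      using nz(1)[of 0 k] by (simp add: qpoch_split)
    moreover have "norm (qpoch c q k) \<le> L" unfolding L_def by (rule norm_qpoch_le) (use assms in auto)
    ultimately show ?thesis
      by (simp only: norm_mult) (intro mult_mono K(2) norm_ge_zero, simp_all add: L_def)
  qed
  have tb: "norm (t (q ^ k * c) n) \<le> M * (L * K) * norm (gauss_prod q d n)" for k n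
  proof -
    have "norm (t (q ^ k * c) n) = norm (gauss_prod q d n) * norm (q ^ k * c) ^ n * norm (1 / qpoch q q n) * norm (1 / qpoch (q ^ k * c) q n)"
      unfolding t_def by (simp add: norm_mult norm_divide norm_power)
    also have "\<dots> \<le> norm (gauss_prod q d n) * 1 * M * (L * K)"
      using ck[of k] M rb[of k n] K by (intro mult_mono power_le_one mult_nonneg_nonneg) (auto simp: L_def)
    finally show ?thesis by (simp add: mult_ac)
  qed
  have sb: "(\<lambda>n. M * (L * K) * norm (gauss_prod q d n)) summable_on UNIV"
    using summable_gauss_prod[OF assms(1,2), of 1] by (intro summable_on_cmult_right) simp
  have st: "t (q ^ k * c) summable_on UNIV" for k
    by (rule summable_on_norm_bound[OF sb tb])
  define F where "F = (\<lambda>k. \<Sum>\<^sub>\<infinity>n. t (q ^ k * c) n)"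
  have rec: "(1 - q ^ k * c) * F k = (1 - q ^ k * (c * d)) * F (Suc k)" for k
  proof -
    let ?c = "q ^ k * c"
    define A where "A = (\<lambda>n. gauss_prod q d n * ?c ^ n / (qpoch q q n * qpoch (q * ?c) q n))"
    \<comment> \<open>\<open>G\<close> certifies the recurrence under c \<mapsto> c q: the termwise
      difference of its two sides is G n - G (n + 1). The factor 1 - q^n gives G 0 = 0, and G tends
      to 0, so the telescoped sum is 0.\<close>
    define G where "G = (\<lambda>n. A n * (1 - q ^ n) * (1 - q ^ n * ?c))"
    have n1: "1 - q ^ n * (q * ?c) \<noteq> 0" "1 - q ^ n * q \<noteq> 0" "1 - ?c \<noteq> 0" for n
      using power_mult_ne_1[OF assms(1) ck[of "Suc k"], of n] power_mult_ne_1[OF assms(1) assms(1), of n]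
        power_mult_ne_1[OF assms(1) ck[of k], of 0] by (auto simp: mult_ac)
    have n2: "qpoch (q * ?c) q n \<noteq> 0" for n using nz(1)[of "Suc k" n] by (simp add: mult_ac)
    have e1: "(1 - ?c) * t ?c n = A n * (1 - q ^ n * ?c)" for n
    proof -
      have "qpoch ?c q n * (1 - q ^ n * ?c) = (1 - ?c) * qpoch (q * ?c) q n"
        using qpoch_Suc[of ?c q n] qpoch_Suc_shift[of ?c q n] by simp
      then have "(1 - ?c) / qpoch ?c q n = (1 - q ^ n * ?c) / qpoch (q * ?c) q n"
        using nz(1)[of k n] n2[of n] by (simp add: frac_eq_eq) (simp only: mult.commute)
      moreover have "(1 - ?c) * t ?c n = gauss_prod q d n * ?c ^ n / qpoch q q n * ((1 - ?c) / qpoch ?c q n)"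
        by (simp add: t_def)
      ultimately show ?thesis by (simp add: A_def)
    qed
    have e2: "t (q ^ Suc k * c) n = A n * q ^ n" for n
      unfolding t_def A_def by (simp add: power_mult_distrib mult_ac)
    have e3: "G (Suc n) = A n * (?c * q ^ n * (q ^ n - d))" for n
      using n1(1,2)[of n] nz n2[of n] unfolding G_def A_def by (simp add: gauss_prod_Suc qpoch_Suc divide_simps mult_ac)
    have step: "(1 - ?c) * t ?c n - (1 - q ^ k * (c * d)) * t (q ^ Suc k * c) n = G n - G (Suc n)" for n
      unfolding e1 e2 e3 unfolding G_def by algebra
    have "(\<lambda>n. t ?c n) \<longlonglongrightarrow> 0" using summable_on_imp_summable[OF st] summable_LIMSEQ_zero by blast
    then have "(\<lambda>n. (1 - q ^ n) * ((1 - ?c) * t ?c n)) \<longlonglongrightarrow> (1 - 0) * ((1 - ?c) * 0)"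
      by (intro tendsto_intros LIMSEQ_power_zero assms)
    then have "G \<longlonglongrightarrow> 0" unfolding e1 G_def by (simp add: mult_ac)
    then have "(\<lambda>n. G n - G (Suc n)) sums (G 0 - 0)" by (rule telescope_sums')
    moreover have "((\<lambda>n. (1 - ?c) * t ?c n + (- (1 - q ^ k * (c * d))) * t (q ^ Suc k * c) n) has_sum
        ((1 - ?c) * F k + (- (1 - q ^ k * (c * d))) * F (Suc k))) UNIV"
      unfolding F_def by (intro has_sum_add has_sum_cmult_right has_sum_infsum st)
    from has_sum_imp_sums[OF this]
    have "(\<lambda>n. G n - G (Suc n)) sums ((1 - ?c) * F k - (1 - q ^ k * (c * d)) * F (Suc k))"
      unfolding step[symmetric] by (simp only: mult_minus_left diff_conv_add_uminus)
    ultimately show ?thesis using sums_unique2 by (fastforce simp: G_def)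
  qed
  have "qpoch c q k * F 0 = qpoch (c * d) q k * F k" for k
  proof (induction k)
    case (Suc k)
    have "qpoch c q (Suc k) * F 0 = (1 - q ^ k * c) * (qpoch c q k * F 0)" by (simp add: qpoch_Suc)
    also have "\<dots> = qpoch (c * d) q k * ((1 - q ^ k * c) * F k)" unfolding Suc by simp
    also have "\<dots> = qpoch (c * d) q (Suc k) * F (Suc k)" unfolding rec by (simp add: qpoch_Suc)
    finally show ?case .
  qed simp
  \<comment> \<open>After infinitely many steps c \<mapsto> c q the parameter is 0 and only the term
    n = 0 of the series survives.\<close>
  moreover have "F \<longlonglongrightarrow> (\<Sum>\<^sub>\<infinity>n::nat. if n = 0 then 1 else 0)"
    unfolding F_def
  proof (rule tannery_infsum[OF sb tb])
    fix n
    have qc: "(\<lambda>k. q ^ k * c) \<longlonglongrightarrow> 0"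
      by (rule tendsto_mult_left_zero) (use assms(1) in \<open>rule LIMSEQ_power_zero\<close>)
    then have "(\<lambda>k. t (q ^ k * c) n) \<longlonglongrightarrow> gauss_prod q d n * 0 ^ n / (qpoch q q n * (\<Prod>i<n. 1 - q ^ i * 0))"
      unfolding t_def qpoch_def[of "q ^ _ * c"] by (intro tendsto_intros) (use nz in auto)
    then show "(\<lambda>k. t (q ^ k * c) n) \<longlonglongrightarrow> (if n = 0 then 1 else 0)" by (cases n) auto
  qed
  moreover have "(\<Sum>\<^sub>\<infinity>n::nat. if n = 0 then 1 else 0) = (\<Sum>\<^sub>\<infinity>n\<in>{0::nat}. 1 :: complex)"
    by (rule infsum_cong_neutral) auto
  ultimately have "(\<lambda>k. qpoch c q k * F 0) \<longlonglongrightarrow> qpoch_inf (c * d) q * 1"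
    by (simp only:) (intro tendsto_mult qpoch_tendsto assms, simp)
  moreover have "(\<lambda>k. qpoch c q k * F 0) \<longlonglongrightarrow> qpoch_inf c q * F 0"
    by (intro tendsto_intros qpoch_tendsto assms)
  ultimately have "qpoch_inf c q * F 0 = qpoch_inf (c * d) q * 1" using LIMSEQ_unique by blast
  then have "F 0 = qpoch_inf (c * d) q / qpoch_inf c q"
    using qpoch_inf_nonzero[OF assms(1,3)] by (simp add: field_simps)
  moreover have "(t c has_sum F 0) UNIV" using has_sum_infsum[OF st[of 0]] unfolding F_def by simp
  ultimately show ?thesis unfolding t_def by simp
qed

text \<open>The terms with n < |r| vanish. Putting n = |r| + m turns the rest into the limiting
  q-Gauss series with c = q^(2|r|+1) and with d / q^|r| in place of d.\<close>

lemma conjugate_bailey: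
  fixes r :: int
  assumes "norm q < 1" "q \<noteq> 0"
  shows "((\<lambda>n. q ^ n * gauss_prod q d n * iqp2 q (int n) r) has_sum
     (q ^ nat \<bar>r\<bar> * gauss_prod q d (nat \<bar>r\<bar>) * qpoch_inf (q ^ Suc (nat \<bar>r\<bar>) * d) q / qpoch_inf q q)) UNIV"
proof -
  define s where "s = nat \<bar>r\<bar>"
  have rs: "iqp q (int n - r) * iqp q (int n + r) = iqp q (int n - int s) * iqp q (int n + int s)" for n
    by (cases "r \<ge> 0") (auto simp: s_def)
  have c: "norm (q ^ (2 * s) * q) < 1" using norm_power_less_1[OF assms(1), of "Suc (2 * s)"] by (simp add: mult.commute)
  have gp: "gauss_prod q d (s + m) = gauss_prod q d s * (gauss_prod q (d / q ^ s) m * (q ^ (2 * s)) ^ m)" for m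
  proof (induction m)
    case (Suc m)
    have "q ^ (s + m) * (q ^ (s + m) - d) = q ^ m * (q ^ m - d / q ^ s) * (q ^ s * q ^ s)"
      using assms by (simp add: power_add field_simps)
    moreover have "q ^ (2 * s) = q ^ s * q ^ s" by (simp add: mult_2 power_add)
    ultimately have "q ^ (s + m) * (q ^ (s + m) - d) = q ^ m * (q ^ m - d / q ^ s) * q ^ (2 * s)" by simp
    then show ?case using Suc by (simp add: gauss_prod_Suc mult_ac)
  qed simp
  have "((\<lambda>m. q ^ (s + m) * gauss_prod q d (s + m) * (iqp q (int (s + m) - int s) * iqp q (int (s + m) + int s)))
     has_sum (q ^ s * gauss_prod q d s / qpoch q q (2 * s) *
        (qpoch_inf (q ^ (2 * s) * q * (d / q ^ s)) q / qpoch_inf (q ^ (2 * s) * q) q))) UNIV"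
  proof (rule has_sum_cong[THEN iffD1, OF _ has_sum_cmult_right[OF limiting_q_gauss[OF assms c]]])
    fix m
    have "int (s + m) - int s = int m" "int (s + m) + int s = int (2 * s + m)" by simp_all
    then show "q ^ s * gauss_prod q d s / qpoch q q (2 * s) *
        (gauss_prod q (d / q ^ s) m * (q ^ (2 * s) * q) ^ m / (qpoch q q m * qpoch (q ^ (2 * s) * q) q m))
      = q ^ (s + m) * gauss_prod q d (s + m) * (iqp q (int (s + m) - int s) * iqp q (int (s + m) + int s))"
      by (simp only: iqp_nat gp qpoch_split[of q q "2 * s"]) (simp add: power_add power_mult_distrib mult_ac)
  qed
  also have "q ^ s * gauss_prod q d s / qpoch q q (2 * s) *
        (qpoch_inf (q ^ (2 * s) * q * (d / q ^ s)) q / qpoch_inf (q ^ (2 * s) * q) q)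
     = q ^ s * gauss_prod q d s * qpoch_inf (q ^ Suc s * d) q / qpoch_inf q q"
  proof -
    have "q ^ (2 * s) * q * (d / q ^ s) = q ^ Suc s * d" using assms by (simp add: mult_2 power_add)
    moreover have "qpoch_inf q q = qpoch q q (2 * s) * qpoch_inf (q ^ (2 * s) * q) q"
      by (rule qpoch_inf_split) fact
    ultimately show ?thesis by simp
  qed
  finally have "((\<lambda>n. q ^ n * gauss_prod q d n * (iqp q (int n - int s) * iqp q (int n + int s))) has_sum
      (q ^ s * gauss_prod q d s * qpoch_inf (q ^ Suc s * d) q / qpoch_inf q q)) {s..}"
    by (subst (asm) has_sum_reindex_bij_witness[of _ "\<lambda>n. n - s" "\<lambda>m. s + m" "{s..}" "\<lambda>n. q ^ n * gauss_prod q d n * (iqp q (int n - int s) * iqp q (int n + int s))"])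
       auto
  then have "((\<lambda>n. q ^ n * gauss_prod q d n * (iqp q (int n - int s) * iqp q (int n + int s))) has_sum
      (q ^ s * gauss_prod q d s * qpoch_inf (q ^ Suc s * d) q / qpoch_inf q q)) UNIV"
    by (subst (asm) has_sum_cong_neutral[of UNIV]) auto
  then show ?thesis unfolding rs s_def .
qed

text \<open>Insert the definition of \<beta>_n, exchange the sums over n and r, and evaluate the sum
  over n by \<open>conjugate_bailey\<close>. The exchange tolerates growth 2^|r| of
  \<open>a\<close>: on the support |r| \<le> n one has 2^|r| \<le> 4^n 2^(-|r|), and the Gaussian
  decay of \<open>gauss_prod\<close> absorbs 4^n.\<close>

lemma bailey_lemma:
  assumes "norm q < 1" "q \<noteq> 0" "\<And>r. norm (a r) \<le> B * 2 ^ nat \<bar>r\<bar>"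
  shows "((\<lambda>n. q ^ n * gauss_prod q d n * bailey q a (int n)) has_sum
     (\<Sum>\<^sub>\<infinity>r. a r * (q ^ nat \<bar>r\<bar> * gauss_prod q d (nat \<bar>r\<bar>) * qpoch_inf (q ^ Suc (nat \<bar>r\<bar>) * d) q)) / qpoch_inf q q) UNIV"
proof -
  let ?w = "\<lambda>r. q ^ nat \<bar>r\<bar> * gauss_prod q d (nat \<bar>r\<bar>) * qpoch_inf (q ^ Suc (nat \<bar>r\<bar>) * d) q"
  obtain M where M: "M > 0" "\<And>k. norm (iqp q k) \<le> M" using iqp_bounded[OF assms(1)] by blast
  have B: "B \<ge> 0" using order_trans[OF norm_ge_zero assms(3)[of 0]] by simp
  define f where "f = (\<lambda>(n::nat, r::int). q ^ n * gauss_prod q d n * (a r * iqp2 q (int n) r))"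
  have s1: "(\<lambda>n. B * M * M * (norm (gauss_prod q d n) * 4 ^ n)) summable_on UNIV"
    by (intro summable_on_cmult_right summable_gauss_prod assms) simp
  have s2: "(\<lambda>r::int. (1 / 2 :: real) ^ nat \<bar>r\<bar>) summable_on UNIV"
  proof (rule summable_on_int_split)
    have g: "(\<lambda>n::nat. (1 / 2 :: real) ^ n) summable_on UNIV"
      by (rule summable_nonneg_imp_summable_on) (auto intro: summable_geometric)
    then show "(\<lambda>n::nat. (1 / 2 :: real) ^ nat \<bar>int n\<bar>) summable_on UNIV" by simp
    have "nat \<bar>- 1 - int n\<bar> = Suc n" for n by simp
    then show "(\<lambda>n::nat. (1 / 2 :: real) ^ nat \<bar>- 1 - int n\<bar>) summable_on UNIV"
      using summable_on_cmult_right[OF g, of "1/2"] by simp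
  qed
  have s: "f summable_on UNIV \<times> UNIV"
  proof (rule summable_on_norm_bound)
    show "(\<lambda>(n, r). B * M * M * (norm (gauss_prod q d n) * 4 ^ n) * (1 / 2) ^ nat \<bar>r::int\<bar>) summable_on UNIV \<times> UNIV"
    proof (rule summable_on_SigmaI)
      show "((\<lambda>r. case (n, r) of (n, r) \<Rightarrow> B * M * M * (norm (gauss_prod q d n) * 4 ^ n) * (1 / 2) ^ nat \<bar>r::int\<bar>)
        has_sum (B * M * M * (norm (gauss_prod q d n) * 4 ^ n) * (\<Sum>\<^sub>\<infinity>r::int. (1 / 2) ^ nat \<bar>r\<bar>))) UNIV" for n
        unfolding prod.case by (intro has_sum_cmult_right has_sum_infsum s2)
    qed (use s1 B M in \<open>auto intro!: summable_on_cmult_left\<close>)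
    fix x :: "nat \<times> int"
    obtain n r where x: "x = (n, r)" by (cases x)
    show "norm (f x) \<le> (case x of (n, r) \<Rightarrow> B * M * M * (norm (gauss_prod q d n) * 4 ^ n) * (1 / 2) ^ nat \<bar>r\<bar>)"
    proof (cases "\<bar>r\<bar> \<le> int n")
      case True
      then have "(4::real) ^ nat \<bar>r\<bar> \<le> 4 ^ n" by (intro power_increasing) auto
      moreover have "(4::real) ^ k = 2 ^ k * 2 ^ k" for k by (simp flip: power_mult_distrib)
      ultimately have p: "2 ^ nat \<bar>r\<bar> \<le> 4 ^ n * (1 / 2 :: real) ^ nat \<bar>r\<bar>" by (simp add: power_divide field_simps)
      have "norm (f x) \<le> 1 ^ n * norm (gauss_prod q d n) * (B * 2 ^ nat \<bar>r\<bar> * (M * M))"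
        unfolding f_def x prod.case norm_mult norm_power
        using assms B M(1) by (intro mult_mono power_mono M(2) assms(3) mult_nonneg_nonneg) auto
      also have "\<dots> \<le> (B * M * M * norm (gauss_prod q d n)) * (4 ^ n * (1 / 2 :: real) ^ nat \<bar>r\<bar>)"
        using mult_left_mono[OF p, of "B * M * M * norm (gauss_prod q d n)"] B M by (simp add: mult_ac)
      finally show ?thesis unfolding x by (simp add: mult_ac)
    next
      case False
      then have "iqp q (int n - r) * iqp q (int n + r) = 0" by (cases "r \<ge> 0") auto
      then have "f x = 0" unfolding x f_def prod.case by (simp only: mult_zero_right)
      then show ?thesis unfolding x using B M by simp
    qed
  qed
  have in1: "((\<lambda>r. f (n, r)) has_sum (q ^ n * gauss_prod q d n * bailey q a (int n))) UNIV" for n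
    unfolding f_def bailey_def by (simp only: prod.case) (intro has_sum_cmult_right has_sum_infsum summable_bailey')
  have in2: "((\<lambda>n. f (n, r)) has_sum (a r * (?w r / qpoch_inf q q))) UNIV" for r
    using has_sum_cmult_right[OF conjugate_bailey[OF assms(1,2), of d r], of "a r"]
    by (simp add: f_def mult_ac)
  have tot: "(f has_sum infsum f (UNIV \<times> UNIV)) (UNIV \<times> UNIV)" using s by simp
  have 1: "((\<lambda>n. q ^ n * gauss_prod q d n * bailey q a (int n)) has_sum infsum f (UNIV \<times> UNIV)) UNIV"
    by (rule has_sum_SigmaD[OF tot in1])
  have "((\<lambda>r. a r * (?w r / qpoch_inf q q))
      has_sum infsum f (UNIV \<times> UNIV)) UNIV"
    by (rule has_sum_SigmaD[OF has_sum_swap[THEN iffD1, OF tot]]) (use in2 in simp)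
  then have "infsum f (UNIV \<times> UNIV) =
     (\<Sum>\<^sub>\<infinity>r. a r * ?w r * (1 / qpoch_inf q q))"
    by (simp add: infsumI)
  also have "\<dots> = (\<Sum>\<^sub>\<infinity>r. a r * ?w r) / qpoch_inf q q"
    by (subst infsum_cmult_left') simp
  finally show ?thesis using 1 by simp
qed

subsection \<open>Three Bailey pairs\<close>

lemma bailey_reflect: "bailey q (\<lambda>r. a (- r)) n = bailey q a n"
  unfolding bailey_def using infsum_int_uminus[of "\<lambda>r. a r * iqp2 q n r"]
  by (simp add: mult_ac)

text \<open>Creative telescoping: the hypothesis says that the summand is F (r + 1) - F r for F r =
  \<Omega> r / ((q;q)_{n-r} (q;q)_{n+r-1}), which has finite support. Symmetrising \<open>a\<close>
  first is harmless, because the kernel is even in \<open>r\<close>, and is what makes a simple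
  certificate \<Omega> exist in the uses below.\<close>

lemma bailey_step_telescope:
  fixes \<Omega> :: "int \<Rightarrow> complex"
  assumes "norm q < 1"
    and "\<And>r. (a r + a (- r)) * ((1 - q powi (n - r)) * (1 - q powi (n + r)) - k)
         = \<Omega> (r + 1) * (1 - q powi (n - r)) - \<Omega> r * (1 - q powi (n + r))"
  shows "bailey q a (n - 1) = k * bailey q a n"
proof -
  let ?b = "\<lambda>r. a r + a (- r)"
  let ?F = "\<lambda>r. \<Omega> r * (iqp q (n - r) * iqp q (n + r - 1))"
  have b: "bailey q ?b m = 2 * bailey q a m" for m
  proof -
    have "bailey q ?b m = bailey q a m + bailey q (\<lambda>r. a (- r)) m"
      unfolding bailey_def by (subst infsum_add[symmetric]) (simp_all add: distrib_right)
    then show ?thesis by (simp add: bailey_reflect)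
  qed
  have F: "?F summable_on UNIV" by (rule summable_bailey[of "\<bar>n\<bar> + 1"]) auto
  have "bailey q ?b (n - 1) = k * bailey q ?b n"
  proof (rule bailey_diff_eq_0[OF assms(1)])
    have "(\<Sum>\<^sub>\<infinity>r. ?b r * ((1 - q powi (n - r)) * (1 - q powi (n + r)) - k) * iqp2 q n r)
        = (\<Sum>\<^sub>\<infinity>r. ?F (r + 1) - ?F r)"
    proof (rule infsum_cong)
      fix r
      have e: "iqp q (n - (r + 1)) = (1 - q powi (n - r)) * iqp q (n - r)"
        "iqp q (n + r - 1) = (1 - q powi (n + r)) * iqp q (n + r)"
        using iqp_rec'[OF assms(1), of "n - (r + 1)" "n - r"] iqp_rec[OF assms(1), of "n + r"] by simp_all
      have "n + (r + 1) - 1 = n + r" by simp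
      show "?b r * ((1 - q powi (n - r)) * (1 - q powi (n + r)) - k) * iqp2 q n r = ?F (r + 1) - ?F r"
        unfolding assms(2) \<open>n + (r + 1) - 1 = n + r\<close> e by algebra
    qed
    then show "(\<Sum>\<^sub>\<infinity>r. ?b r * ((1 - q powi (n - r)) * (1 - q powi (n + r)) - k) * iqp2 q n r) = 0"
      using infsum_telescope[OF F] by simp
  qed
  then show ?thesis unfolding b by simp
qed

lemma powi_ne_1:
  fixes q :: complex
  assumes "norm q < 1" "q \<noteq> 0" "k \<noteq> 0"
  shows "q powi k \<noteq> 1" "q powi k \<noteq> - 1"
proof -
  have "norm (q powi k) \<noteq> 1"
  proof (cases "k > 0")
    case True
    have "norm q ^ nat k \<noteq> 1"
      using power_less_one_iff[of "norm q" "nat k"] assms True by auto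
    then show ?thesis using True by (simp add: power_int_def norm_power)
  next
    case False
    have "norm q ^ nat (- k) \<noteq> 1"
      using power_less_one_iff[of "norm q" "nat (- k)"] assms False by auto
    then show ?thesis using False assms by (simp add: power_int_def norm_power norm_inverse power_inverse inverse_eq_1_iff)
  qed
  then show "q powi k \<noteq> 1" "q powi k \<noteq> - 1" by auto
qed

text \<open>Antisymmetric extension of \<open>\<Sum>j=0..r. q powi (- j (j + 1) / 2)\<close> to all integers \<open>r\<close>.\<close>

definition psi_sum :: "complex \<Rightarrow> int \<Rightarrow> complex" where
  "psi_sum q r = (\<Sum>j\<in>{0..r}. q powi (- (j * (j + 1) div 2))) - (\<Sum>j\<in>{0..- r - 2}. q powi (- (j * (j + 1) div 2)))"

lemma psi_sum_reflect: "psi_sum q (- r) = - psi_sum q (r - 2)"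
  by (simp add: psi_sum_def)

lemma psi_sum_0: "psi_sum q 0 = 1" by (simp add: psi_sum_def)

lemma int_atLeastAtMost_Suc: "(0::int) \<le> r \<Longrightarrow> {0..r} = insert r {0..r - 1}" by auto

lemma psi_sum_diff: "psi_sum q r - psi_sum q (r - 1) = q powi (- (r * (r + 1) div 2))"
proof (cases "r \<ge> 0")
  case True
  then show ?thesis by (simp add: psi_sum_def int_atLeastAtMost_Suc[OF True])
next
  case False
  then have "{0..- (r - 1) - 2} = insert (- r - 1) {0..- r - 2}" by auto
  moreover have "(- r - 1) * (- r - 1 + 1) = r * (r + 1)" by algebra
  ultimately show ?thesis using False by (simp add: psi_sum_def)
qed

text \<open>Partner of \<beta>_n = 1/(q;q^2)_n. The further weight q^(r^2) from the case d = 0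
  raises the exponent to 2 r^2 + r, which is what the double sum shows along r + s = const.\<close>

definition psi_alpha :: "complex \<Rightarrow> int \<Rightarrow> complex" where
  "psi_alpha q r = (- 1) powi r * q powi (r * r + r) * psi_sum q r"

lemma minus_one_powi_uminus: "(- 1 :: complex) powi (- r) = (- 1) powi r"
  by (simp add: power_int_minus power_int_def flip: power_inverse)

text \<open>Replacing squares in this way makes many identities and inequalities between exponents
  linear in the triangular numbers.\<close>

lemma square_triangle: "(r::int) * r = 2 * (tri r) + r"
  using triangle_double[of r] by (simp add: algebra_simps)

lemma bailey_psi_rec:
  assumes "norm q < 1" "q \<noteq> 0" "n \<noteq> 0"
  shows "bailey q (psi_alpha q) (n - 1) = (1 - q powi (2 * n - 1)) * bailey q (psi_alpha q) n"
proof -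
  \<comment> \<open>The certificate has a multiple of \<open>psi_sum\<close>, which matches the
    \<open>psi_sum\<close> terms of the symmetrised summand, and two elementary terms, which absorb
    the monomials left by \<open>psi_sum_diff\<close>. The denominator 1 - q^n is where n \<noteq> 0
    enters.\<close>
  define \<Omega> where "\<Omega> = (\<lambda>r. (- 1) powi r * q powi n * (psi_sum q (r - 1) * (q powi (r * r - 1) - q powi (r * r - 2 * r))
     + q powi (tri r - r) + (1 - q powi (n - 1)) / (1 - q powi n) * q powi (tri r)))"
  show ?thesis
  proof (rule bailey_step_telescope[OF assms(1), of _ _ _ \<Omega>], goal_cases)
    case (1 r)
    \<comment> \<open>Every power of q becomes a monomial in \<open>W\<close>, \<open>X\<close>,
      \<open>N\<close> and q, and every value of \<open>psi_sum\<close> is expressed through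
      \<open>S\<close>; what remains is an identity of rational functions.\<close>
    define W X N S s where "W = q powi (tri r)" and "X = q powi r" and "N = q powi n"
      and "S = psi_sum q r" and "s = (- 1 :: complex) powi r"
    have nz: "W \<noteq> 0" "X \<noteq> 0" "N \<noteq> 0" "1 - N \<noteq> 0"
      using assms powi_ne_1(1)[OF assms] by (auto simp: W_def X_def N_def)
    have d1: "psi_sum q (r - 1) = S - 1 / (W * X)"
      using psi_sum_diff[of q r] triangle_Suc[of r] assms(2)
      by (simp add: S_def W_def X_def power_int_minus power_int_add power_int_diff algebra_simps divide_simps)
    have "psi_sum q (r - 1) - psi_sum q (r - 2) = 1 / W"
      using psi_sum_diff[of q "r - 1"] assms(2) by (simp add: W_def power_int_minus divide_simps mult.commute)
    then have d2: "psi_sum q (- r) = 1 / W - (S - 1 / (W * X))"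
      unfolding psi_sum_reflect d1 by (simp add: algebra_simps)
    have e: "q powi (r * r) = W * W * X"
      unfolding square_triangle[of r] W_def X_def
      by (subst power_int_add, simp add: assms(2), subst powi_double, rule assms(2), rule refl)
    have t: "tri (r + 1) = tri r + r" using triangle_Suc[of r] by (simp add: mult.commute)
    have sq: "(r + 1) * (r + 1) = r * r + (2 * r + 1)" "(- r) * (- r) + - r = r * r - r" by algebra+
    have a1: "psi_alpha q r = s * (W * W * X * X) * S"
      unfolding psi_alpha_def S_def s_def using assms(2) e by (simp add: power_int_add X_def)
    have a2: "psi_alpha q (- r) = s * (W * W) * (1 / W - (S - 1 / (W * X)))"
      unfolding psi_alpha_def d2 sq minus_one_powi_uminus s_def X_def using assms(2) e nz by (simp add: power_int_diff X_def)
    have o1: "\<Omega> r = s * N * ((S - 1 / (W * X)) * (W * W * X / q - W * W / X) + W / X + (1 - N / q) / (1 - N) * W)"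
      unfolding \<Omega>_def d1 s_def[symmetric] using assms(2) e nz
      by (simp add: power_int_diff powi_double W_def[symmetric] X_def[symmetric] N_def[symmetric])
    have o2: "\<Omega> (r + 1) = - s * N * (S * (W * W * X * X * X - W * W * X / q) + W / q + (1 - N / q) / (1 - N) * (W * X))"
    proof -
      have "q powi ((r + 1) * (r + 1) - 1) = W * W * X * X * X" "q powi ((r + 1) * (r + 1) - 2 * (r + 1)) = W * W * X / q"
        "q powi (tri (r + 1) - (r + 1)) = W / q" "q powi (tri (r + 1)) = W * X"
        unfolding t sq using assms(2) e nz
        by (simp_all add: power_int_add power_int_diff powi_double W_def[symmetric] X_def[symmetric] N_def[symmetric] distrib_left)
      then show ?thesis unfolding \<Omega>_def using assms(2)
        by (simp add: s_def S_def N_def power_int_add power_int_diff)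
    qed
    have x: "q powi (n - r) = N / X" "q powi (n + r) = N * X" "q powi (2 * n - 1) = N * N / q"
      using assms(2) by (simp_all add: N_def X_def power_int_add power_int_diff powi_double)
    show ?case unfolding a1 a2 o1 o2 x
      using nz assms(2) by (simp add: divide_simps) algebra
  qed
qed

lemma bailey_psi:
  assumes "norm q < 1" "q \<noteq> 0"
  shows "bailey q (psi_alpha q) (int n) = 1 / qpoch q (q\<^sup>2) n"
proof (induction n)
  case 0
  show ?case by (simp add: bailey_0 psi_alpha_def psi_sum_0)
next
  case (Suc n)
  have "2 * int (Suc n) - 1 = int (2 * n + 1)" by simp
  then have p: "q powi (2 * int (Suc n) - 1) = (q\<^sup>2) ^ n * q"
    by (simp only: power_int_of_nat power_add power_mult power_one_right)
  have "1 - (q\<^sup>2) ^ n * q \<noteq> 0"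
    using power_mult_ne_1[OF norm_power2_less_1[OF assms(1)] assms(1), of n] by simp
  moreover have "bailey q (psi_alpha q) (int n) = (1 - (q\<^sup>2) ^ n * q) * bailey q (psi_alpha q) (int (Suc n))"
    using bailey_psi_rec[OF assms, of "int (Suc n)"] unfolding p by simp
  ultimately have "bailey q (psi_alpha q) (int (Suc n)) = 1 / qpoch q (q\<^sup>2) n / (1 - (q\<^sup>2) ^ n * q)"
    using Suc by (metis nonzero_mult_div_cancel_left)
  then show ?case by (simp add: qpoch_Suc)
qed

text \<open>An even function of \<open>r\<close>, being \<alpha>_r distributed equally over r and
  -r. The factor 2 offsets the denominator at r = 0 and so gives \<beta>_0 = 1.\<close>

definition mu_alpha :: "complex \<Rightarrow> int \<Rightarrow> complex" where
  "mu_alpha q r = 2 * (- 1) powi r * q powi (r * (r + 1) div 2) / (1 + q powi r)"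

lemma one_plus_powi_nonzero:
  fixes q :: complex
  assumes "norm q < 1" "q \<noteq> 0"
  shows "1 + q powi k \<noteq> 0"
  using powi_ne_1(2)[OF assms, of k] by (cases "k = 0") (auto simp: add_eq_0_iff)

lemma bailey_mu_rec:
  assumes "norm q < 1" "q \<noteq> 0" "n \<noteq> 0"
  shows "bailey q (mu_alpha q) (n - 1) = (1 + q powi n)\<^sup>2 * bailey q (mu_alpha q) n"
proof -
  \<comment> \<open>There is no inner sum this time, so a single Gaussian monomial is certificate
    enough.\<close>
  define \<Omega> where "\<Omega> = (\<lambda>r. 4 * q powi n / (1 - q powi n) * ((- 1) powi r * q powi (tri r)))"
  show ?thesis
  proof (rule bailey_step_telescope[OF assms(1), of _ _ _ \<Omega>], goal_cases)
    case (1 r)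
    define W X N s where "W = q powi (tri r)" and "X = q powi r" and "N = q powi n"
      and "s = (- 1 :: complex) powi r"
    have nz: "W \<noteq> 0" "X \<noteq> 0" "N \<noteq> 0" "1 - N \<noteq> 0" "1 + X \<noteq> 0"
      using assms powi_ne_1(1)[OF assms] one_plus_powi_nonzero[OF assms(1,2)] by (auto simp: W_def X_def N_def)
    have a1: "mu_alpha q r = 2 * s * (W * X) / (1 + X)"
      unfolding mu_alpha_def triangle_Suc using assms(2) by (simp add: power_int_add s_def W_def X_def)
    have "(- r) * (- r + 1) = r * (r - 1)" by algebra
    then have t': "(- r) * (- r + 1) div 2 = tri r" by (simp only:)
    have a2: "mu_alpha q (- r) = 2 * s * (W * X) / (1 + X)"
      unfolding mu_alpha_def minus_one_powi_uminus t' W_def[symmetric] s_def[symmetric] using assms(2) nz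
      by (simp add: power_int_minus X_def[symmetric] divide_simps add.commute)
    have t: "tri (r + 1) = tri r + r" using triangle_Suc[of r] by (simp add: mult.commute)
    have o1: "\<Omega> r = 4 * N / (1 - N) * (s * W)" unfolding \<Omega>_def by (simp add: s_def W_def N_def)
    have o2: "\<Omega> (r + 1) = 4 * N / (1 - N) * (- s * (W * X))"
      unfolding \<Omega>_def t using assms(2) by (simp add: s_def W_def N_def X_def power_int_add)
    have x: "q powi (n - r) = N / X" "q powi (n + r) = N * X"
      using assms(2) by (simp_all add: N_def X_def power_int_add power_int_diff)
    show ?case unfolding a1 a2 o1 o2 x N_def[symmetric]
      using nz by (simp add: divide_simps) algebra
  qed
qed

lemma bailey_mu:
  assumes "norm q < 1" "q \<noteq> 0"
  shows "bailey q (mu_alpha q) (int n) = 1 / (qpoch (- q) q n)\<^sup>2"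
proof (induction n)
  case 0
  show ?case by (simp add: bailey_0 mu_alpha_def)
next
  case (Suc n)
  have p: "q powi (int (Suc n)) = q ^ n * q"
    by (simp only: power_int_of_nat power_Suc2)
  have "1 + q ^ n * q \<noteq> 0"
    using one_plus_powi_nonzero[OF assms, of "int (Suc n)"] unfolding p .
  moreover have "bailey q (mu_alpha q) (int n) = (1 + q ^ n * q)\<^sup>2 * bailey q (mu_alpha q) (int (Suc n))"
    using bailey_mu_rec[OF assms, of "int (Suc n)"] unfolding p by simp
  ultimately have "bailey q (mu_alpha q) (int (Suc n)) = 1 / (qpoch (- q) q n)\<^sup>2 / (1 + q ^ n * q)\<^sup>2"
    using Suc by (metis nonzero_mult_div_cancel_left power_not_zero)
  then show ?case by (simp add: qpoch_Suc power_mult_distrib)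
qed

text \<open>The second sum extends the symmetric sum over |j| \<le> r to negative r
  antisymmetrically about -1/2, so that \<open>phi_sum_diff\<close> holds for all integers.\<close>

definition phi_sum :: "complex \<Rightarrow> int \<Rightarrow> complex" where
  "phi_sum q r = (\<Sum>j\<in>{- r..r}. (- 1) powi j * q powi (- (j * j))) - (\<Sum>j\<in>{r + 1..- r - 1}. (- 1) powi j * q powi (- (j * j)))"

lemma phi_sum_reflect: "phi_sum q (- r) = - phi_sum q (r - 1)"
  by (simp add: phi_sum_def)

lemma phi_sum_0: "phi_sum q 0 = 1" by (simp add: phi_sum_def)

lemma phi_sum_diff: "phi_sum q r - phi_sum q (r - 1) = 2 * ((- 1) powi r * q powi (- (r * r)))"
proof -
  consider "r > 0" | "r = 0" | "r < 0" by linarith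
  then show ?thesis
  proof cases
    case 1
    then have "{- r..r} = insert r (insert (- r) {- (r - 1)..r - 1})" by auto
    then show ?thesis using 1 by (simp add: phi_sum_def minus_one_powi_uminus)
  next
    case 2
    then show ?thesis by (simp add: phi_sum_def)
  next
    case 3
    then have "{r..- r} = insert r (insert (- r) {r + 1..- r - 1})" by auto
    then show ?thesis using 3 by (simp add: phi_sum_def minus_one_powi_uminus)
  qed
qed

definition phi_alpha :: "complex \<Rightarrow> int \<Rightarrow> complex" where
  "phi_alpha q r = q powi (2 * (r * r) + r) * phi_sum q r"

lemma bailey_phi_rec:
  assumes "norm q < 1" "q \<noteq> 0" "n \<noteq> 0"
  shows "bailey (q\<^sup>2) (phi_alpha q) (n - 1) =
    (1 + q powi (2 * n - 1)) * (1 + q powi (2 * n)) * bailey (q\<^sup>2) (phi_alpha q) n"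
proof -
  have p2: "(q\<^sup>2) powi k = q powi (2 * k)" for k using power_int_mult[of q 2 k] by simp
  \<comment> \<open>Same shape as for psi, in base q^2: a multiple of \<open>phi_sum\<close> and one
    elementary term cleaning up after \<open>phi_sum_diff\<close>.\<close>
  define \<Omega> where "\<Omega> = (\<lambda>r. q powi (2 * n) * (- (phi_sum q (r - 1) * (q powi (2 * (r * r) - r) * (1 / q + q powi (- 2 * r))))
     + 2 * (1 + q powi (2 * n - 1)) / (1 - q powi (2 * n)) * ((- 1) powi r * q powi (r * r - r))))"
  show ?thesis
  proof (rule bailey_step_telescope[OF norm_power2_less_1[OF assms(1)], of _ _ _ \<Omega>], goal_cases)
    case (1 r)
    define R X N S s where "R = q powi (r * r)" and "X = q powi r" and "N = q powi (2 * n)"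
      and "S = phi_sum q r" and "s = (- 1 :: complex) powi r"
    have nz: "R \<noteq> 0" "X \<noteq> 0" "N \<noteq> 0" "1 - N \<noteq> 0"
      using assms powi_ne_1(1)[OF assms(1,2), of "2 * n"] by (auto simp: R_def X_def N_def)
    have ss: "s * s = 1" unfolding s_def by (simp add: power_int_def flip: power_mult_distrib)
    have d1: "phi_sum q (r - 1) = S - 2 * s / R"
      using phi_sum_diff[of q r] assms(2)
      by (simp add: S_def R_def s_def power_int_minus algebra_simps divide_simps)
    have d2: "phi_sum q (- r) = 2 * s / R - S" unfolding phi_sum_reflect d1 by simp
    have add: "q powi (i + j) = q powi i * q powi j" for i j using assms(2) by (simp add: power_int_add)
    have sq: "2 * ((r + 1) * (r + 1)) - (r + 1) = 2 * (r * r) + (2 * r + (r + 1))" "(r + 1) * (r + 1) - (r + 1) = r * r + r"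
      "- 2 * (r + 1) = - (2 * r) - 2"
      by algebra+
    have a1: "phi_alpha q r = R * R * X * S"
      unfolding phi_alpha_def S_def using assms(2) by (simp add: power_int_add powi_double X_def R_def)
    have a2: "phi_alpha q (- r) = R * R / X * (2 * s / R - S)"
      unfolding phi_alpha_def d2 using assms(2) by (simp add: power_int_diff powi_double X_def R_def)
    have o1: "\<Omega> r = N * (- ((S - 2 * s / R) * (R * R / X * (1 / q + 1 / (X * X)))) + 2 * (1 + N / q) / (1 - N) * (s * (R / X)))"
      unfolding \<Omega>_def d1 using assms(2) nz
      by (simp add: power_int_diff power_int_minus powi_double s_def[symmetric] R_def[symmetric] X_def[symmetric] N_def[symmetric] divide_simps)
    have o2: "\<Omega> (r + 1) = N * (- (S * (R * R * X * X * X * q * (1 / q + 1 / (X * X * q * q)))) + 2 * (1 + N / q) / (1 - N) * (- s * (R * X)))"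
    proof -
      have "q powi (2 * ((r + 1) * (r + 1)) - (r + 1)) = R * R * X * X * X * q" "q powi ((r + 1) * (r + 1) - (r + 1)) = R * X"
        "q powi (- 2 * (r + 1)) = 1 / (X * X * q * q)" "q powi (2 * n - 1) = N / q"
        unfolding sq add powi_double[OF assms(2)] using assms(2) nz
        by (simp_all add: power_int_diff power_int_minus powi_double R_def X_def N_def power2_eq_square divide_simps)
      then show ?thesis unfolding \<Omega>_def using assms(2)
        by (simp add: s_def S_def N_def power_int_add)
    qed
    have x: "(q\<^sup>2) powi (n - r) = N / (X * X)" "(q\<^sup>2) powi (n + r) = N * (X * X)" "q powi (2 * n - 1) = N / q"
      unfolding p2 using assms(2) by (simp_all add: N_def X_def power_int_add power_int_diff powi_double right_diff_distrib distrib_left)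
    show ?case unfolding a1 a2 o1 o2 x N_def[symmetric]
      using nz assms(2) by (simp add: divide_simps) algebra
  qed
qed

lemma bailey_phi:
  assumes "norm q < 1" "q \<noteq> 0"
  shows "bailey (q\<^sup>2) (phi_alpha q) (int n) = 1 / qpoch (- q) q (2 * n)"
proof (induction n)
  case 0
  show ?case by (simp add: bailey_0 phi_alpha_def phi_sum_0)
next
  case (Suc n)
  have e: "2 * int (Suc n) - 1 = int (Suc (2 * n))" "2 * int (Suc n) = int (Suc (Suc (2 * n)))" by simp_all
  have p: "q powi (2 * int (Suc n) - 1) = q ^ (2 * n) * q" "q powi (2 * int (Suc n)) = q ^ Suc (2 * n) * q"
    using e by (simp_all only: power_int_of_nat power_Suc2)
  have "1 + q ^ (2 * n) * q \<noteq> 0" "1 + q ^ Suc (2 * n) * q \<noteq> 0"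
    using one_plus_powi_nonzero[OF assms, of "2 * int (Suc n) - 1"] one_plus_powi_nonzero[OF assms, of "2 * int (Suc n)"] unfolding p by auto
  moreover have pred: "int (Suc n) - 1 = int n" by simp
  ultimately have "bailey (q\<^sup>2) (phi_alpha q) (int (Suc n)) =
      bailey (q\<^sup>2) (phi_alpha q) (int n) / ((1 + q ^ (2 * n) * q) * (1 + q ^ Suc (2 * n) * q))"
    using bailey_phi_rec[OF assms, of "int (Suc n)"] unfolding p pred
    by (simp add: nonzero_eq_divide_eq mult_ac del: of_nat_Suc power_Suc)
  also have "\<dots> = 1 / qpoch (- q) q (2 * Suc n)"
    unfolding Suc by (simp add: qpoch_Suc mult_ac)
  finally show ?case .
qed

subsection \<open>Mock theta functions as bilateral sums\<close>

text \<open>The bound must not depend on \<open>k\<close>. For k < 0 the factor q^(-k) is extracted,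
  which has norm at most 1 and leaves the case of positive exponent.\<close>

lemma norm_recip_one_plus_powi_le:
  fixes q :: complex
  assumes "norm q < 1" "q \<noteq> 0"
  shows "norm (1 / (1 + q powi k)) \<le> 1 / (1 - norm q)"
proof -
  have pos: "norm (1 / (1 + q powi k)) \<le> 1 / (1 - norm q)" if "k > 0" for k
  proof -
    have "norm q powi k \<le> norm q powi 1" using assms that by (intro power_int_decreasing) auto
    then have "1 - norm q \<le> norm (1::complex) - norm (- (q powi k))" by (simp add: norm_power_int)
    also have "\<dots> \<le> norm (1 - (- (q powi k)))" by (rule norm_triangle_ineq2)
    finally have "1 - norm q \<le> norm (1 + q powi k)" by simp
    then show ?thesis using assms by (simp add: norm_divide frac_le)
  qed
  consider "k > 0" | "k = 0" | "k < 0" by linarith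
  then show ?thesis
  proof cases
    case 1 then show ?thesis by (rule pos)
  next
    case 2 then show ?thesis using assms by (simp add: field_simps)
  next
    case 3
    have "1 / (1 + q powi k) = q powi (- k) * (1 / (1 + q powi (- k)))"
      using assms one_plus_powi_nonzero[OF assms, of k] one_plus_powi_nonzero[OF assms, of "- k"]
      by (simp add: power_int_minus divide_simps)
    moreover have "norm (q powi (- k)) \<le> 1"
      using 3 assms power_int_decreasing[of 0 "- k" "norm q"] by (simp add: norm_power_int)
    moreover from this have "norm (q powi (- k)) * norm (1 / (1 + q powi (- k))) \<le> 1 * (1 / (1 - norm q))"
      using 3 by (intro mult_mono pos) auto
    ultimately show ?thesis by (simp only: norm_mult mult_1_left)
  qed
qed

lemma summable_theta_bounded:
  fixes q :: complex and c :: "int \<Rightarrow> complex"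
  assumes "norm q < 1" "q \<noteq> 0" "k > 0" "\<And>u. norm (c u) \<le> M"
  shows "(\<lambda>u. q powi (k * tri u + j * u) * c u) summable_on UNIV"
proof (rule summable_on_norm_bound)
  have "norm q powi k < 1"
    using assms power_int_strict_decreasing[of 0 k "norm q"] by simp
  then show "(\<lambda>u. M * ((norm q powi j) powi u * (norm q powi k) powi (tri u))) summable_on UNIV"
    using assms by (intro summable_on_cmult_right summable_gauss) auto
  fix u
  have "norm (q powi (k * tri u + j * u) * c u) \<le> norm q powi (k * tri u + j * u) * M"
    unfolding norm_mult norm_power_int by (intro mult_left_mono assms) simp
  also have "\<dots> = M * ((norm q powi j) powi u * (norm q powi k) powi (tri u))"
    using assms by (simp add: power_int_add power_int_mult)
  finally show "norm (q powi (k * tri u + j * u) * c u) \<le> M * ((norm q powi j) powi u * (norm q powi k) powi (tri u))" .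
qed

lemma summable_lambert:
  fixes q :: complex
  assumes "norm q < 1" "q \<noteq> 0" "k > 0"
  shows "(\<lambda>u. q powi (k * tri u + j * u) / (1 + q powi (m * u))) summable_on UNIV"
proof -
  have "norm (1 / (1 + q powi (m * u))) \<le> 1 / (1 - norm q)" for u
    by (rule norm_recip_one_plus_powi_le[OF assms(1,2)])
  from summable_theta_bounded[OF assms this, of j] show ?thesis by simp
qed

lemma norm_powi_le_1:
  fixes q :: complex
  assumes "norm q < 1" "q \<noteq> 0" "0 \<le> k"
  shows "norm q powi k \<le> 1"
  using assms power_int_decreasing[of 0 k "norm q"] by simp

lemma linear_le_power2: "real_of_int (\<bar>r\<bar> + 1) \<le> 2 ^ nat \<bar>r\<bar>"
proof -
  have "real n + 1 \<le> 2 ^ n" for n :: nat by (induction n) auto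
  from this[of "nat \<bar>r\<bar>"] show ?thesis by simp
qed

lemma norm_psi_sum_le:
  assumes "norm q < 1" "q \<noteq> 0"
  shows "norm (psi_sum q r) \<le> real_of_int (\<bar>r\<bar> + 1) * norm q powi (- (tri r + r))"
proof -
  have mono: "j * (j + 1) div 2 \<le> r * (r + 1) div 2" if "0 \<le> j" "j \<le> r \<or> j \<le> - r - 2" for j
  proof -
    have "j * (j + 1) \<le> r * (r + 1)"
      using that(2)
    proof
      assume "j \<le> r" then show ?thesis using that by (intro mult_mono) auto
    next
      assume "j \<le> - r - 2"
      then have "j * (j + 1) \<le> (- r - 1) * (- r)" using that by (intro mult_mono) auto
      then show ?thesis by (simp add: algebra_simps)
    qed
    then show ?thesis by (rule zdiv_mono1) simp
  qed
  have tm: "norm (q powi (- (j * (j + 1) div 2))) \<le> norm q powi (- (tri r + r))" if "0 \<le> j" "j \<le> r \<or> j \<le> - r - 2" for j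
    unfolding norm_power_int triangle_Suc[symmetric] using mono[OF that] assms by (intro power_int_decreasing) auto
  have sum: "norm (\<Sum>j\<in>{0..s}. q powi (- (j * (j + 1) div 2))) \<le> real (nat (s + 1)) * norm q powi (- (tri r + r))"
    if "s \<le> r \<or> s \<le> - r - 2" for s
    using sum_norm_bound[of "{0..s}" "\<lambda>j. q powi (- (j * (j + 1) div 2))" "norm q powi (- (tri r + r))"] tm that
    by (auto simp: add.commute)
  show ?thesis
  proof (cases "r \<ge> 0")
    case True
    then have "real (nat (r + 1)) = real_of_int (\<bar>r\<bar> + 1)" by simp
    then show ?thesis using sum[of r] True by (simp add: psi_sum_def)
  next
    case False
    have "real (nat (- r - 2 + 1)) \<le> real_of_int (\<bar>r\<bar> + 1)" using False by simp
    then have "real (nat (- r - 2 + 1)) * norm q powi (- (tri r + r)) \<le> real_of_int (\<bar>r\<bar> + 1) * norm q powi (- (tri r + r))"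
      by (rule mult_right_mono) simp
    then show ?thesis using order_trans[OF sum[of "- r - 2"]] False by (simp add: psi_sum_def)
  qed
qed

lemma norm_minus_one_powi [simp]: "norm ((- 1 :: complex) powi r) = 1"
  by (simp add: norm_power_int)

text \<open>The inner sum contributes at worst q^(-(tri r + r)) with a linear number of terms,
  against q^(2 tri r + 2 r) in front. The exponent left over is tri (- r) \<ge> 0.\<close>

lemma norm_psi_alpha_le:
  assumes "norm q < 1" "q \<noteq> 0"
  shows "norm (psi_alpha q r) \<le> 1 * 2 ^ nat \<bar>r\<bar>"
proof -
  have e: "r * r + r = 2 * tri r + 2 * r" using square_triangle[of r] by simp
  have "norm (psi_alpha q r) \<le> norm q powi (2 * tri r + 2 * r) * (real_of_int (\<bar>r\<bar> + 1) * norm q powi (- (tri r + r)))"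
    unfolding psi_alpha_def e norm_mult norm_power_int norm_minus_cancel norm_one power_int_1_left mult_1_left
    using norm_psi_sum_le[OF assms, of r] by (intro mult_mono) auto
  also have "\<dots> = real_of_int (\<bar>r\<bar> + 1) * norm q powi (2 * tri r + 2 * r + - (tri r + r))"
    using assms by (subst power_int_add) auto
  also have "2 * tri r + 2 * r + - (tri r + r) = tri (- r)" unfolding triangle_uminus by simp
  also have "real_of_int (\<bar>r\<bar> + 1) * norm q powi tri (- r) \<le> 2 ^ nat \<bar>r\<bar> * 1"
    by (intro mult_mono linear_le_power2 norm_powi_le_1 triangle_nonneg assms) auto
  finally show ?thesis by simp
qed

lemma gauss_prod_zero: "q ^ n * gauss_prod q 0 n = q ^ (n\<^sup>2)"
proof (induction n)
  case (Suc n)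
  have "(Suc n)\<^sup>2 = n\<^sup>2 + n + n + 1" by (simp add: power2_eq_square)
  then have "q ^ ((Suc n)\<^sup>2) = (q ^ n * gauss_prod q 0 n) * q ^ n * q ^ n * q"
    unfolding Suc by (simp add: power_add)
  then show ?case by (simp add: gauss_prod_Suc mult_ac)
qed simp

text \<open>The case d = 0 of \<open>bailey_lemma\<close>: both sides of the pair receive the weight
  q^(n^2), and the product (0;q)_\<infinity> is 1.\<close>

lemma mock_psi_bilateral:
  assumes "norm q < 1" "q \<noteq> 0"
  shows "qpoch_inf q q * mock_psi q = (\<Sum>\<^sub>\<infinity>r. (- 1) powi r * q powi (2 * (r * r) + r) * psi_sum q r)"
proof -
  let ?S = "\<Sum>\<^sub>\<infinity>r. psi_alpha q r * q ^ ((nat \<bar>r\<bar>)\<^sup>2)"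
  have q0: "qpoch_inf 0 q = 1" unfolding qpoch_inf_def by simp
  have "((\<lambda>n. q ^ (n\<^sup>2) / qpoch q (q\<^sup>2) n) has_sum
     ?S / qpoch_inf q q) UNIV"
    using bailey_lemma[where a = "psi_alpha q", OF assms norm_psi_alpha_le[OF assms], of 0] unfolding gauss_prod_zero bailey_psi[OF assms] by (simp add: q0)
  then have "mock_psi q = ?S / qpoch_inf q q"
    unfolding mock_psi_def by (rule has_sum_imp_sums[THEN sums_unique, symmetric])
  moreover have "psi_alpha q r * q ^ ((nat \<bar>r\<bar>)\<^sup>2) = (- 1) powi r * q powi (2 * (r * r) + r) * psi_sum q r" for r
  proof -
    have "int ((nat \<bar>r\<bar>)\<^sup>2) = r * r" by (simp add: power2_eq_square)
    then have "q ^ ((nat \<bar>r\<bar>)\<^sup>2) = q powi (r * r)" by (metis power_int_of_nat)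
    then show ?thesis unfolding psi_alpha_def using assms(2) by (simp add: power_int_add powi_double)
  qed
  ultimately show ?thesis using qpoch_inf_nonzero[OF assms(1,1)] by simp
qed

text \<open>The case \<open>d = 1/q\<close> of \<open>bailey_lemma\<close> in base \<open>q\<^sup>2\<close>.\<close>

lemma bailey_lemma_odd:
  assumes "norm q < 1" "q \<noteq> 0" "\<And>r. norm (a r) \<le> B * 2 ^ nat \<bar>r\<bar>"
  shows "((\<lambda>n. (- 1) ^ n * q ^ (n\<^sup>2) * qpoch q (q\<^sup>2) n * bailey (q\<^sup>2) a (int n)) has_sum
     (qpoch_inf q (q\<^sup>2) / qpoch_inf (q\<^sup>2) (q\<^sup>2) * (\<Sum>\<^sub>\<infinity>r. (- 1) powi r * q powi (r * r) * a r))) UNIV"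
proof -
  have q2: "norm (q\<^sup>2) < 1" "q\<^sup>2 \<noteq> 0" using assms norm_power2_less_1 by auto
  have g: "(q\<^sup>2) ^ n * gauss_prod (q\<^sup>2) (1 / q) n = (- 1) ^ n * q ^ (n\<^sup>2) * qpoch q (q\<^sup>2) n" for n
  proof (induction n)
    case (Suc n)
    have e: "(Suc n)\<^sup>2 = n\<^sup>2 + 2 * n + 1" by (simp add: power2_eq_square)
    have "q\<^sup>2 * ((q\<^sup>2) ^ n * ((q\<^sup>2) ^ n - 1 / q)) = - (q ^ (2 * n) * q * (1 - (q\<^sup>2) ^ n * q))"
      using assms(2) by (simp add: power_mult power2_eq_square field_simps)
    moreover have "(q\<^sup>2) ^ Suc n * gauss_prod (q\<^sup>2) (1 / q) (Suc n) =
       ((q\<^sup>2) ^ n * gauss_prod (q\<^sup>2) (1 / q) n) * (q\<^sup>2 * ((q\<^sup>2) ^ n * ((q\<^sup>2) ^ n - 1 / q)))"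
      by (simp add: gauss_prod_Suc mult_ac)
    ultimately show ?case unfolding Suc e by (simp add: qpoch_Suc power_add mult_ac)
  qed simp
  \<comment> \<open>The tail product completes (q;q^2)_n to the constant (q;q^2)_\<infinity>, so the
    weight on the \<alpha> side is only (-1)^r q^(r^2).\<close>
  have h: "(q\<^sup>2) ^ n * gauss_prod (q\<^sup>2) (1 / q) n * qpoch_inf ((q\<^sup>2) ^ Suc n * (1 / q)) (q\<^sup>2)
     = (- 1) ^ n * q ^ (n\<^sup>2) * qpoch_inf q (q\<^sup>2)" for n
  proof -
    have "(q\<^sup>2) ^ Suc n * (1 / q) = (q\<^sup>2) ^ n * q" using assms(2) by (simp add: power2_eq_square)
    then show ?thesis unfolding g by (simp add: qpoch_inf_split[OF q2(1), of q n])
  qed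
  have "a r * ((q\<^sup>2) ^ nat \<bar>r\<bar> * gauss_prod (q\<^sup>2) (1 / q) (nat \<bar>r\<bar>) * qpoch_inf ((q\<^sup>2) ^ Suc (nat \<bar>r\<bar>) * (1 / q)) (q\<^sup>2))
     = qpoch_inf q (q\<^sup>2) * ((- 1) powi r * q powi (r * r) * a r)" for r
  proof -
    have "int ((nat \<bar>r\<bar>)\<^sup>2) = r * r" by (simp add: power2_eq_square)
    then have "q ^ ((nat \<bar>r\<bar>)\<^sup>2) = q powi (r * r)" by (metis power_int_of_nat)
    moreover have "(- 1 :: complex) ^ nat \<bar>r\<bar> = (- 1) powi r"
      by (cases "r \<ge> 0") (simp_all add: power_int_def)
    ultimately show ?thesis unfolding h by simp
  qed
  then show ?thesis
    using bailey_lemma[where a = a, OF q2 assms(3), of "1 / q"] unfolding g by (simp only: infsum_cmult_right' times_divide_eq_left)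
qed

text \<open>Euler's identity behind partitions into odd and into distinct parts: both
  (q;q)_\<infinity> / (q;q^2)_\<infinity> and (q;q)_\<infinity> (-q;q)_\<infinity> equal
  (q^2;q^2)_\<infinity>.\<close>

lemma qpoch_inf_euler:
  assumes "norm q < 1"
  shows "qpoch_inf q (q\<^sup>2) * qpoch_inf (- q) q = 1"
proof -
  have "qpoch_inf q (q\<^sup>2) * qpoch_inf (q\<^sup>2) (q\<^sup>2) * qpoch_inf (- q) q = qpoch_inf (q\<^sup>2) (q\<^sup>2)"
    using qpoch_inf_dissect2[OF assms, of q] qpoch_inf_mult_uminus[OF assms, of q] by (simp add: power2_eq_square)
  then show ?thesis
    using qpoch_inf_nonzero[OF norm_power2_less_1[OF assms] norm_power2_less_1[OF assms]]
    by (simp add: mult.assoc mult.left_commute)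
qed

text \<open>The second formula inverts the prefactor of \<open>bailey_lemma_odd\<close>; this is why
  j(-1;q) multiplies mu and phi below.\<close>

lemma theta_minus_one:
  assumes "norm q < 1" "q \<noteq> 0"
  shows "theta_j (- 1) q = 2 * (qpoch_inf (- q) q)\<^sup>2 * qpoch_inf q q"
    "theta_j (- 1) q * (qpoch_inf q (q\<^sup>2) / qpoch_inf (q\<^sup>2) (q\<^sup>2)) = 2"
proof -
  show 1: "theta_j (- 1) q = 2 * (qpoch_inf (- q) q)\<^sup>2 * qpoch_inf q q"
    using qpoch_inf_shift[OF assms(1), of "- 1"] by (simp add: theta_j_def power2_eq_square)
  have "theta_j (- 1) q * qpoch_inf q (q\<^sup>2) = 2 * (qpoch_inf q (q\<^sup>2) * qpoch_inf (- q) q) * (qpoch_inf q q * qpoch_inf (- q) q)"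
    unfolding 1 by (simp add: power2_eq_square)
  also have "\<dots> = 2 * qpoch_inf (q\<^sup>2) (q\<^sup>2)"
    unfolding qpoch_inf_euler[OF assms(1)] qpoch_inf_mult_uminus[OF assms(1)] by simp
  finally show "theta_j (- 1) q * (qpoch_inf q (q\<^sup>2) / qpoch_inf (q\<^sup>2) (q\<^sup>2)) = 2"
    using qpoch_inf_nonzero[OF norm_power2_less_1[OF assms(1)] norm_power2_less_1[OF assms(1)]]
    by (simp add: field_simps)
qed

lemma norm_mu_alpha_factor_le:
  fixes q :: complex
  assumes "norm q < 1" "q \<noteq> 0"
  shows "norm (2 * (- 1) powi r * (1 / (1 + q powi r))) \<le> 2 * (1 / (1 - norm q))"
  unfolding norm_mult norm_minus_one_powi using norm_recip_one_plus_powi_le[OF assms, of r] by simp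

lemma mu_alpha_eq: "mu_alpha q r = q powi (tri (- r)) * (2 * (- 1) powi r * (1 / (1 + q powi r)))"
  unfolding mu_alpha_def triangle_Suc triangle_uminus by simp

lemma norm_mu_alpha_le:
  assumes "norm q < 1" "q \<noteq> 0"
  shows "norm (mu_alpha q r) \<le> 2 * (1 / (1 - norm q)) * 2 ^ nat \<bar>r\<bar>"
proof -
  have "norm (mu_alpha q r) \<le> 1 * (2 * (1 / (1 - norm q)))"
    unfolding mu_alpha_eq norm_mult[of "q powi _"] norm_power_int[of q]
    by (intro mult_mono norm_mu_alpha_factor_le norm_powi_le_1 triangle_nonneg assms) auto
  also have "\<dots> \<le> 2 * (1 / (1 - norm q)) * 2 ^ nat \<bar>r\<bar>"
    using mult_left_mono[OF one_le_power[of "2 :: real" "nat \<bar>r\<bar>"], of "2 * (1 / (1 - norm q))"] assms by simp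
  finally show ?thesis .
qed

lemma summable_mu_alpha:
  assumes "norm q < 1" "q \<noteq> 0"
  shows "mu_alpha q summable_on UNIV"
  using summable_theta_bounded[where c = "\<lambda>r. 2 * (- 1) powi r * (1 / (1 + q powi r))", OF assms _ norm_mu_alpha_factor_le[OF assms], of 1 1]
  unfolding mu_alpha_eq[abs_def] triangle_uminus by simp

text \<open>The sign (-1)^r of the pair cancels that of the weight, and the exponents r^2 and r(r+1)
  add up to 2 r^2 + r = 4 tri r + 3 r.\<close>

lemma mock_mu_bilateral:
  assumes "norm q < 1" "q \<noteq> 0"
  shows "theta_j (- 1) q * mock_mu q = 4 * (\<Sum>\<^sub>\<infinity>r. q powi (4 * tri r + 3 * r) / (1 + q powi (2 * r)))"
proof -
  let ?S = "\<Sum>\<^sub>\<infinity>r. q powi (4 * tri r + 3 * r) / (1 + q powi (2 * r))"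
  have q2: "norm (q\<^sup>2) < 1" "q\<^sup>2 \<noteq> 0" using assms norm_power2_less_1 by auto
  have p2: "(q\<^sup>2) powi k = q powi (2 * k)" for k using power_int_mult[of q 2 k] by simp
  have e: "(- 1) powi r * q powi (r * r) * mu_alpha (q\<^sup>2) r = 2 * (q powi (4 * tri r + 3 * r) / (1 + q powi (2 * r)))" for r
  proof -
    have "(- 1) powi r * q powi (r * r) * mu_alpha (q\<^sup>2) r
       = ((- 1) powi r * (- 1) powi r) * (2 * (q powi (r * r) * q powi (2 * (tri r + r))) / (1 + q powi (2 * r)))"
      unfolding mu_alpha_def p2 triangle_Suc by simp
    also have "q powi (r * r) * q powi (2 * (tri r + r)) = q powi (4 * tri r + 3 * r)"
    proof -
      have "a + 2 * (T + r) = 4 * T + 3 * r" if "a = 2 * T + r" for a T :: int using that by simp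
      from this[OF square_triangle] have "r * r + 2 * (tri r + r) = 4 * tri r + 3 * r" .
      then show ?thesis using assms(2) by (simp only: power_int_add[symmetric] simp_thms)
    qed
    finally show ?thesis by simp
  qed
  have "((\<lambda>n. (- 1) ^ n * q ^ (n\<^sup>2) * qpoch q (q\<^sup>2) n / (qpoch (- (q\<^sup>2)) (q\<^sup>2) n)\<^sup>2) has_sum
     (qpoch_inf q (q\<^sup>2) / qpoch_inf (q\<^sup>2) (q\<^sup>2) * (2 * ?S))) UNIV"
    using bailey_lemma_odd[where a = "mu_alpha (q\<^sup>2)", OF assms norm_mu_alpha_le[OF q2]] unfolding bailey_mu[OF q2] e infsum_cmult_right'
    by (simp only: times_divide_eq_right mult_1_right)
  then have "mock_mu q = qpoch_inf q (q\<^sup>2) / qpoch_inf (q\<^sup>2) (q\<^sup>2) * (2 * ?S)"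
    unfolding mock_mu_def by (rule has_sum_imp_sums[THEN sums_unique, symmetric])
  then show ?thesis using theta_minus_one(2)[OF assms] by (simp only: mult.assoc[symmetric]) simp
qed

lemma norm_phi_sum_le:
  assumes "norm q < 1" "q \<noteq> 0"
  shows "norm (phi_sum q r) \<le> real_of_int (2 * \<bar>r\<bar> + 1) * norm q powi (- (r * r))"
proof -
  have tm: "norm ((- 1) powi j * q powi (- (j * j))) \<le> norm q powi (- (r * r))" if "\<bar>j\<bar> \<le> \<bar>r\<bar>" for j
  proof -
    have "j * j \<le> r * r" using mult_mono[OF that that] by simp
    then show ?thesis unfolding norm_mult norm_minus_one_powi unfolding norm_power_int mult_1_left
      using assms by (intro power_int_decreasing) auto
  qed
  have sum: "norm (\<Sum>j\<in>{a..b}. (- 1) powi j * q powi (- (j * j))) \<le> real_of_int (2 * \<bar>r\<bar> + 1) * norm q powi (- (r * r))"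
    if "- \<bar>r\<bar> \<le> a" "b \<le> \<bar>r\<bar>" for a b
  proof -
    have "norm (\<Sum>j\<in>{a..b}. (- 1) powi j * q powi (- (j * j))) \<le> real (card {a..b}) * norm q powi (- (r * r))"
      by (rule sum_norm_bound) (use that in \<open>auto intro!: tm\<close>)
    also have "\<dots> \<le> real_of_int (2 * \<bar>r\<bar> + 1) * norm q powi (- (r * r))"
      using that by (intro mult_right_mono) auto
    finally show ?thesis .
  qed
  show ?thesis
  proof (cases "r \<ge> 0")
    case True
    then show ?thesis using sum[of "- r" r] by (simp add: phi_sum_def)
  next
    case False
    then show ?thesis using sum[of "r + 1" "- r - 1"] by (simp add: phi_sum_def)
  qed
qed

lemma norm_phi_alpha_le:
  assumes "norm q < 1" "q \<noteq> 0"
  shows "norm (phi_alpha q r) \<le> 2 * 2 ^ nat \<bar>r\<bar>"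
proof -
  have "norm (phi_alpha q r) \<le> norm q powi (2 * (r * r) + r) * (real_of_int (2 * \<bar>r\<bar> + 1) * norm q powi (- (r * r)))"
    unfolding phi_alpha_def norm_mult norm_power_int
    using norm_phi_sum_le[OF assms, of r] by (intro mult_mono) auto
  also have "\<dots> = real_of_int (2 * \<bar>r\<bar> + 1) * norm q powi (2 * (r * r) + r + - (r * r))"
    using assms by (subst power_int_add) auto
  also have "2 * (r * r) + r + - (r * r) = 2 * tri (- r)"
    unfolding triangle_uminus using square_triangle[of r] by simp
  also have "real_of_int (2 * \<bar>r\<bar> + 1) * norm q powi (2 * tri (- r)) \<le> (2 * 2 ^ nat \<bar>r\<bar>) * 1"
    using linear_le_power2[of r] by (intro mult_mono norm_powi_le_1 mult_nonneg_nonneg triangle_nonneg assms) auto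
  finally show ?thesis by simp
qed

lemma mock_phi_bilateral:
  assumes "norm q < 1" "q \<noteq> 0"
  shows "theta_j (- 1) q * mock_phi q = 2 * (\<Sum>\<^sub>\<infinity>r. (- 1) powi r * q powi (3 * (r * r) + r) * phi_sum q r)"
proof -
  let ?S = "\<Sum>\<^sub>\<infinity>r. (- 1) powi r * q powi (3 * (r * r) + r) * phi_sum q r"
  have e: "(- 1) powi r * q powi (r * r) * phi_alpha q r = (- 1) powi r * q powi (3 * (r * r) + r) * phi_sum q r" for r
    unfolding phi_alpha_def using power_int_add[of q "r * r" "2 * (r * r) + r"] assms(2) by simp
  have "((\<lambda>n. (- 1) ^ n * q ^ (n\<^sup>2) * qpoch q (q\<^sup>2) n / qpoch (- q) q (2 * n)) has_sum
     (qpoch_inf q (q\<^sup>2) / qpoch_inf (q\<^sup>2) (q\<^sup>2) * ?S)) UNIV"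
    using bailey_lemma_odd[where a = "phi_alpha q", OF assms norm_phi_alpha_le[OF assms]] unfolding bailey_phi[OF assms] e by (simp only: times_divide_eq_right mult_1_right)
  then have "mock_phi q = qpoch_inf q (q\<^sup>2) / qpoch_inf (q\<^sup>2) (q\<^sup>2) * ?S"
    unfolding mock_phi_def by (rule has_sum_imp_sums[THEN sums_unique, symmetric])
  then show ?thesis using theta_minus_one(2)[OF assms] by (simp only: mult.assoc[symmetric])
qed

text \<open>Here the Bailey pair itself is sent to n \<rightarrow> \<infinity>, without Bailey's
  lemma: \<beta>_n tends to a product, hence the alternating Lambert series is a theta
  quotient.\<close>

lemma infsum_mu_alpha:
  assumes "norm q < 1" "q \<noteq> 0"
  shows "(\<Sum>\<^sub>\<infinity>r. mu_alpha q r) = 2 * qpoch_inf q q ^ 3 / theta_j (- 1) q"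
proof -
  have q1: "norm (- q) < 1" using assms by simp
  have "(\<lambda>n. 1 / (qpoch (- q) q n)\<^sup>2) \<longlonglongrightarrow> 1 / (qpoch_inf (- q) q)\<^sup>2"
    using qpoch_inf_nonzero[OF assms(1) q1] by (intro tendsto_intros qpoch_tendsto assms) auto
  moreover have "(\<lambda>n. 1 / (qpoch (- q) q n)\<^sup>2) \<longlonglongrightarrow> (\<Sum>\<^sub>\<infinity>r. mu_alpha q r) / (qpoch_inf q q)\<^sup>2"
    using bailey_tendsto[OF assms(1) summable_mu_alpha[OF assms]] unfolding bailey_mu[OF assms] .
  ultimately have "1 / (qpoch_inf (- q) q)\<^sup>2 = (\<Sum>\<^sub>\<infinity>r. mu_alpha q r) / (qpoch_inf q q)\<^sup>2"
    by (rule LIMSEQ_unique)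
  then have "(\<Sum>\<^sub>\<infinity>r. mu_alpha q r) = (qpoch_inf q q)\<^sup>2 / (qpoch_inf (- q) q)\<^sup>2"
    using qpoch_inf_nonzero[OF assms(1,1)] by (simp add: field_simps)
  then show ?thesis unfolding theta_minus_one(1)[OF assms]
    using qpoch_inf_nonzero[OF assms(1,1)] by (simp add: power2_eq_square power3_eq_cube)
qed

subsection \<open>The double sums\<close>

text \<open>In the variables n = r + s and s the exponent has no mixed term: it is 2 n^2 + n -
  s(s+1)/2. The sign \<open>e\<close> treats both identities at once, e = 1 for psi and e = -1 for
  the other.\<close>

lemma fabc_term_443:
  assumes "q \<noteq> 0" "e * e = 1" "n = r + s"
  shows "fabc_term 4 4 3 (e * q ^ 3) (e * q\<^sup>2) q r s = (- e) powi n * q powi (2 * (n * n) + n - (tri s + s))"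
proof -
  have e0: "e \<noteq> 0" using assms(2) by auto
  have ex: "2 * ((r + s) * (r + s)) + (r + s) - (tri s + s) = 3 * r + 2 * s + (4 * tri r + 4 * r * s + 3 * tri s)"
  proof -
    have "2 * ((r + s) * (r + s)) + (r + s) - (S + s) = 3 * r + 2 * s + (4 * T + 4 * r * s + 3 * S)"
      if "r * r = 2 * T + r" "s * s = 2 * S + s" for T S
      using that by (simp add: algebra_simps)
    from this[OF square_triangle square_triangle] show ?thesis .
  qed
  have "(e * q ^ 3) powi r = e powi r * q powi (3 * r)" "(e * q\<^sup>2) powi s = e powi s * q powi (2 * s)"
    using power_int_mult[of q 3 r] power_int_mult[of q 2 s] by (simp_all add: power_int_mult_distrib)
  then have "fabc_term 4 4 3 (e * q ^ 3) (e * q\<^sup>2) q r s = (- 1) powi (r + s) * (e powi r * e powi s) *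
      (q powi (3 * r) * q powi (2 * s) * q powi (4 * tri r + 4 * r * s + 3 * tri s))"
    unfolding fabc_term_def by simp
  also have "(- 1) powi (r + s) * (e powi r * e powi s) = (- e) powi (r + s)"
    using e0 by (simp add: power_int_add[symmetric] power_int_mult_distrib[symmetric])
  also have "q powi (3 * r) * q powi (2 * s) * q powi (4 * tri r + 4 * r * s + 3 * tri s) =
      q powi (3 * r + 2 * s + (4 * tri r + 4 * r * s + 3 * tri s))"
    using assms(1) by (simp only: power_int_add simp_thms)
  finally show ?thesis unfolding assms(3) ex .
qed

lemma summable_geometric_nat2:
  fixes r :: real
  assumes "0 \<le> r" "r < 1"
  shows "(\<lambda>(m, n). r ^ (m + n)) summable_on (UNIV :: (nat \<times> nat) set)"
proof -
  have g: "(\<lambda>n::nat. r ^ n) summable_on UNIV"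
    using assms by (intro summable_nonneg_imp_summable_on summable_geometric) auto
  have "(\<lambda>(m, n). r ^ (m + n)) summable_on ((UNIV :: nat set) \<times> (UNIV :: nat set))"
  proof (rule summable_on_SigmaI)
    show "((\<lambda>n. case (m, n) of (m, n) \<Rightarrow> r ^ (m + n)) has_sum (r ^ m * (\<Sum>\<^sub>\<infinity>n. r ^ n))) UNIV" for m
      unfolding prod.case power_add by (intro has_sum_cmult_right has_sum_infsum g)
    show "(\<lambda>m. r ^ m * (\<Sum>\<^sub>\<infinity>n. r ^ n)) summable_on UNIV" by (intro summable_on_cmult_left g)
  qed (use assms in auto)
  then show ?thesis by simp
qed

lemma summable_powi_nat2:
  fixes q :: complex and f :: "nat \<Rightarrow> nat \<Rightarrow> complex"
  assumes "norm q < 1" "q \<noteq> 0" "\<And>m n. norm (f m n) = norm q powi k m n" "\<And>m n. int m + int n \<le> k m n"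
  shows "(\<lambda>(m, n). f m n) summable_on UNIV"
proof (rule summable_on_norm_bound[OF summable_geometric_nat2[of "norm q"]])
  fix x :: "nat \<times> nat"
  obtain m n where x: "x = (m, n)" by (cases x)
  have "norm (f m n) \<le> norm q powi int (m + n)"
    unfolding assms(3) using assms(1,2) assms(4)[of m n] by (intro power_int_decreasing) auto
  then show "norm (case x of (m, n) \<Rightarrow> f m n) \<le> (case x of (m, n) \<Rightarrow> norm q ^ (m + n))"
    unfolding x by (simp del: of_nat_add)
qed (use assms in auto)

lemma triangle_mono:
  assumes "0 \<le> s" "s \<le> (n::int)"
  shows "tri s + s \<le> tri n + n"
proof -
  have "s * (s + 1) \<le> n * (n + 1)" using assms by (intro mult_mono) auto
  then show ?thesis unfolding triangle_Suc[symmetric] by (rule zdiv_mono1) simp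
qed

lemma nonneg_quadrant_reindex:
  "infsum (\<lambda>(r, s). f r s) ({0::int..} \<times> {0::int..}) = (\<Sum>\<^sub>\<infinity>(m, n)\<in>UNIV. f (int m) (int n))"
  by (rule infsum_reindex_bij_witness[of _ "\<lambda>(m, n). (int m, int n)" "\<lambda>(r, s). (nat r, nat s)"]) auto

lemma neg_quadrant_reindex:
  "infsum (\<lambda>(r, s). f r s) ({..<0::int} \<times> {..<0::int}) = (\<Sum>\<^sub>\<infinity>(m, n)\<in>UNIV. f (- 1 - int m) (- 1 - int n))"
  by (rule infsum_reindex_bij_witness[of _ "\<lambda>(m, n). (- 1 - int m, - 1 - int n)" "\<lambda>(r, s). (nat (- 1 - r), nat (- 1 - s))"]) auto

lemma infsum_diagonal:
  fixes f :: "nat \<Rightarrow> nat \<Rightarrow> complex"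
  assumes "(\<lambda>(m, n). f m n) summable_on UNIV"
  shows "((\<lambda>u. \<Sum>k\<le>u. f (u - k) k) has_sum (\<Sum>\<^sub>\<infinity>(m, n)\<in>UNIV. f m n)) UNIV"
proof -
  have "((\<lambda>(m, n). f m n) has_sum (\<Sum>\<^sub>\<infinity>(m, n)\<in>UNIV. f m n)) UNIV" using assms by (rule has_sum_infsum)
  also have "?this \<longleftrightarrow> ((\<lambda>(u, k). f (u - k) k) has_sum (\<Sum>\<^sub>\<infinity>(m, n)\<in>UNIV. f m n)) (SIGMA u:UNIV. {..u})"
    by (rule has_sum_reindex_bij_witness[of _ "\<lambda>(u, k). (u - k, k)" "\<lambda>(m, n). (m + n, n)"]) auto
  finally have 1: "((\<lambda>(u, k). f (u - k) k) has_sum (\<Sum>\<^sub>\<infinity>(m, n)\<in>UNIV. f m n)) (SIGMA u:UNIV. {..u})" .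
  show ?thesis by (rule has_sum_SigmaD[OF 1]) auto
qed

text \<open>For fixed n = r + s the sum over s is a partial sum of q^(-s(s+1)/2). The minus sign of
  the negative quadrant is exactly the antisymmetry of \<open>psi_sum\<close>, so both quadrants fit
  into one series over all n.\<close>

lemma fabc_443_diagonal:
  assumes "norm q < 1" "q \<noteq> 0" "e * e = (1 :: complex)"
  shows "fabc 4 4 3 (e * q ^ 3) (e * q\<^sup>2) q = (\<Sum>\<^sub>\<infinity>n. (- e) powi n * q powi (2 * (n * n) + n) * psi_sum q n)"
    "(\<lambda>(r, s). fabc_term 4 4 3 (e * q ^ 3) (e * q\<^sup>2) q (int r) (int s)) summable_on UNIV"
    "(\<lambda>(r, s). fabc_term 4 4 3 (e * q ^ 3) (e * q\<^sup>2) q (- 1 - int r) (- 1 - int s)) summable_on UNIV"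
proof -
  let ?t = "fabc_term 4 4 3 (e * q ^ 3) (e * q\<^sup>2) q"
  have ne: "norm (- e) = 1"
    using assms(3) by (metis norm_minus_cancel norm_mult norm_one norm_ge_zero abs_of_nonneg abs_square_eq_1 power2_eq_square)
  have e0: "e \<noteq> 0" using assms(3) by auto
  note t = fabc_term_443[OF assms(2,3) refl]
  have b: "norm ((- e) powi n * q powi m) = norm q powi m" for n m
    unfolding norm_mult norm_power_int ne by simp
  have s1: "(\<lambda>(r, s). ?t (int r) (int s)) summable_on UNIV"
  proof (rule summable_powi_nat2[OF assms(1,2)])
    fix r s :: nat
    define n where "n = int r + int s"
    show "norm (?t (int r) (int s)) = norm q powi (2 * (n * n) + n - (tri (int s) + int s))" unfolding t b n_def ..
    have "tri (int s) + int s \<le> tri n + n" by (rule triangle_mono) (auto simp: n_def)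
    moreover have "int r + int s \<le> 2 * (n * n) + n - S" if "n * n = 2 * T + n" "S \<le> T + n" "T \<ge> 0" for S T
      using that by (simp add: n_def)
    ultimately show "int r + int s \<le> 2 * (n * n) + n - (tri (int s) + int s)"
      using square_triangle triangle_nonneg by metis
  qed
  have s2: "(\<lambda>(r, s). ?t (- 1 - int r) (- 1 - int s)) summable_on UNIV"
  proof (rule summable_powi_nat2[OF assms(1,2)])
    fix r s :: nat
    define n where "n = int r + int s"
    have n: "- 1 - int r + (- 1 - int s) = - 2 - n" by (simp add: n_def)
    show "norm (?t (- 1 - int r) (- 1 - int s)) =
        norm q powi (2 * ((- 2 - n) * (- 2 - n)) + (- 2 - n) - (tri (- 1 - int s) + (- 1 - int s)))"
      unfolding t b n ..
    have "(- 1 - int s) * (- 1 - int s + 1) = int s * (int s + 1)" by algebra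
    then have "tri (- 1 - int s) + (- 1 - int s) = tri (int s) + int s" unfolding triangle_Suc[symmetric] by simp
    moreover have "tri (int s) + int s \<le> tri n + n" by (rule triangle_mono) (auto simp: n_def)
    moreover have "int r + int s \<le> 2 * ((- 2 - n) * (- 2 - n)) + (- 2 - n) - S"
      if "n * n = 2 * T + n" "S \<le> T + n" "T \<ge> 0" for S T
    proof -
      have "(- 2 - n) * (- 2 - n) = n * n + 4 * n + 4" by algebra
      then show ?thesis using that by (simp add: n_def)
    qed
    ultimately show "int r + int s \<le> 2 * ((- 2 - n) * (- 2 - n)) + (- 2 - n) - (tri (- 1 - int s) + (- 1 - int s))"
      using square_triangle triangle_nonneg by metis
  qed
  let ?P = "\<Sum>\<^sub>\<infinity>(r, s)\<in>UNIV. ?t (int r) (int s)"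
  let ?N = "\<Sum>\<^sub>\<infinity>(r, s)\<in>UNIV. ?t (- 1 - int r) (- 1 - int s)"
  let ?c = "\<lambda>n. (- e) powi n * q powi (2 * (n * n) + n)"
  let ?g = "\<lambda>s. q powi (- (s * (s + 1) div 2))"
  have split: "q powi (a - (tri s + s)) = q powi a * ?g s" for a s
    unfolding triangle_Suc diff_conv_add_uminus[of a] by (rule power_int_add) (use assms(2) in simp)
  have nat_sum: "(\<Sum>k\<le>u. ?g (int k)) = (\<Sum>j\<in>{0..int u}. ?g j)" for u
    by (rule sum.reindex_bij_witness[of _ nat int]) auto
  have "((\<lambda>n. ?c n * psi_sum q n) has_sum (?P + - ?N)) UNIV"
  proof (rule has_sum_int_split)
    have "(\<Sum>k\<le>u. ?t (int (u - k)) (int k)) = ?c (int u) * psi_sum q (int u)" for u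
    proof -
      have "(\<Sum>k\<le>u. ?t (int (u - k)) (int k)) = (\<Sum>k\<le>u. ?c (int u) * ?g (int k))"
        by (rule sum.cong) (auto simp: t split of_nat_diff)
      also have "\<dots> = ?c (int u) * psi_sum q (int u)"
        unfolding sum_distrib_left[symmetric] nat_sum by (simp add: psi_sum_def)
      finally show ?thesis .
    qed
    then show "((\<lambda>u. ?c (int u) * psi_sum q (int u)) has_sum ?P) UNIV"
      using infsum_diagonal[OF s1] by simp
    \<comment> \<open>Two negative indices add up to at most -2, so diagonal u of the negative
      quadrant is n = -2 - u.\<close>
    have "(\<Sum>k\<le>u. ?t (- 1 - int (u - k)) (- 1 - int k)) = - (?c (- 1 - int (Suc u)) * psi_sum q (- 1 - int (Suc u)))" for u
    proof -
      have "?t (- 1 - int (u - k)) (- 1 - int k) = ?c (- 1 - int (Suc u)) * ?g (int k)" if "k \<le> u" for k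
      proof -
        have n: "- 1 - int (u - k) + (- 1 - int k) = - 1 - int (Suc u)" using that by (simp add: of_nat_diff)
        have "(- 1 - int k) * (- 1 - int k + 1) = int k * (int k + 1)" by algebra
        then show ?thesis unfolding t n split by simp
      qed
      then have "(\<Sum>k\<le>u. ?t (- 1 - int (u - k)) (- 1 - int k)) = (\<Sum>k\<le>u. ?c (- 1 - int (Suc u)) * ?g (int k))"
        by (intro sum.cong) auto
      also have "\<dots> = - (?c (- 1 - int (Suc u)) * psi_sum q (- 1 - int (Suc u)))"
        unfolding sum_distrib_left[symmetric] nat_sum by (simp add: psi_sum_def)
      finally show ?thesis .
    qed
    then have "((\<lambda>u. - (?c (- 1 - int (Suc u)) * psi_sum q (- 1 - int (Suc u)))) has_sum ?N) UNIV"
      using infsum_diagonal[OF s2] by simp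
    then have "((\<lambda>u. ?c (- 1 - int (Suc u)) * psi_sum q (- 1 - int (Suc u))) has_sum - ?N) UNIV"
      using has_sum_uminus[of "\<lambda>u. ?c (- 1 - int (Suc u)) * psi_sum q (- 1 - int (Suc u))" "UNIV"] by simp
    \<comment> \<open>The missing value n = -1 may be added, because \<open>psi_sum\<close> vanishes
      there.\<close>
    also have "?this \<longleftrightarrow> ((\<lambda>u. ?c (- 1 - int u) * psi_sum q (- 1 - int u)) has_sum - ?N) {1..}"
      by (rule has_sum_reindex_bij_witness[of _ "\<lambda>u. u - 1" Suc]) auto
    also have "\<dots> \<longleftrightarrow> ((\<lambda>u. ?c (- 1 - int u) * psi_sum q (- 1 - int u)) has_sum - ?N) UNIV"
      by (rule has_sum_cong_neutral) (auto simp: psi_sum_def not_less_eq_eq)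
    finally show "((\<lambda>u. ?c (- 1 - int u) * psi_sum q (- 1 - int u)) has_sum - ?N) UNIV" .
  qed
  then show "fabc 4 4 3 (e * q ^ 3) (e * q\<^sup>2) q = (\<Sum>\<^sub>\<infinity>n. ?c n * psi_sum q n)"
    unfolding fabc_def nonneg_quadrant_reindex neg_quadrant_reindex by (simp add: infsumI)
  show "(\<lambda>(r, s). ?t (int r) (int s)) summable_on UNIV" "(\<lambda>(r, s). ?t (- 1 - int r) (- 1 - int s)) summable_on UNIV"
    by fact+
qed

lemma fabc_443_mock_psi:
  assumes "norm q < 1" "q \<noteq> 0"
  shows "fabc 4 4 3 (q ^ 3) (q\<^sup>2) q = qpoch_inf q q * mock_psi q"
  using fabc_443_diagonal(1)[OF assms, of 1] unfolding mock_psi_bilateral[OF assms] by simp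

section \<open>Splitting bilateral sums by sign and parity, and the double sum at negative
  arguments\<close>

lemma summable_nat_subseq:
  fixes f :: "nat \<Rightarrow> complex"
  assumes "f summable_on UNIV" "inj g"
  shows "(\<lambda>n. f (g n)) summable_on UNIV"
  using summable_on_subset_banach[OF assms(1), of "range g"] summable_on_reindex[OF assms(2), of f]
  by (simp add: o_def)

lemma infsum_nat_Suc:
  fixes f :: "nat \<Rightarrow> complex"
  assumes "f summable_on UNIV"
  shows "(\<Sum>\<^sub>\<infinity>n. f n) = f 0 + (\<Sum>\<^sub>\<infinity>n. f (Suc n))"
proof -
  have "(\<Sum>\<^sub>\<infinity>n. f n) = infsum f (insert 0 (range Suc))"
    by (rule arg_cong[of _ _ "infsum f"]) (metis UNIV_nat_eq)
  also have "\<dots> = f 0 + infsum f (range Suc)"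
    by (rule infsum_insert) (use summable_on_subset_banach[OF assms] in auto)
  also have "infsum f (range Suc) = (\<Sum>\<^sub>\<infinity>n. f (Suc n))"
    by (subst infsum_reindex) (auto simp: o_def)
  finally show ?thesis .
qed

lemma infsum_int_split:
  fixes f :: "int \<Rightarrow> complex"
  assumes "f summable_on UNIV"
  shows "(\<lambda>n. f (int n)) summable_on UNIV" "(\<lambda>n. f (- 1 - int n)) summable_on UNIV"
    "(\<Sum>\<^sub>\<infinity>u. f u) = (\<Sum>\<^sub>\<infinity>n. f (int n)) + (\<Sum>\<^sub>\<infinity>n. f (- 1 - int n))"
proof -
  have inj: "inj_on int UNIV" "inj_on (\<lambda>n. - 1 - int n) UNIV" by (auto simp: inj_on_def)
  show 1: "(\<lambda>n. f (int n)) summable_on UNIV" "(\<lambda>n. f (- 1 - int n)) summable_on UNIV"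
    using summable_on_subset_banach[OF assms] summable_on_reindex[OF inj(1), of f] summable_on_reindex[OF inj(2), of f]
    by (simp_all add: o_def)
  show "(\<Sum>\<^sub>\<infinity>u. f u) = (\<Sum>\<^sub>\<infinity>n. f (int n)) + (\<Sum>\<^sub>\<infinity>n. f (- 1 - int n))"
    using 1 by (intro infsumI has_sum_int_split has_sum_infsum)
qed

lemma infsum_int_even:
  fixes f :: "int \<Rightarrow> complex"
  assumes "f summable_on UNIV" "\<And>u. f (- u) = f u"
  shows "(\<Sum>\<^sub>\<infinity>u. f u) = 2 * (\<Sum>\<^sub>\<infinity>n. f (int n)) - f 0"
proof -
  have "f (- 1 - int n) = f (int (Suc n))" for n using assms(2)[of "int (Suc n)"] by simp
  then show ?thesis
    using infsum_int_split(3)[OF assms(1)] infsum_nat_Suc[OF infsum_int_split(1)[OF assms(1)]] by simp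
qed

lemma infsum_nat_parity:
  fixes f :: "nat \<Rightarrow> complex"
  assumes "f summable_on UNIV"
  shows "(\<Sum>\<^sub>\<infinity>n. f n) = (\<Sum>\<^sub>\<infinity>n. f (2 * n)) + (\<Sum>\<^sub>\<infinity>n. f (2 * n + 1))"
proof -
  have "(\<Sum>\<^sub>\<infinity>n. f n) = infsum f (range (\<lambda>n. 2 * n) \<union> range (\<lambda>n. 2 * n + 1))"
  proof (rule arg_cong[of _ _ "infsum f"])
    show "UNIV = range (\<lambda>n::nat. 2 * n) \<union> range (\<lambda>n. 2 * n + 1)"
      by (auto simp: image_iff) presburger
  qed
  also have "\<dots> = infsum f (range (\<lambda>n. 2 * n)) + infsum f (range (\<lambda>n. 2 * n + 1))"
    by (rule infsum_Un_disjoint) (use summable_on_subset_banach[OF assms] in \<open>auto, presburger\<close>)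
  also have "infsum f (range (\<lambda>n. 2 * n)) = (\<Sum>\<^sub>\<infinity>n. f (2 * n))"
    by (subst infsum_reindex) (auto simp: o_def inj_on_def)
  also have "infsum f (range (\<lambda>n. 2 * n + 1)) = (\<Sum>\<^sub>\<infinity>n. f (2 * n + 1))"
    by (subst infsum_reindex) (auto simp: o_def inj_on_def)
  finally show ?thesis .
qed

text \<open>The quadratic form splits, and both quadrants become rows of a single array indexed by
  (d, k): the positive one gives the even d, the negative one the odd d \<ge> 3 with a minus sign.
  Only the row d = 1 is absent; it is the series subtracted on the right. Regrouping the completed
  alternating array by u = d + k gives the stated terms.\<close>

lemma fabc_443_plus_nat:
  assumes "norm q < 1" "q \<noteq> 0"
  shows "((\<lambda>u. (- 1) ^ u * q powi (tri (int u) + int u) / (1 + q powi (int u))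
      + q powi (3 * tri (int u) + 3 * int u) / (1 + q powi (int u)))
    has_sum (fabc 4 4 3 (- (q ^ 3)) (- (q\<^sup>2)) q - (\<Sum>\<^sub>\<infinity>k. q powi (3 * tri (int (Suc k)) + int (Suc k))))) UNIV"
proof -
  let ?S = "\<Sum>\<^sub>\<infinity>k. q powi (3 * tri (int (Suc k)) + int (Suc k))"
  let ?t = "fabc_term 4 4 3 (- 1 * q ^ 3) (- 1 * q\<^sup>2) q"
  have m1: "(- 1 :: complex) * - 1 = 1" by simp
  note s = fabc_443_diagonal(2,3)[OF assms m1]
  \<comment> \<open>In the positive quadrant d = 2 r and k = s; at (-1 - r, -1 - s) in the negative
    one d = 2 r + 3 and k = s. With u = d + k the exponent is u(u+1)/2 + u k, linear in k.\<close>
  define Z where "Z = (\<lambda>d k. q powi (tri (int d + int k) + (int d + int k) + (int d + int k) * int k))"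
  have poly: "tri u + u + u * k = 2 * (n * n) + n - (tri s + s)"
    if "u = 2 * n - s \<and> k = s \<or> u = s - 2 * n \<and> k = - 1 - s" for u n s k
  proof -
    have e: "u * (u - 1) + 2 * u + 2 * (u * k) = 2 * (2 * (n * n) + n) - (s * (s - 1) + 2 * s)"
      using that
    proof (elim disjE conjE)
      assume a: "u = 2 * n - s" "k = s"
      show ?thesis unfolding a by (simp add: algebra_simps)
    next
      assume a: "u = s - 2 * n" "k = - 1 - s"
      show ?thesis unfolding a by (simp add: algebra_simps)
    qed
    have "T + u + u * k = 2 * (n * n) + n - (S + s)" if "2 * T = u * (u - 1)" "2 * S = s * (s - 1)" for T S
      using e that by (simp add: algebra_simps)
    from this[OF triangle_double triangle_double] show ?thesis .
  qed
  have t1: "?t (int r) (int s) = Z (2 * r) s" for r s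
    unfolding fabc_term_443[OF assms(2) m1 refl] Z_def
    by (subst poly[where n = "int r + int s" and s = "int s"]) auto
  have t2: "?t (- 1 - int r) (- 1 - int s) = Z (2 * r + 3) s" for r s
    unfolding fabc_term_443[OF assms(2) m1 refl] Z_def
    by (subst poly[where n = "- 1 - int r + (- 1 - int s)" and s = "- 1 - int s"]) auto
  have sZ: "(\<lambda>(d, k). (- 1) ^ d * Z d k) summable_on UNIV"
  proof (rule summable_powi_nat2[OF assms])
    fix d k :: nat
    show "norm ((- 1) ^ d * Z d k) = norm q powi (tri (int d + int k) + (int d + int k) + (int d + int k) * int k)"
      by (simp add: Z_def norm_mult norm_power norm_power_int)
    have "0 \<le> (int d + int k) * int k" by simp
    from add_mono[OF add_mono[OF triangle_nonneg[of "int d + int k"] order_refl[of "int d + int k"]] this]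
    show "int d + int k \<le> tri (int d + int k) + (int d + int k) + (int d + int k) * int k"
      by (simp only: add_0 add_0_right)
  qed
  have sZ1: "(\<lambda>k. Z d k) summable_on UNIV" for d
  proof -
    have "(\<lambda>(d, k). (- 1) ^ d * Z d k) summable_on (UNIV \<times> UNIV)" using sZ by simp
    from summable_on_SigmaD1[OF this, of d] have "(\<lambda>k. (- 1) ^ d * Z d k) summable_on UNIV" by simp
    from summable_on_cmult_right[OF this, of "(- 1) ^ d"] show ?thesis
      by (simp add: mult.assoc[symmetric] power_mult_distrib[symmetric])
  qed
  define z where "z = (\<lambda>d. \<Sum>\<^sub>\<infinity>k. Z d k)"
  have tot: "((\<lambda>(d, k). (- 1) ^ d * Z d k) has_sum (\<Sum>\<^sub>\<infinity>(d, k)\<in>UNIV. (- 1) ^ d * Z d k)) (UNIV \<times> UNIV)"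
    using has_sum_infsum[OF sZ] by simp
  have hz: "((\<lambda>d. (- 1) ^ d * z d) has_sum (\<Sum>\<^sub>\<infinity>(d, k)\<in>UNIV. (- 1) ^ d * Z d k)) UNIV"
    unfolding z_def by (rule has_sum_SigmaD[OF tot]) (unfold prod.case, intro has_sum_cmult_right has_sum_infsum sZ1)
  then have zs: "(\<lambda>d. (- 1) ^ d * z d) summable_on UNIV" by (rule has_sum_imp_summable)
  have f1: "(\<Sum>\<^sub>\<infinity>(r, s)\<in>UNIV. ?t (int r) (int s)) = (\<Sum>\<^sub>\<infinity>r. z (2 * r))"
  proof -
    have "(\<lambda>(r, s). ?t (int r) (int s)) summable_on UNIV \<times> UNIV" using s(1) by simp
    from infsum_Sigma'_banach[OF this] show ?thesis unfolding t1 z_def by simp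
  qed
  have f2: "(\<Sum>\<^sub>\<infinity>(r, s)\<in>UNIV. ?t (- 1 - int r) (- 1 - int s)) = (\<Sum>\<^sub>\<infinity>r. z (2 * r + 3))"
  proof -
    have "(\<lambda>(r, s). ?t (- 1 - int r) (- 1 - int s)) summable_on UNIV \<times> UNIV" using s(2) by simp
    from infsum_Sigma'_banach[OF this] show ?thesis unfolding t2 z_def by simp
  qed
  have "(\<Sum>\<^sub>\<infinity>(d, k)\<in>UNIV. (- 1) ^ d * Z d k) = (\<Sum>\<^sub>\<infinity>r. z (2 * r)) - (\<Sum>\<^sub>\<infinity>r. z (2 * r + 1))"
    using infsum_nat_parity[OF zs] hz by (simp add: infsumI infsum_uminus)
  moreover have "(\<Sum>\<^sub>\<infinity>r. z (2 * r + 1)) = z 1 + (\<Sum>\<^sub>\<infinity>r. z (2 * r + 3))"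
  proof -
    have "(\<lambda>r. - ((- 1) ^ (2 * r + 1) * z (2 * r + 1))) summable_on UNIV"
      unfolding summable_on_uminus by (rule summable_nat_subseq[OF zs]) (auto simp: inj_on_def)
    then show ?thesis using infsum_nat_Suc[of "\<lambda>r. z (2 * r + 1)"] by (simp add: numeral_3_eq_3)
  qed
  moreover have "fabc 4 4 3 (- (q ^ 3)) (- (q\<^sup>2)) q = (\<Sum>\<^sub>\<infinity>r. z (2 * r)) - (\<Sum>\<^sub>\<infinity>r. z (2 * r + 3))"
    using f1 f2 unfolding fabc_def nonneg_quadrant_reindex neg_quadrant_reindex by simp
  moreover have "z 1 = ?S"
  proof -
    have "tri (int 1 + int k) + (int 1 + int k) + (int 1 + int k) * int k = 3 * tri (int (Suc k)) + int (Suc k)" for k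
      using triangle_double[of "int 1 + int k"] by (simp add: algebra_simps)
    then show ?thesis unfolding z_def Z_def by (simp only:)
  qed
  ultimately have val: "(\<Sum>\<^sub>\<infinity>(d, k)\<in>UNIV. (- 1) ^ d * Z d k)
     = fabc 4 4 3 (- (q ^ 3)) (- (q\<^sup>2)) q - ?S"
    by simp
  \<comment> \<open>The progression has ratio -q^u; the two fractions come from its two ends, and
    the signs (-1)^u cancel in the second.\<close>
  have "(\<Sum>k\<le>u. (- 1) ^ (u - k) * Z (u - k) k) = (- 1) ^ u * q powi (tri (int u) + int u) / (1 + q powi (int u))
      + q powi (3 * tri (int u) + 3 * int u) / (1 + q powi (int u))" for u
  proof -
    have nz: "1 + q ^ u \<noteq> 0" using one_plus_powi_nonzero[OF assms, of "int u"] by simp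
    have p: "q powi (tri (int u) + int u + int u * int k) = q powi (tri (int u) + int u) * (q ^ u) ^ k" for k
      using assms(2) by (subst power_int_add) (auto simp: power_int_mult)
    have "(\<Sum>k\<le>u. (- 1) ^ (u - k) * Z (u - k) k) = (\<Sum>k\<le>u. (- 1) ^ u * q powi (tri (int u) + int u) * (- (q ^ u)) ^ k)"
    proof (rule sum.cong)
      fix k assume "k \<in> {..u}"
      then have k: "k \<le> u" by simp
      then have i: "int (u - k) + int k = int u" by simp
      have "(- 1 :: complex) ^ d = (- 1) ^ (d + k) * (- 1) ^ k" for d by (simp add: power_add mult.assoc)
      from this[of "u - k"] have "(- 1 :: complex) ^ (u - k) = (- 1) ^ u * (- 1) ^ k" using k by simp
      moreover have "(- (q ^ u)) ^ k = (- 1) ^ k * (q ^ u) ^ k" by (rule power_minus)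
      ultimately show "(- 1) ^ (u - k) * Z (u - k) k = (- 1) ^ u * q powi (tri (int u) + int u) * (- (q ^ u)) ^ k"
        unfolding Z_def i p by simp
    qed simp
    also have "\<dots> = (- 1) ^ u * q powi (tri (int u) + int u) * (\<Sum>k<Suc u. (- (q ^ u)) ^ k)"
      by (simp only: sum_distrib_left lessThan_Suc_atMost)
    also have "(\<Sum>k<Suc u. (- (q ^ u)) ^ k) = (1 - (- (q ^ u)) ^ Suc u) / (1 + q ^ u)"
      using nz one_diff_power_eq[of "- (q ^ u)" "Suc u"] by (simp add: nonzero_eq_divide_eq mult.commute del: sum.lessThan_Suc power_Suc)
    also have "(- 1) ^ u * q powi (tri (int u) + int u) * ((1 - (- (q ^ u)) ^ Suc u) / (1 + q ^ u)) =
       (- 1) ^ u * q powi (tri (int u) + int u) / (1 + q ^ u) + q powi (tri (int u) + int u + int u * int (Suc u)) / (1 + q ^ u)"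
    proof -
      have "(- (q ^ u)) ^ Suc u = - ((- 1) ^ u * (q ^ u) ^ Suc u)" by (subst power_minus) simp
      moreover have "a * W * ((1 - - (a * Y)) / D) = a * W / D + W * Y / D" if "a * a = 1" for a W Y D :: complex
      proof -
        have "a * W * ((1 - - (a * Y)) / D) = a * W / D + (a * a) * (W * Y) / D"
          by (simp add: algebra_simps add_divide_distrib)
        then show ?thesis unfolding that by simp
      qed
      moreover have "(- 1 :: complex) ^ u * (- 1) ^ u = 1" by (simp flip: power_mult_distrib)
      ultimately show ?thesis unfolding p by (simp only:)
    qed
    also have "tri (int u) + int u + int u * int (Suc u) = 3 * tri (int u) + 3 * int u"
      using triangle_double[of "int u"] by (simp add: algebra_simps)
    finally show ?thesis by simp
  qed
  then show ?thesis using infsum_diagonal[OF sZ] unfolding val by simp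
qed

text \<open>The triple product is used at -q^2, which has the same theta value as -q by x \<mapsto>
  q^3 / x and directly yields the exponents u(3u+1)/2 of the Lambert series.\<close>

lemma theta_one_three:
  assumes "norm q < 1" "q \<noteq> 0"
  shows "((\<lambda>u. q powi (3 * tri u + 2 * u)) has_sum theta_j (- q) (q ^ 3)) UNIV"
proof -
  have q3: "0 < norm (q ^ 3)" "norm (q ^ 3) < 1" using assms norm_power3_less_1 by auto
  have "theta_j (- (q\<^sup>2)) (q ^ 3) = theta_j (- q) (q ^ 3)"
  proof -
    have "q ^ 3 / - (q\<^sup>2) = - q" "q ^ 3 / - q = - (q\<^sup>2)" using assms by (auto simp: power2_eq_square power3_eq_cube field_simps)
    then show ?thesis unfolding theta_j_def by simp
  qed
  moreover have "(- (- (q\<^sup>2))) powi u * (q ^ 3) powi (tri u) = q powi (3 * tri u + 2 * u)" for u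
    using assms power_int_mult[of q 2 u] power_int_mult[of q 3 "tri u"] by (simp add: power_int_add)
  ultimately show ?thesis using theta_series[OF q3, of "- (q\<^sup>2)"] assms by simp
qed

section \<open>Lambert series and the relations between them\<close>

definition lambert_B :: "complex \<Rightarrow> complex" where
  "lambert_B q = (\<Sum>\<^sub>\<infinity>u. q powi (3 * tri u + 2 * u) / (1 + q powi u))"

definition lambert_P :: "complex \<Rightarrow> complex" where
  "lambert_P q = (\<Sum>\<^sub>\<infinity>u. q powi (3 * tri u + 2 * u) / (1 + q powi (3 * u)))"

definition lambert_R :: "complex \<Rightarrow> complex" where
  "lambert_R q = (\<Sum>\<^sub>\<infinity>u. q powi (tri u + u) / (1 + q powi u))"

text \<open>The one-sided Lambert sums are halves of bilateral ones, because their terms are even in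
  u. The theta function appears on writing q^u / (1 + q^u) as 1 - 1 / (1 + q^u).\<close>

lemma fabc_443_plus:
  assumes "norm q < 1" "q \<noteq> 0"
  shows "fabc 4 4 3 (- (q ^ 3)) (- (q\<^sup>2)) q =
    theta_j (- q) (q ^ 3) + (\<Sum>\<^sub>\<infinity>u. mu_alpha q u) / 4 - lambert_B q / 2"
proof -
  let ?th = "\<lambda>u. q powi (3 * tri u + 2 * u)"
  let ?S = "\<Sum>\<^sub>\<infinity>k. q powi (3 * tri (int (Suc k)) + int (Suc k))"
  let ?b = "\<lambda>u. q powi (3 * tri u + 2 * u) / (1 + q powi u)"
  have tu: "tri (- u) = tri u + u" for u by (rule triangle_uminus)
  have nz: "1 + q powi u \<noteq> 0" for u by (rule one_plus_powi_nonzero[OF assms])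
  have sth: "?th summable_on UNIV" using theta_one_three[OF assms] by (rule has_sum_imp_summable)
  have sb: "?b summable_on UNIV" using summable_lambert[OF assms, of 3 2 1] by simp
  have "?b (- u) = ?b u" for u
  proof -
    have "3 * tri (- u) + 2 * (- u) = 3 * tri u + u" unfolding tu by simp
    then have "?b (- u) = q powi (3 * tri u + u) / (1 + 1 / q powi u)"
      by (simp only: power_int_minus inverse_eq_divide)
    also have "\<dots> = ?b u"
      using assms(2) nz[of u] by (simp add: power_int_add powi_double divide_simps add.commute)
    finally show ?thesis .
  qed
  from infsum_int_even[OF sb this] have B: "lambert_B q = 2 * (\<Sum>\<^sub>\<infinity>n. ?b (int n)) - 1 / 2"
    unfolding lambert_B_def by simp
  have "mu_alpha q (- u) = mu_alpha q u" for u
  proof -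
    have "(- u) * (- u + 1) = u * (u - 1)" by algebra
    then have t': "(- u) * (- u + 1) div 2 = tri u" by (simp only:)
    show ?thesis
      unfolding mu_alpha_def minus_one_powi_uminus t' unfolding triangle_Suc using assms(2) nz[of u]
      by (simp add: power_int_minus power_int_add divide_simps add.commute)
  qed
  from infsum_int_even[OF summable_mu_alpha[OF assms] this]
  have E: "(\<Sum>\<^sub>\<infinity>u. mu_alpha q u) = 2 * (\<Sum>\<^sub>\<infinity>n. mu_alpha q (int n)) - 1"
    by (simp add: mu_alpha_def)
  have s1: "(\<lambda>n. mu_alpha q (int n)) summable_on UNIV" by (rule infsum_int_split(1)[OF summable_mu_alpha[OF assms]])
  have s2: "(\<lambda>n. ?th (int n)) summable_on UNIV" by (rule infsum_int_split(1)[OF sth])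
  have s3: "(\<lambda>n. ?b (int n)) summable_on UNIV" by (rule infsum_int_split(1)[OF sb])
  have "?th (- 1 - int n) = q powi (3 * tri (int (Suc n)) + int (Suc n))" for n
  proof -
    have "3 * tri (- int (Suc n)) + 2 * (- int (Suc n)) = 3 * tri (int (Suc n)) + int (Suc n)"
      unfolding tu by simp
    moreover have "- 1 - int n = - int (Suc n)" by simp
    ultimately show ?thesis by (simp only:)
  qed
  \<comment> \<open>The absent row d = 1 is the negative half of the theta series: u \<mapsto> -u
    turns 3 tri u + 2 u into 3 tri u + u.\<close>
  then have T: "theta_j (- q) (q ^ 3) = (\<Sum>\<^sub>\<infinity>n. ?th (int n)) + ?S"
    using infsum_int_split(3)[OF sth] infsumI[OF theta_one_three[OF assms]] by simp
  have "(- 1) ^ u * q powi (tri (int u) + int u) / (1 + q powi (int u)) + q powi (3 * tri (int u) + 3 * int u) / (1 + q powi (int u))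
      = 1 / 2 * mu_alpha q (int u) + (?th (int u) + - ?b (int u))" for u
  proof -
    have "q powi (3 * tri (int u) + 3 * int u) = ?th (int u) * q powi (int u)"
      using assms(2) by (subst power_int_add[symmetric]) (auto simp: algebra_simps)
    then show ?thesis unfolding mu_alpha_def triangle_Suc using nz[of "int u"]
      by (simp add: divide_simps) (simp add: algebra_simps)
  qed
  then have "fabc 4 4 3 (- (q ^ 3)) (- (q\<^sup>2)) q - ?S
     = (\<Sum>\<^sub>\<infinity>u. 1 / 2 * mu_alpha q (int u) + (?th (int u) + - ?b (int u)))"
    using infsumI[OF fabc_443_plus_nat[OF assms]] by simp
  also have "\<dots> = 1 / 2 * (\<Sum>\<^sub>\<infinity>n. mu_alpha q (int n)) + ((\<Sum>\<^sub>\<infinity>n. ?th (int n)) + - (\<Sum>\<^sub>\<infinity>n. ?b (int n)))"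
  proof (intro infsumI has_sum_add has_sum_cmult_right has_sum_infsum s1 s2)
    show "((\<lambda>n. - ?b (int n)) has_sum - (\<Sum>\<^sub>\<infinity>n. ?b (int n))) UNIV"
      using has_sum_infsum[OF s3] by (simp only: has_sum_uminus minus_minus)
  qed
  finally have "fabc 4 4 3 (- (q ^ 3)) (- (q\<^sup>2)) q - ?S
     = 1 / 2 * (\<Sum>\<^sub>\<infinity>n. mu_alpha q (int n)) + ((\<Sum>\<^sub>\<infinity>n. ?th (int n)) + - (\<Sum>\<^sub>\<infinity>n. ?b (int n)))" .
  \<comment> \<open>Doubling a half counts u = 0 twice; the two resulting corrections are 1/4 each,
    with opposite signs.\<close>
  moreover have "A = (T + S) + (2 * M - 1) / 4 - (2 * N - 1 / 2) / 2"
    if "A - S = 1 / 2 * M + (T + - N)" for A S M T N :: complex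
    using that by (simp add: diff_eq_eq add_divide_distrib diff_divide_distrib)
  ultimately show ?thesis unfolding B E T by blast
qed

text \<open>With X = q^u the three parts carry X^2, X^3 and X^4 over 1 + X^3. Reflection u \<mapsto>
  -u carries the X^4 part to the X^2 part, hence the factor 2, and the X^3 part is a series in
  q^3.\<close>

lemma lambert_B_eq:
  assumes "norm q < 1" "q \<noteq> 0"
  shows "lambert_B q = 2 * lambert_P q - lambert_R (q ^ 3)"
proof -
  let ?p = "\<lambda>u. q powi (3 * tri u + 2 * u) / (1 + q powi (3 * u))"
  let ?r = "\<lambda>u. q powi (3 * tri u + 3 * u) / (1 + q powi (3 * u))"
  have tu: "tri (- u) = tri u + u" for u by (rule triangle_uminus)
  have nz: "1 + q powi u \<noteq> 0" for u by (rule one_plus_powi_nonzero[OF assms])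
  have sp: "?p summable_on UNIV" using summable_lambert[OF assms, of 3 2 3] by simp
  have sr: "?r summable_on UNIV" using summable_lambert[OF assms, of 3 3 3] by simp
  have sp': "(\<lambda>u. ?p (- u)) summable_on UNIV" by (rule summable_on_int_uminus[of ?p, THEN iffD2, OF sp])
  have "q powi (3 * tri u + 2 * u) / (1 + q powi u) = ?p u + (?p (- u) + - ?r u)" for u
  proof -
    define V X where "V = q powi (3 * tri u)" and "X = q powi u"
    have X: "X \<noteq> 0" "1 + X \<noteq> 0" "1 + X ^ 3 \<noteq> 0"
      using assms(2) nz[of u] nz[of "3 * u"] power_int_mult[of q u 3] by (auto simp: X_def mult.commute)
    have p3: "q powi (3 * u) = X ^ 3" "q powi (2 * u) = X ^ 2"
      using power_int_mult[of q u 3] power_int_mult[of q u 2] by (simp_all add: X_def mult.commute)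
    have a: "?p u = V * X ^ 2 / (1 + X ^ 3)" "?r u = V * X ^ 3 / (1 + X ^ 3)"
      using assms(2) by (simp_all add: power_int_add p3 V_def)
    have "?p (- u) = V * X / (1 + 1 / X ^ 3)"
    proof -
      have "3 * tri (- u) + 2 * (- u) = 3 * tri u + u" unfolding tu by simp
      then have "q powi (3 * tri (- u) + 2 * (- u)) = V * X" using assms(2) by (simp only: power_int_add simp_thms V_def X_def)
      moreover have "q powi (3 * (- u)) = 1 / X ^ 3" by (simp add: power_int_minus p3 divide_simps)
      ultimately show ?thesis by (simp only:)
    qed
    also have "\<dots> = V * X ^ 4 / (1 + X ^ 3)" using X by (simp add: divide_simps) algebra
    finally have b: "?p (- u) = V * X ^ 4 / (1 + X ^ 3)" .
    have "q powi (3 * tri u + 2 * u) / (1 + q powi u) = V * X ^ 2 / (1 + X)"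
      using assms(2) by (simp add: power_int_add p3 V_def X_def)
    also have "\<dots> = V * X ^ 2 / (1 + X ^ 3) + (V * X ^ 4 / (1 + X ^ 3) + - (V * X ^ 3 / (1 + X ^ 3)))"
      using X by (simp add: divide_simps) algebra
    finally show ?thesis unfolding a b .
  qed
  then have "lambert_B q = (\<Sum>\<^sub>\<infinity>u. ?p u + (?p (- u) + - ?r u))" unfolding lambert_B_def by simp
  also have "\<dots> = lambert_P q + (lambert_P q + - (\<Sum>\<^sub>\<infinity>u. ?r u))"
  proof (intro infsumI has_sum_add)
    show "(?p has_sum lambert_P q) UNIV" unfolding lambert_P_def using sp by (rule has_sum_infsum)
    show "((\<lambda>u. ?p (- u)) has_sum lambert_P q) UNIV"
      unfolding lambert_P_def using has_sum_infsum[OF sp'] infsum_int_uminus[of ?p] by (simp only:)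
    show "((\<lambda>u. - ?r u) has_sum - (\<Sum>\<^sub>\<infinity>u. ?r u)) UNIV"
      using has_sum_infsum[OF sr] by (simp only: has_sum_uminus minus_minus)
  qed
  also have "(\<Sum>\<^sub>\<infinity>u. ?r u) = lambert_R (q ^ 3)"
    unfolding lambert_R_def
  proof (rule infsum_cong)
    fix u
    have "(q ^ 3) powi k = q powi (3 * k)" for k using power_int_mult[of q 3 k] by simp
    then show "?r u = (q ^ 3) powi (tri u + u) / (1 + (q ^ 3) powi u)" by (simp only: distrib_left)
  qed
  finally show ?thesis by simp
qed

lemma infsum_int_even_terms:
  fixes f :: "int \<Rightarrow> complex"
  shows "(\<Sum>\<^sub>\<infinity>u. if even u then f u else 0) = (\<Sum>\<^sub>\<infinity>r. f (2 * r))"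
proof -
  have "(\<Sum>\<^sub>\<infinity>u. if even u then f u else 0) = infsum f (range (\<lambda>r. 2 * r))"
    by (rule infsum_cong_neutral) auto
  also have "\<dots> = (\<Sum>\<^sub>\<infinity>r. f (2 * r))"
    by (subst infsum_reindex) (auto simp: o_def inj_on_def)
  finally show ?thesis .
qed

lemma lambert_R_eq:
  assumes "norm q < 1" "q \<noteq> 0"
  shows "lambert_R q = theta_j (- 1) q * mock_mu q / 2 - (\<Sum>\<^sub>\<infinity>u. mu_alpha q u) / 2"
proof -
  let ?r = "\<lambda>u. q powi (tri u + u) / (1 + q powi u)"
  have sr: "?r summable_on UNIV" using summable_lambert[OF assms, of 1 1 1] by simp
  have "lambert_R q + 1 / 2 * (\<Sum>\<^sub>\<infinity>u. mu_alpha q u) = (\<Sum>\<^sub>\<infinity>u. ?r u + 1 / 2 * mu_alpha q u)"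
    unfolding lambert_R_def
    by (rule infsumI[symmetric]) (intro has_sum_add has_sum_cmult_right has_sum_infsum sr summable_mu_alpha assms)
  also have "\<dots> = (\<Sum>\<^sub>\<infinity>u. if even u then 2 * ?r u else 0)"
    by (rule infsum_cong) (auto simp: mu_alpha_def triangle_Suc power_int_minus_left)
  also have "\<dots> = (\<Sum>\<^sub>\<infinity>r. 2 * ?r (2 * r))" by (rule infsum_int_even_terms)
  also have "\<dots> = 2 * (\<Sum>\<^sub>\<infinity>r. q powi (4 * tri r + 3 * r) / (1 + q powi (2 * r)))"
  proof -
    have "tri (2 * r) + 2 * r = 4 * tri r + 3 * r" for r
    proof -
      have "S + 2 * r = 4 * T + 3 * r" if "2 * S = 2 * r * (2 * r - 1)" "2 * T = r * (r - 1)" for S T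
        using that by (simp add: algebra_simps)
      from this[OF triangle_double triangle_double] show ?thesis .
    qed
    then show ?thesis by (simp only: infsum_cmult_right')
  qed
  also have "\<dots> = theta_j (- 1) q * mock_mu q / 2" unfolding mock_mu_bilateral[OF assms] by simp
  finally show ?thesis by (simp add: algebra_simps)
qed

subsection \<open>The sixth-order function as a double sum\<close>

text \<open>The tail from N = 2 m of the partial theta series with terms (-1)^N
  q^(N(N+1)/2).\<close>

definition tail_sum :: "complex \<Rightarrow> nat \<Rightarrow> complex" where
  "tail_sum q m = (\<Sum>\<^sub>\<infinity>t::nat. (- 1) ^ t * q powi (tri (2 * int m + int t) + (2 * int m + int t)))"

lemma triangle_add: "tri (a + b) = tri a + tri b + a * b"
proof -
  have "S = T + U + a * b" if "2 * S = (a + b) * (a + b - 1)" "2 * T = a * (a - 1)" "2 * U = b * (b - 1)" for S T U :: int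
  proof -
    have "2 * S = 2 * (T + U + a * b)" unfolding that distrib_left by (simp add: algebra_simps that)
    then show ?thesis by simp
  qed
  from this[OF triangle_double triangle_double triangle_double] show ?thesis .
qed

lemma triangle_twice: "tri (2 * a) = 4 * tri a + a"
  using triangle_add[of a a] square_triangle[of a] by (simp add: mult_2[symmetric])

lemma tail_sum_exponent_ge: "4 * tri (int m) + 3 * int m + int t \<le> tri (2 * int m + int t) + (2 * int m + int t)"
proof -
  have "0 \<le> tri (int t) + 2 * int m * int t" using triangle_nonneg[of "int t"] by (simp del: zero_le_divide_iff)
  then show ?thesis unfolding triangle_add[of "2 * int m"] triangle_twice by linarith
qed

lemma tail_sum_bounds:
  assumes "norm q < 1" "q \<noteq> 0"
  shows "(\<lambda>t::nat. (- 1) ^ t * q powi (tri (2 * int m + int t) + (2 * int m + int t))) summable_on UNIV"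
    "norm (tail_sum q m) \<le> norm q powi (4 * tri (int m) + 3 * int m) * (\<Sum>\<^sub>\<infinity>t::nat. norm q ^ t)"
proof -
  let ?f = "\<lambda>t::nat. (- 1) ^ t * q powi (tri (2 * int m + int t) + (2 * int m + int t))"
  let ?g = "\<lambda>t::nat. norm q powi (4 * tri (int m) + 3 * int m) * norm q ^ t"
  have g: "(\<lambda>t::nat. norm q ^ t) summable_on UNIV"
    using assms by (intro summable_nonneg_imp_summable_on summable_geometric) auto
  then have sg: "?g summable_on UNIV" by (rule summable_on_cmult_right)
  have b: "norm (?f t) \<le> ?g t" for t
  proof -
    have "norm (?f t) = norm q powi (tri (2 * int m + int t) + (2 * int m + int t))"
      by (simp add: norm_mult norm_power norm_power_int)
    also have "\<dots> \<le> norm q powi (4 * tri (int m) + 3 * int m + int t)"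
      using assms tail_sum_exponent_ge by (intro power_int_decreasing) auto
    also have "\<dots> = ?g t" using assms by (subst power_int_add) auto
    finally show ?thesis .
  qed
  show s: "?f summable_on UNIV" by (rule summable_on_norm_bound[OF sg b])
  have sn: "(\<lambda>t. norm (?f t)) summable_on UNIV" using s by (simp add: summable_on_iff_abs_summable_on_complex)
  have "norm (tail_sum q m) \<le> (\<Sum>\<^sub>\<infinity>t. norm (?f t))" unfolding tail_sum_def by (rule norm_infsum_bound) (rule sn)
  also have "\<dots> \<le> (\<Sum>\<^sub>\<infinity>t. ?g t)" by (rule infsum_mono[OF sn sg b])
  also have "\<dots> = norm q powi (4 * tri (int m) + 3 * int m) * (\<Sum>\<^sub>\<infinity>t::nat. norm q ^ t)" by (rule infsum_cmult_right')
  finally show "norm (tail_sum q m) \<le> norm q powi (4 * tri (int m) + 3 * int m) * (\<Sum>\<^sub>\<infinity>t::nat. norm q ^ t)" .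
qed

lemma tail_sum_Suc:
  assumes "norm q < 1" "q \<noteq> 0"
  shows "tail_sum q m = q powi (4 * tri (int m) + 3 * int m) - q powi (4 * tri (int m) + 5 * int m + 1) + tail_sum q (Suc m)"
proof -
  let ?f = "\<lambda>t::nat. (- 1) ^ t * q powi (tri (2 * int m + int t) + (2 * int m + int t))"
  have s: "?f summable_on UNIV" by (rule tail_sum_bounds(1)[OF assms])
  have s': "(\<lambda>t. ?f (Suc t)) summable_on UNIV" by (rule summable_nat_subseq[OF s]) simp
  have "tail_sum q m = ?f 0 + (?f (Suc 0) + (\<Sum>\<^sub>\<infinity>t. ?f (Suc (Suc t))))"
    unfolding tail_sum_def by (simp only: infsum_nat_Suc[OF s] infsum_nat_Suc[OF s'])
  moreover have "(\<Sum>\<^sub>\<infinity>t. ?f (Suc (Suc t))) = tail_sum q (Suc m)"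
  proof -
    have "2 * int m + int (Suc (Suc t)) = 2 * int (Suc m) + int t" for t by simp
    then show ?thesis unfolding tail_sum_def by (simp only: power_Suc mult_minus_left minus_minus mult_1_left)
  qed
  moreover have "?f 0 = q powi (4 * tri (int m) + 3 * int m)"
  proof -
    have "tri (2 * int m + int 0) + (2 * int m + int 0) = 4 * tri (int m) + 3 * int m"
      unfolding triangle_add[of "2 * int m"] triangle_twice by simp
    then show ?thesis by (simp only: power_0 mult_1_left)
  qed
  moreover have "?f (Suc 0) = - (q powi (4 * tri (int m) + 5 * int m + 1))"
  proof -
    have "tri (2 * int m + int (Suc 0)) + (2 * int m + int (Suc 0)) = 4 * tri (int m) + 5 * int m + 1"
      unfolding triangle_add[of "2 * int m"] triangle_twice by simp
    then show ?thesis by (simp only: power_Suc0_right mult_minus_left mult_1_left)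
  qed
  ultimately show ?thesis by simp
qed

text \<open>For s \<ge> 1 the index |s| exceeds |s - 1| by one, for s \<le> 0 it is smaller by one;
  in both cases two consecutive terms of the partial theta series separate the tails, and the
  symmetry of tri gives one formula. These two terms later produce the theta functions in
  \<open>phi_laurent_functional\<close>.\<close>

lemma tail_sum_diff:
  assumes "norm q < 1" "q \<noteq> 0"
  shows "tail_sum q (nat \<bar>s\<bar>) - tail_sum q (nat \<bar>s - 1\<bar>) = q powi (4 * tri s + s) - q powi (4 * tri s - s + 1)"
proof (cases "s \<ge> 1")
  case True
  define m where "m = nat (s - 1)"
  have m: "nat \<bar>s - 1\<bar> = m" "nat \<bar>s\<bar> = Suc m" "s = int m + 1" using True by (auto simp: m_def)
  have t: "tri (int m + 1) = tri (int m) + int m" using triangle_add[of "int m" 1] by simp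
  have "4 * tri s - s + 1 = 4 * tri (int m) + 3 * int m" "4 * tri s + s = 4 * tri (int m) + 5 * int m + 1"
    unfolding m(3) t by simp_all
  then show ?thesis unfolding m(1,2) using tail_sum_Suc[OF assms, of m] by simp
next
  case False
  define m where "m = nat (- s)"
  have m: "nat \<bar>s - 1\<bar> = Suc m" "nat \<bar>s\<bar> = m" "s = - int m" using False by (auto simp: m_def)
  have "4 * tri s - s + 1 = 4 * tri (int m) + 5 * int m + 1" "4 * tri s + s = 4 * tri (int m) + 3 * int m"
    unfolding m(3) triangle_uminus by simp_all
  then show ?thesis unfolding m(1,2) using tail_sum_Suc[OF assms, of m] by simp
qed

lemma phi_diagonal_odd:
  assumes "odd u"
  shows "(\<Sum>k\<le>u. (- 1) ^ (u - k) * q ^ ((u - k) * k)) = (0 :: complex)" (is "?S = 0")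
proof -
  have "?S = (\<Sum>k\<le>u. (- 1) ^ k * q ^ ((u - k) * k))"
    by (rule sum.reindex_bij_witness[of _ "\<lambda>k. u - k" "\<lambda>k. u - k"]) (auto simp: mult.commute)
  also have "\<dots> = - ?S"
    unfolding sum_negf[symmetric]
  proof (rule sum.cong)
    fix k assume "k \<in> {..u}"
    then have "odd (u - k) \<longleftrightarrow> even k" using assms by auto
    then show "(- 1) ^ k * q ^ ((u - k) * k) = - ((- 1) ^ (u - k) * q ^ ((u - k) * k))"
      by (cases "even k") auto
  qed simp
  finally show ?thesis by simp
qed

text \<open>Centring by j = n - k gives (2n - k) k = n^2 - j^2.\<close>

lemma phi_diagonal_even:
  assumes "q \<noteq> 0"
  shows "(\<Sum>k\<le>2 * n. (- 1) ^ (2 * n - k) * q ^ ((2 * n - k) * k)) = (- 1) ^ n * q powi (int n * int n) * phi_sum q (int n)"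
proof -
  have "(\<Sum>k\<le>2 * n. (- 1) ^ (2 * n - k) * q ^ ((2 * n - k) * k))
    = (\<Sum>j\<in>{- int n..int n}. (- 1) ^ n * q powi (int n * int n) * ((- 1) powi j * q powi (- (j * j))))"
  proof (rule sum.reindex_bij_witness[of _ "\<lambda>j. nat (int n - j)" "\<lambda>k. int n - int k"])
    fix k assume "k \<in> {..2 * n}"
    then have k: "k \<le> 2 * n" by simp
    define j where "j = int n - int k"
    have "int ((2 * n - k) * k) = int n * int n + - (j * j)"
      unfolding j_def using k by (simp add: of_nat_diff algebra_simps)
    then have "q ^ ((2 * n - k) * k) = q powi (int n * int n) * q powi (- (j * j))"
      using assms by (metis power_int_add power_int_of_nat)
    moreover have "(- 1 :: complex) ^ (2 * n - k) = (- 1) ^ n * (- 1) powi j"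
    proof -
      have "(- 1 :: complex) ^ (2 * n - k) = (- 1) powi (int n + j)"
        using k by (simp add: j_def of_nat_diff flip: power_int_of_nat)
      then show ?thesis by (simp add: power_int_add)
    qed
    ultimately show "(- 1) ^ n * q powi (int n * int n) * ((- 1) powi (int n - int k) * q powi (- ((int n - int k) * (int n - int k))))
      = (- 1) ^ (2 * n - k) * q ^ ((2 * n - k) * k)"
      unfolding j_def[symmetric] by simp
  qed auto
  also have "\<dots> = (- 1) ^ n * q powi (int n * int n) * phi_sum q (int n)"
    unfolding sum_distrib_left[symmetric] by (simp add: phi_sum_def)
  finally show ?thesis .
qed

lemma has_sum_nat_even_support:
  fixes f :: "nat \<Rightarrow> complex"
  assumes "(f has_sum S) UNIV" "\<And>u. odd u \<Longrightarrow> f u = 0"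
  shows "((\<lambda>n. f (2 * n)) has_sum S) UNIV"
proof -
  have "(f has_sum S) (range (\<lambda>n. 2 * n))"
  proof (rule has_sum_cong_neutral[THEN iffD1, OF _ _ _ assms(1)])
    fix u :: nat
    assume "u \<in> UNIV - range (\<lambda>n. 2 * n)"
    then have "odd u" by (auto elim!: evenE)
    then show "f u = 0" by (rule assms(2))
  qed auto
  then show ?thesis by (subst (asm) has_sum_reindex) (auto simp: inj_on_def o_def)
qed

text \<open>The double sum \<open>f\<^bsub>1,2,1\<^esub>(q,-q;q)\<close>, summed along \<open>r + s = const\<close> and along rows.\<close>

lemma phi_tail_sum:
  assumes "norm q < 1" "q \<noteq> 0"
  shows "(\<Sum>\<^sub>\<infinity>r. (- 1) powi r * q powi (3 * (r * r) + r) * phi_sum q r) =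
    (\<Sum>\<^sub>\<infinity>s. q powi (- (3 * tri s + 2 * s)) * tail_sum q (nat \<bar>s\<bar>))"
proof -
  define f where "f = (\<lambda>(r::nat) (s::nat). (- 1) ^ r * q powi (tri (int (r + s)) + int (r + s) + int r * int s))"
  \<comment> \<open>Minus the term at (-1 - r, -1 - s): the sign in front of the negative quadrant
    is absorbed, so the two quadrants are added.\<close>
  define f' where "f' = (\<lambda>(r::nat) (s::nat). (- 1) ^ r * q powi (tri (int (r + s) + 2) + (1 + int r) * (1 + int s)))"
  have sf: "(\<lambda>(r, s). f r s) summable_on UNIV"
  proof (rule summable_powi_nat2[OF assms])
    fix r s :: nat
    show "norm (f r s) = norm q powi (tri (int (r + s)) + int (r + s) + int r * int s)"
      by (simp add: f_def norm_mult norm_power norm_power_int)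
    have "0 \<le> int r * int s" by simp
    from add_mono[OF add_mono[OF triangle_nonneg[of "int (r + s)"] order_refl[of "int (r + s)"]] this]
    show "int r + int s \<le> tri (int (r + s)) + int (r + s) + int r * int s"
      by (simp only: add_0 add_0_right of_nat_add)
  qed
  have tt: "tri (int u + 2) = tri (int u) + 2 * int u + 1" for u using triangle_add[of "int u" 2] by simp
  have sf': "(\<lambda>(r, s). f' r s) summable_on UNIV"
  proof (rule summable_powi_nat2[OF assms])
    fix r s :: nat
    show "norm (f' r s) = norm q powi (tri (int (r + s) + 2) + (1 + int r) * (1 + int s))"
      by (simp add: f'_def norm_mult norm_power norm_power_int)
    have "0 \<le> (1 + int r) * (1 + int s) + int (r + s) + 1" by simp
    from add_mono[OF add_mono[OF triangle_nonneg[of "int (r + s)"] order_refl[of "int (r + s)"]] this]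
    show "int r + int s \<le> tri (int (r + s) + 2) + (1 + int r) * (1 + int s)"
      unfolding tt by (simp only: add_0 add_0_right of_nat_add) (simp add: algebra_simps)
  qed
  let ?P = "\<Sum>\<^sub>\<infinity>(r, s)\<in>UNIV. f r s" and ?N = "\<Sum>\<^sub>\<infinity>(r, s)\<in>UNIV. f' r s"
  \<comment> \<open>Both quadrants have this same inner sum along diagonal u. It vanishes for odd u,
    and u = 2n supplies the terms r = n and r = -1 - n of the bilateral series.\<close>
  define D where "D = (\<lambda>u. \<Sum>k\<le>u. (- 1) ^ (u - k) * q ^ ((u - k) * k))"
  have d1: "(\<Sum>k\<le>u. f (u - k) k) = q powi (tri (int u) + int u) * D u" for u
    unfolding D_def sum_distrib_left
  proof (rule sum.cong)
    fix k assume "k \<in> {..u}"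
    then have k: "u - k + k = u" by simp
    have "q powi (tri (int u) + int u + int (u - k) * int k) = q powi (tri (int u) + int u) * q ^ ((u - k) * k)"
      using assms(2) by (subst power_int_add) (auto simp flip: of_nat_mult)
    then show "f (u - k) k = q powi (tri (int u) + int u) * ((- 1) ^ (u - k) * q ^ ((u - k) * k))"
      unfolding f_def k by simp
  qed simp
  have d2: "(\<Sum>k\<le>u. f' (u - k) k) = q powi (tri (int u + 2) + int u + 1) * D u" for u
    unfolding D_def sum_distrib_left
  proof (rule sum.cong)
    fix k assume "k \<in> {..u}"
    then have k: "u - k + k = u" by simp
    have "(1 + int (u - k)) * (1 + int k) = int u + 1 + int ((u - k) * k)"
      using \<open>k \<in> {..u}\<close> by (simp add: of_nat_diff algebra_simps)
    then have e: "tri (int u + 2) + (1 + int (u - k)) * (1 + int k) = tri (int u + 2) + int u + 1 + int ((u - k) * k)" by simp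
    have "q powi (tri (int u + 2) + (1 + int (u - k)) * (1 + int k)) = q powi (tri (int u + 2) + int u + 1) * q ^ ((u - k) * k)"
      unfolding e using assms(2) by (subst power_int_add) (auto simp del: of_nat_mult)
    then show "f' (u - k) k = q powi (tri (int u + 2) + int u + 1) * ((- 1) ^ (u - k) * q ^ ((u - k) * k))"
      unfolding f'_def k by simp
  qed simp
  have D: "q powi m * D (2 * n) = (- 1) ^ n * q powi (m + int n * int n) * phi_sum q (int n)" for m n
    unfolding D_def phi_diagonal_even[OF assms(2)] using assms(2) by (simp add: power_int_add)
  let ?a = "\<lambda>r. (- 1) powi r * q powi (3 * (r * r) + r) * phi_sum q r"
  have "(?a has_sum (?P + ?N)) UNIV"
  proof (rule has_sum_int_split)
    have "((\<lambda>n. q powi (tri (int (2 * n)) + int (2 * n)) * D (2 * n)) has_sum ?P) UNIV"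
      by (rule has_sum_nat_even_support[OF infsum_diagonal[OF sf, unfolded d1]]) (simp add: D_def phi_diagonal_odd)
    moreover have "tri (int (2 * n)) + int (2 * n) + int n * int n = 3 * (int n * int n) + int n" for n
    proof -
      have "T' + 2 * N + N * N = 3 * (N * N) + N" if "T' = 4 * T + N" "N * N = 2 * T + N" for T T' N :: int
        using that by simp
      from this[OF triangle_twice square_triangle, of "int n"] show ?thesis by simp
    qed
    ultimately show "((\<lambda>n. ?a (int n)) has_sum ?P) UNIV"
      unfolding D by (simp only: power_int_of_nat)
    have "((\<lambda>n. q powi (tri (int (2 * n) + 2) + int (2 * n) + 1) * D (2 * n)) has_sum ?N) UNIV"
      by (rule has_sum_nat_even_support[OF infsum_diagonal[OF sf', unfolded d2]]) (simp add: D_def phi_diagonal_odd)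
    moreover have "tri (int (2 * n) + 2) + int (2 * n) + 1 + int n * int n = 3 * ((- 1 - int n) * (- 1 - int n)) + (- 1 - int n)" for n
    proof -
      have "T' + 2 * (2 * N) + 1 + 2 * N + 1 + N * N = 3 * ((- 1 - N) * (- 1 - N)) + (- 1 - N)"
        if "T' = 4 * T + N" "N * N = 2 * T + N" for T T' N :: int
        using that by (simp add: algebra_simps)
      from this[OF triangle_twice square_triangle, of "int n"] show ?thesis unfolding tt by simp
    qed
    moreover have "(- 1) powi (- 1 - int n) * x * phi_sum q (- 1 - int n) = (- 1) ^ n * x * phi_sum q (int n)" for n x
      using phi_sum_reflect[of q "int n + 1"] minus_one_powi_uminus[of "1 + int n"] by (simp add: algebra_simps power_int_add)
    ultimately show "((\<lambda>n. ?a (- 1 - int n)) has_sum ?N) UNIV" unfolding D by (simp only:)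
  qed
  then have lhs: "(\<Sum>\<^sub>\<infinity>r. ?a r) = ?P + ?N" by (rule infsumI)
  let ?b = "\<lambda>s. q powi (- (3 * tri s + 2 * s)) * tail_sum q (nat \<bar>s\<bar>)"
  have "(?b has_sum (?P + ?N)) UNIV"
  proof (rule has_sum_int_split)
    \<comment> \<open>For fixed s the exponent is that of the partial theta series at N = 2 s + r,
      up to a part depending on s only; summing over r gives a tail.\<close>
    have row: "((\<lambda>r. f r s) has_sum ?b (int s)) UNIV" for s
    proof -
      have "f r s = q powi (- (3 * tri (int s) + 2 * int s)) * ((- 1) ^ r * q powi (tri (2 * int s + int r) + (2 * int s + int r)))" for r
      proof -
        have "R + S + r * s + (r + s) + r * s = - (3 * S + 2 * s) + (4 * S + s + R + 2 * s * r + (2 * s + r))" for R S r s :: int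
          by (simp add: algebra_simps)
        then have "tri (int (r + s)) + int (r + s) + int r * int s = - (3 * tri (int s) + 2 * int s) + (tri (2 * int s + int r) + (2 * int s + int r))"
          unfolding of_nat_add triangle_add[of "2 * int s"] triangle_twice triangle_add[of "int r"] .
        then show ?thesis unfolding f_def using assms(2) by (simp only: power_int_add simp_thms mult_ac)
      qed
      then show ?thesis
        using has_sum_cmult_right[OF has_sum_infsum[OF tail_sum_bounds(1)[OF assms, of s]]] unfolding tail_sum_def by simp
    qed
    have "((\<lambda>(s, r). f r s) has_sum ?P) (UNIV \<times> UNIV)"
      using has_sum_infsum[OF sf] by (subst has_sum_swap) simp
    then show "((\<lambda>s. ?b (int s)) has_sum ?P) UNIV"
      by (rule has_sum_SigmaD) (use row in simp)
    have row': "((\<lambda>r. f' r s) has_sum ?b (- 1 - int s)) UNIV" for s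
    proof -
      have "f' r s = q powi (- (3 * tri (- 1 - int s) + 2 * (- 1 - int s))) * ((- 1) ^ r * q powi (tri (2 * int (Suc s) + int r) + (2 * int (Suc s) + int r)))" for r
      proof -
        have t1: "tri (- 1 - int s) = tri (int s) + 2 * int s + 1"
        proof -
          have e: "- 1 - int s = - (int s + 1)" by simp
          have "tri (int s + 1) = tri (int s) + int s" using triangle_add[of "int s" 1] by simp
          then show ?thesis unfolding e triangle_uminus by linarith
        qed
        have t2: "tri (int s + 1) = tri (int s) + int s" using triangle_add[of "int s" 1] by simp
        have "R + S + r * s + 2 * (r + s) + 1 + (1 + r) * (1 + s) =
            - (3 * (S + 2 * s + 1) + 2 * (- 1 - s)) + (4 * (S + s) + (s + 1) + R + 2 * (s + 1) * r + (2 * (s + 1) + r))" for R S r s :: int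
          by (simp add: algebra_simps)
        then have "tri (int (r + s) + 2) + (1 + int r) * (1 + int s) =
           - (3 * tri (- 1 - int s) + 2 * (- 1 - int s)) + (tri (2 * (int s + 1) + int r) + (2 * (int s + 1) + int r))"
          unfolding tt t1 unfolding of_nat_add triangle_add[of "2 * (int s + 1)"] triangle_twice t2 triangle_add[of "int r"] .
        moreover have "int (Suc s) = int s + 1" by simp
        ultimately show ?thesis unfolding f'_def using assms(2) by (simp only: power_int_add simp_thms mult_ac)
      qed
      moreover have "nat \<bar>- 1 - int s\<bar> = Suc s" by simp
      ultimately show ?thesis
        using has_sum_cmult_right[OF has_sum_infsum[OF tail_sum_bounds(1)[OF assms, of "Suc s"]]] unfolding tail_sum_def by simp
    qed
    have "((\<lambda>(s, r). f' r s) has_sum ?N) (UNIV \<times> UNIV)"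
      using has_sum_infsum[OF sf'] by (subst has_sum_swap) simp
    then show "((\<lambda>s. ?b (- 1 - int s)) has_sum ?N) UNIV"
      by (rule has_sum_SigmaD) (use row' in simp)
  qed
  then have "(\<Sum>\<^sub>\<infinity>s. ?b s) = ?P + ?N" by (rule infsumI)
  with lhs show ?thesis by simp
qed

subsection \<open>The theta functional equation and the cubic dissection\<close>

lemma theta_shift:
  assumes "norm q < 1" "q \<noteq> 0" "x \<noteq> 0"
  shows "theta_j (q * x) q = - theta_j x q / x"
proof -
  have 1: "qpoch_inf x q = (1 - x) * qpoch_inf (q * x) q" by (rule qpoch_inf_shift[OF assms(1)])
  have 2: "qpoch_inf (1 / x) q = (1 - 1 / x) * qpoch_inf (q / x) q" using qpoch_inf_shift[OF assms(1), of "1 / x"] by simp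
  have e: "q / (q * x) = 1 / x" using assms by simp
  have "theta_j (q * x) q = (1 - 1 / x) * (qpoch_inf (q * x) q * qpoch_inf (q / x) q * qpoch_inf q q)"
    unfolding theta_j_def e 2 by (simp add: mult_ac)
  also have "(1 - 1 / x) = - ((1 - x) / x)" using assms by (simp add: divide_simps)
  finally show ?thesis unfolding theta_j_def 1 by simp
qed

lemma theta_symmetric: "q \<noteq> 0 \<Longrightarrow> x \<noteq> 0 \<Longrightarrow> theta_j (q / x) q = theta_j x q"
  unfolding theta_j_def by simp

text \<open>All products are split modulo 3, and the parts of (q/x;q)_\<infinity> pair crosswise
  with those of (x;q)_\<infinity>. This matches the inhomogeneous term j(y;q) of the double sum with
  the theta functions of nome q^3 around the Appell sum.\<close>

lemma theta_dissect3:
  assumes "norm q < 1" "q \<noteq> 0" "x \<noteq> 0"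
  shows "theta_j x q * qpoch_inf (q ^ 3) (q ^ 3) ^ 3 =
    qpoch_inf q q * (theta_j x (q ^ 3) * theta_j (q * x) (q ^ 3) * theta_j (q\<^sup>2 * x) (q ^ 3))"
proof -
  have e: "q ^ 3 / (q * x) = q * (q / x)" "q ^ 3 / (q\<^sup>2 * x) = q / x" "q ^ 3 / x = q\<^sup>2 * (q / x)"
    using assms by (simp_all add: power2_eq_square power3_eq_cube)
  show ?thesis
    unfolding theta_j_def e qpoch_inf_dissect3[OF assms(1), of x] qpoch_inf_dissect3[OF assms(1), of "q / x"]
    by (simp only: power3_eq_cube mult_ac)
qed

subsection \<open>A functional equation without nonzero solutions\<close>

text \<open>Contraction towards \<open>0\<close> bounds \<open>h\<close> there, so \<open>h\<close> extends holomorphically; the functional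
  equation then forces all Taylor coefficients at \<open>0\<close> to vanish.\<close>

lemma functional_equation_zero:
  fixes h :: "complex \<Rightarrow> complex" and p :: complex
  assumes p: "0 < norm p" "norm p < 1" and r: "1 < r"
    and hol: "h holomorphic_on (ball 0 r - {0})"
    and eq: "\<And>y. y \<in> ball 0 r - {0} \<Longrightarrow> h (p * y) = - y * h y"
    and y: "y \<in> ball 0 r - {0}"
  shows "h y = 0"
proof -
  \<comment> \<open>A fundamental annulus for y \<mapsto> p y. Every point with 0 < |z| \<le> 1
    arises from one in \<open>K\<close> by multiplications by p at points of norm at most 1, where
    the factor -y does not increase the norm; thus a bound on \<open>K\<close> is a bound near
    0.\<close>
  define K where "K = cball 0 1 - ball (0 :: complex) (norm p)"
  have "compact K" unfolding K_def by (intro compact_diff) auto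
  moreover have Ksub: "K \<subseteq> ball 0 r - {0}" using p r by (auto simp: K_def)
  ultimately have "compact (h ` K)"
    using holomorphic_on_imp_continuous_on[OF hol] continuous_on_subset compact_continuous_image by blast
  then obtain M where M: "\<And>z. z \<in> K \<Longrightarrow> norm (h z) \<le> M"
    using compact_imp_bounded bounded_iff by (metis imageI)
  have bound: "norm (h z) \<le> M" if "0 < norm z" "norm p ^ n \<le> norm z" "norm z \<le> 1" for n z
    using that
  proof (induction n arbitrary: z)
    case 0
    then show ?case using p by (intro M) (auto simp: K_def)
  next
    case (Suc n)
    show ?case
    proof (cases "norm z \<ge> norm p")
      case True
      then show ?thesis using Suc.prems by (intro M) (auto simp: K_def)
    next
      case False
      define w where "w = z / p"
      have w: "z = p * w" "norm w \<le> 1" "0 < norm w" "norm p ^ n \<le> norm w"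
        using False Suc.prems p by (auto simp: w_def norm_divide divide_simps mult.commute)
      have "norm (h z) = norm w * norm (h w)" unfolding w(1) using eq[of w] w r by (simp add: norm_mult)
      also have "\<dots> \<le> 1 * norm (h w)" using w by (intro mult_right_mono) auto
      also have "\<dots> \<le> M" using Suc.IH[of w] w by simp
      finally show ?thesis .
    qed
  qed
  have bound': "norm (h z) \<le> M" if z: "0 < norm z" "norm z \<le> 1" for z
  proof -
    obtain n where "norm p ^ n < norm z" using real_arch_pow_inv[OF z(1) p(2)] by blast
    then show ?thesis using bound[of z n] z by simp
  qed
  have "eventually (\<lambda>z. norm (h z) \<le> M) (at 0)"
    unfolding eventually_at by (rule exI[of _ 1]) (auto intro!: bound')
  then obtain g where g: "g holomorphic_on ball 0 r" "\<And>z. z \<in> ball 0 r - {0} \<Longrightarrow> g z = h z"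
    using holomorphic_on_extend_bounded[OF hol] r by (auto simp: interior_open)
  have pm: "p * z \<in> ball 0 r - {0}" if "z \<in> ball 0 r - {0}" for z
  proof -
    have "norm (p * z) \<le> 1 * norm z" unfolding norm_mult by (intro mult_right_mono) (use p in auto)
    then show ?thesis using that p by auto
  qed
  have geq: "g (p * z) = - (z * g z)" if "z \<in> ball 0 r - {0}" for z
    using eq[OF that] g(2)[OF that] g(2)[OF pm[OF that]] by simp
  have ev: "eventually (\<lambda>z. z \<in> ball 0 r - {0}) (at 0)"
    unfolding eventually_at using r by (intro exI[of _ r]) (auto simp: dist_commute)
  have cont: "isCont g 0"
    using g(1) r by (meson centre_in_ball continuous_on_eq_continuous_at holomorphic_on_imp_continuous_on open_ball less_trans zero_less_one)
  have "(\<lambda>z. p * z) \<midarrow>0\<rightarrow> 0" by (auto intro!: tendsto_eq_intros)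
  then have "(\<lambda>z. g (p * z)) \<midarrow>0\<rightarrow> g 0" using cont isCont_tendsto_compose by blast
  moreover have "(\<lambda>z. - (z * g z)) \<midarrow>0\<rightarrow> - (0 * g 0)" using cont unfolding isCont_def by (intro tendsto_intros)
  then have "(\<lambda>z. g (p * z)) \<midarrow>0\<rightarrow> - (0 * g 0)"
    by (rule Lim_transform_eventually) (use ev in \<open>eventually_elim, simp add: geq\<close>)
  ultimately have g0: "g 0 = 0" using LIM_unique by fastforce
  define F where "F = fps_expansion g 0"
  have F: "g has_fps_expansion F"
    unfolding F_def by (rule has_fps_expansion_fps_expansion[OF open_ball _ g(1)]) (use r in auto)
  have F1: "(\<lambda>z. g (p * z)) has_fps_expansion (F oo (fps_const p * fps_X))"
    by (rule has_fps_expansion_compose[OF F, unfolded o_def]) (auto intro!: fps_expansion_intros)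
  have F2: "(\<lambda>z. - (z * g z)) has_fps_expansion (- (fps_X * F))"
    by (intro fps_expansion_intros F)
  have "eventually (\<lambda>z. g (p * z) = - (z * g z)) (nhds 0)"
    unfolding eventually_nhds using geq g0 r by (intro exI[of _ "ball 0 r"]) (metis DiffI centre_in_ball empty_iff insert_iff less_trans minus_zero mult_zero_left mult_zero_right open_ball zero_less_one)
  then have "(\<lambda>z. - (z * g z)) has_fps_expansion (F oo (fps_const p * fps_X))"
    using F1 has_fps_expansion_cong[of "\<lambda>z. g (p * z)" "\<lambda>z. - (z * g z)"] by blast
  \<comment> \<open>On coefficients this reads p^(n+1) F_{n+1} = -F_n, starting from F_0 =
    0.\<close>
  then have Feq: "F oo (fps_const p * fps_X) = - (fps_X * F)"
    using F2 fps_expansion_unique_complex by blast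
  have "fps_nth F n = 0" for n
  proof (induction n)
    case 0
    show ?case using has_fps_expansion_imp_0_eq_fps_nth_0[OF F] g0 by simp
  next
    case (Suc n)
    have "p ^ Suc n * fps_nth F (Suc n) = - fps_nth F n"
      using arg_cong[OF Feq, of "\<lambda>G. fps_nth G (Suc n)"] by (simp add: fps_nth_compose_linear)
    then show ?case using Suc p by simp
  qed
  then have "F = 0" by (simp add: fps_eq_iff)
  then have "eventually (\<lambda>z. g z = 0) (nhds 0)" using F by (simp add: has_fps_expansion_0_iff)
  then obtain e where e: "e > 0" "\<And>z. norm z < e \<Longrightarrow> g z = 0"
    unfolding eventually_nhds_metric by (auto simp: dist_norm)
  have zero: "h z = 0" if "z \<in> ball 0 r - {0}" "norm p ^ n * norm z < e" for n z
    using that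
  proof (induction n arbitrary: z)
    case 0
    then show ?case using e(2)[of z] g(2) by simp
  next
    case (Suc n)
    have "h (p * z) = 0" by (rule Suc.IH[OF pm]) (use Suc.prems in \<open>auto simp: norm_mult mult_ac\<close>)
    then show ?case using eq[OF Suc.prems(1)] Suc.prems(1) by simp
  qed
  have "norm y > 0" using y by auto
  then obtain n where "norm p ^ n < e / norm y" using real_arch_pow_inv[of "e / norm y" "norm p"] e(1) p by auto
  then have "norm p ^ n * norm y < e" using \<open>norm y > 0\<close> by (simp add: field_simps)
  then show ?thesis using zero[OF y] by blast
qed

subsection \<open>The sixth-order function as an Appell sum\<close>

lemma norm_powi_annulus:
  fixes w :: complex
  assumes "0 < a" "a \<le> norm w" "norm w \<le> b"
  shows "norm (w powi s) \<le> a powi s + b powi s"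
proof (cases "s \<ge> 0")
  case True
  then have "norm w powi s \<le> b powi s" using assms by (intro power_int_mono) auto
  moreover have "0 \<le> a powi s" using assms by simp
  ultimately show ?thesis by (simp add: norm_power_int)
next
  case False
  have "norm w powi s \<le> a powi s"
    using assms False by (simp add: power_int_def) (metis inverse_nonnegative_iff_nonnegative le_imp_inverse_le less_imp_le order.trans power_mono)
  moreover have "0 \<le> b powi s" using assms by simp
  ultimately show ?thesis by (simp add: norm_power_int)
qed

text \<open>Local M-test on the annulus |z|/2 \<le> |w| \<le> 3|z|/2. The outer radius bounds the
  powers with s \<ge> 0 and the inner radius those with s < 0; the sum of both is still summable
  against the Gaussian factor.\<close>

lemma holomorphic_gauss_laurent:
  fixes f :: "int \<Rightarrow> complex \<Rightarrow> complex"
  assumes "open S" "0 \<notin> S" "c \<noteq> 0" "0 < \<rho>" "\<rho> < 1" "\<And>s. f s holomorphic_on S"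
    and bound: "\<And>z. z \<in> S \<Longrightarrow> \<exists>d>0. \<exists>K. \<forall>w\<in>cball z d. \<forall>s. norm (f s w) \<le> K * (norm ((c * w) powi s) * \<rho> powi (tri s))"
  shows "(\<lambda>z. \<Sum>\<^sub>\<infinity>s. f s z) holomorphic_on S"
proof (rule holomorphic_infsum[OF assms(1,6)])
  fix z assume z: "z \<in> S"
  obtain d K where d: "d > 0" "\<And>w s. w \<in> cball z d \<Longrightarrow> norm (f s w) \<le> K * (norm ((c * w) powi s) * \<rho> powi (tri s))"
    using bound[OF z] by blast
  have z0: "norm z > 0" using z assms(2) by auto
  define e where "e = min d (norm z / 2)"
  define a b where "a = norm c * (norm z / 2)" and "b = norm c * (3 * norm z / 2)"
  have K: "K \<ge> 0"
  proof -
    have "0 \<le> K * (norm ((c * z) powi 0) * \<rho> powi (tri 0))" using d(2)[of z 0] d(1) norm_ge_zero order_trans by (metis centre_in_cball less_imp_le)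
    then show ?thesis by simp
  qed
  have "norm (f s w) \<le> K * (a powi s * \<rho> powi (tri s) + b powi s * \<rho> powi (tri s))" if "w \<in> cball z e" for s w
  proof -
    have "norm z / 2 \<le> norm w" "norm w \<le> 3 * norm z / 2"
      using that norm_triangle_ineq2[of z w] norm_triangle_ineq2[of w z] by (auto simp: e_def dist_norm norm_minus_commute)
    from this[THEN mult_left_mono, OF norm_ge_zero[of c]]
    have w: "a \<le> norm (c * w)" "norm (c * w) \<le> b" unfolding a_def b_def norm_mult .
    have "norm (f s w) \<le> K * (norm ((c * w) powi s) * \<rho> powi (tri s))" using that by (intro d(2)) (auto simp: e_def)
    also have "\<dots> \<le> K * ((a powi s + b powi s) * \<rho> powi (tri s))"
      using norm_powi_annulus[OF _ w, of s] z0 K assms(3,4) by (intro mult_left_mono mult_right_mono) (auto simp: a_def)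
    finally show ?thesis by (simp add: distrib_right)
  qed
  moreover have "(\<lambda>s. K * (a powi s * \<rho> powi (tri s) + b powi s * \<rho> powi (tri s))) summable_on UNIV"
    using z0 assms by (intro summable_on_cmult_right summable_on_add summable_gauss) (auto simp: a_def b_def)
  ultimately show "\<exists>d>0. \<exists>M. M summable_on UNIV \<and> (\<forall>s. \<forall>w\<in>cball z d. norm (f s w) \<le> M s)"
    using d(1) z0 by (intro exI[of _ e]) (auto simp: e_def)
qed

section \<open>The Laurent series of the sixth-order double sum\<close>

abbreviation phi_coeff :: "complex \<Rightarrow> int \<Rightarrow> complex" where
  "phi_coeff q s \<equiv> q powi (- (3 * tri s + 3 * s)) * tail_sum q (nat \<bar>s\<bar>)"

text \<open>The exponent 3 tri s + 3 s is chosen so that y = -q recovers the row sums of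
  \<open>phi_tail_sum\<close>, while y \<mapsto> q^3 y shifts the prefactor from s to s - 1.\<close>

definition phi_laurent :: "complex \<Rightarrow> complex \<Rightarrow> complex" where
  "phi_laurent q y = (\<Sum>\<^sub>\<infinity>s. (- y) powi s * phi_coeff q s)"

text \<open>The growth q^(-3 tri s) is beaten by the decay of order q^(4 tri s) of the tail, and a
  Gaussian factor remains.\<close>

lemma phi_laurent_term_bound:
  assumes "norm q < 1" "q \<noteq> 0"
  shows "norm ((- y) powi s * phi_coeff q s)
    \<le> (\<Sum>\<^sub>\<infinity>t::nat. norm q ^ t) * (norm (y powi s) * norm q powi (tri s))"
proof -
  have K: "0 \<le> (\<Sum>\<^sub>\<infinity>t::nat. norm q ^ t)" by (rule infsum_nonneg) simp
  have ex: "tri s \<le> - (3 * tri s + 3 * s) + (4 * tri (int (nat \<bar>s\<bar>)) + 3 * int (nat \<bar>s\<bar>))"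
  proof (cases "s \<ge> 0")
    case False
    then have "int (nat \<bar>s\<bar>) = - s" by simp
    then show ?thesis using False triangle_uminus[of s] by simp
  qed simp
  have "norm (phi_coeff q s)
    \<le> norm q powi (- (3 * tri s + 3 * s)) * (norm q powi (4 * tri (int (nat \<bar>s\<bar>)) + 3 * int (nat \<bar>s\<bar>)) * (\<Sum>\<^sub>\<infinity>t::nat. norm q ^ t))"
    unfolding norm_mult norm_power_int by (intro mult_left_mono tail_sum_bounds assms) simp
  also have "\<dots> = norm q powi (- (3 * tri s + 3 * s) + (4 * tri (int (nat \<bar>s\<bar>)) + 3 * int (nat \<bar>s\<bar>))) * (\<Sum>\<^sub>\<infinity>t::nat. norm q ^ t)"
    using assms by (subst power_int_add) auto
  also have "\<dots> \<le> norm q powi (tri s) * (\<Sum>\<^sub>\<infinity>t::nat. norm q ^ t)"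
    using ex assms K by (intro mult_right_mono power_int_decreasing) auto
  finally have "norm (y powi s) * norm (phi_coeff q s)
     \<le> norm (y powi s) * (norm q powi (tri s) * (\<Sum>\<^sub>\<infinity>t::nat. norm q ^ t))"
    by (rule mult_left_mono) simp
  then show ?thesis by (simp only: norm_mult norm_power_int norm_minus_cancel mult_ac)
qed

lemma summable_gauss_norm:
  fixes f :: "int \<Rightarrow> complex" and y :: complex
  assumes "0 < \<rho>" "\<rho> < 1" "y \<noteq> 0" "\<And>s. norm (f s) \<le> K * (norm (y powi s) * \<rho> powi (tri s))"
  shows "f summable_on UNIV"
proof (rule summable_on_norm_bound)
  show "(\<lambda>s. K * (norm y powi s * \<rho> powi (tri s))) summable_on UNIV"
    using assms by (intro summable_on_cmult_right summable_gauss) auto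
  show "norm (f s) \<le> K * (norm y powi s * \<rho> powi (tri s))" for s
    using assms(4)[of s] by (simp add: norm_power_int)
qed

lemma summable_phi_laurent:
  assumes "norm q < 1" "q \<noteq> 0" "y \<noteq> 0"
  shows "(\<lambda>s. (- y) powi s * phi_coeff q s) summable_on UNIV"
  by (rule summable_gauss_norm[OF _ assms(1,3) phi_laurent_term_bound[OF assms(1,2)]]) (use assms in auto)

lemma holomorphic_phi_laurent:
  assumes "norm q < 1" "q \<noteq> 0" "open S" "0 \<notin> S"
  shows "phi_laurent q holomorphic_on S"
  unfolding phi_laurent_def
proof (rule holomorphic_gauss_laurent[OF assms(3,4), of 1 "norm q"])
  show "(\<lambda>y. (- y) powi s * phi_coeff q s) holomorphic_on S" for s
    using assms(4) by (intro holomorphic_intros) auto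
  show "\<exists>d>0. \<exists>K. \<forall>w\<in>cball z d. \<forall>s. norm ((- w) powi s * phi_coeff q s)
      \<le> K * (norm ((1 * w) powi s) * norm q powi (tri s))" for z
    using phi_laurent_term_bound[OF assms(1,2)] by (intro exI[of _ 1]) auto
qed (use assms in auto)

text \<open>After the shift of the prefactor only the tail has the wrong index. Correcting it by
  \<open>tail_sum_diff\<close> costs q^(tri (s + 1)) - q^(tri (s - 1)), which are the terms of two
  shifted theta series; they sum to -j(y;q)/y and y j(y;q).\<close>

lemma phi_laurent_functional:
  assumes "norm q < 1" "q \<noteq> 0" "y \<noteq> 0"
  shows "phi_laurent q (q ^ 3 * y) = - y * phi_laurent q y + (y - 1 / y) * theta_j y q"
proof -
  let ?c = "phi_coeff q"
  let ?g = "\<lambda>s. (- y) powi s * ?c s"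
  let ?t = "\<lambda>s. (- y) powi s * q powi (tri s)"
  have q0: "0 < norm q" using assms by simp
  have sg: "?g summable_on UNIV" by (rule summable_phi_laurent[OF assms])
  have th: "(?t has_sum theta_j y q) UNIV" by (rule theta_series[OF q0 assms(1,3)])
  then have st: "?t summable_on UNIV" by (rule has_sum_imp_summable)
  have h1: "((\<lambda>s. ?g (s - 1)) has_sum phi_laurent q y) UNIV"
    using infsum_int_shift[of ?g "- 1"] summable_on_int_shift[of ?g "- 1"] sg unfolding phi_laurent_def has_sum_iff by simp
  have h2: "((\<lambda>s. ?t (s - 1)) has_sum theta_j y q) UNIV"
    using infsum_int_shift[of ?t "- 1"] summable_on_int_shift[of ?t "- 1"] th unfolding has_sum_iff by simp
  have h3: "((\<lambda>s. ?t (s + 1)) has_sum theta_j y q) UNIV"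
    using infsum_int_shift[of ?t 1] summable_on_int_shift[of ?t 1] th unfolding has_sum_iff by simp
  have "(- (q ^ 3 * y)) powi s * ?c s = - y * ?g (s - 1) + (y * ?t (s - 1) + - (1 / y) * ?t (s + 1))" for s
  proof -
    define W X Y where "W = q powi (tri s)" and "X = q powi s" and "Y = (- y) powi s"
    define A B where "A = tail_sum q (nat \<bar>s\<bar>)" and "B = tail_sum q (nat \<bar>s - 1\<bar>)"
    have nz: "W \<noteq> 0" "X \<noteq> 0" using assms by (auto simp: W_def X_def)
    have p: "q powi (k * n) = (q powi n) powi k" for k n by (metis power_int_mult mult.commute)
    have p3: "q powi (3 * n) = (q powi n) ^ 3" "q powi (4 * n) = (q powi n) ^ 4" for n
      using p[of 3 n] p[of 4 n] by simp_all
    have t1: "tri (s - 1) = tri s - s + 1" using triangle_add[of s "- 1"] by simp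
    have t2: "tri (s + 1) = tri s + s" using triangle_add[of s 1] by simp
    have AB: "A - B = W ^ 4 * X - W ^ 4 * q / X"
      using tail_sum_diff[OF assms(1,2), of s] assms(2)
      by (simp add: A_def B_def W_def X_def power_int_add power_int_diff p3)
    have e1: "q powi (- (3 * tri s + 3 * s)) = 1 / (W ^ 3 * X ^ 3)"
      using assms(2) by (simp add: power_int_minus power_int_diff p3 W_def X_def divide_simps)
    have e2: "q powi (- (3 * tri (s - 1) + 3 * (s - 1))) = 1 / W ^ 3"
      unfolding t1 using assms(2) by (simp add: power_int_minus p3 W_def divide_simps)
    have e3: "q powi (tri (s - 1)) = W * q / X" "q powi (tri (s + 1)) = W * X"
      unfolding t1 t2 using assms(2) by (simp_all add: power_int_add power_int_diff W_def X_def)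
    have y1: "(- y) powi (s - 1) = - Y / y" "(- y) powi (s + 1) = - (Y * y)"
      using assms(3) by (simp_all add: power_int_add power_int_diff Y_def)
    have y2: "(- (q ^ 3 * y)) powi s = X ^ 3 * Y"
      using power_int_mult_distrib[of "q ^ 3" "- y" s] power_int_mult[of q 3 s] p3(1)[of s] by (simp add: X_def Y_def)
    have "A = B + (W ^ 4 * X - W ^ 4 * q / X)" using AB by (simp add: algebra_simps)
    then show ?thesis unfolding y1 y2 e1 e2 e3 A_def[symmetric] B_def[symmetric] using nz assms(3)
      by (simp only:) (simp add: field_simps power4_eq_xxxx power3_eq_cube)
  qed
  then have "phi_laurent q (q ^ 3 * y) = (\<Sum>\<^sub>\<infinity>s. - y * ?g (s - 1) + (y * ?t (s - 1) + - (1 / y) * ?t (s + 1)))"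
    unfolding phi_laurent_def by (simp only:)
  also have "\<dots> = - y * phi_laurent q y + (y * theta_j y q + - (1 / y) * theta_j y q)"
    by (intro infsumI has_sum_add has_sum_cmult_right h1 h2 h3)
  finally show ?thesis by (simp add: algebra_simps)
qed

text \<open>The product \<open>(q/y; q\<^sup>3)\<^sub>\<infinity>\<close> with its factor \<open>1 - q\<^bsup>3r+1\<^esup>/y\<close> removed: this cancels the poles of
  the Appell sum, so that \<open>appell_reg\<close> is holomorphic for \<open>0 < norm y < norm q powi (- 2)\<close>.\<close>

definition appell_reg_term :: "complex \<Rightarrow> int \<Rightarrow> complex \<Rightarrow> complex" where
  "appell_reg_term q r y = (- (q * y)) powi r * (q ^ 3) powi (tri r) *
     (if r \<ge> 0 then qpoch (q / y) (q ^ 3) (nat r) * qpoch_inf ((q ^ 3) ^ Suc (nat r) * (q / y)) (q ^ 3)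
      else qpoch_inf (q / y) (q ^ 3) / (1 - q powi (3 * r + 1) / y))"

definition appell_reg :: "complex \<Rightarrow> complex \<Rightarrow> complex" where
  "appell_reg q y = (\<Sum>\<^sub>\<infinity>r. appell_reg_term q r y)"

text \<open>Poles lie at y = q^(3r+1). At y = -q the term becomes that of
  \<open>lambert_P\<close>.\<close>

definition appell_term :: "complex \<Rightarrow> int \<Rightarrow> complex \<Rightarrow> complex" where
  "appell_term q r y = (- (q * y)) powi r * (q ^ 3) powi (tri r) / (1 - q powi (3 * r + 1) / y)"

lemma appell_reg_term_eq:
  assumes "norm q < 1" "q \<noteq> 0" "\<And>r. q powi (3 * r + 1) \<noteq> y" "y \<noteq> 0"
  shows "appell_reg_term q r y = qpoch_inf (q / y) (q ^ 3) * appell_term q r y"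
proof (cases "r \<ge> 0")
  case True
  then have e: "q powi (3 * r + 1) / y = (q ^ 3) ^ nat r * (q / y)"
    using assms(2) by (simp add: power_int_def nat_add_distrib nat_mult_distrib power_mult)
  have nz: "1 - (q ^ 3) ^ nat r * (q / y) \<noteq> 0" using assms(3)[of r] assms(4) unfolding e[symmetric] by auto
  have f: "qpoch_inf (q / y) (q ^ 3) = qpoch (q / y) (q ^ 3) (nat r) * (1 - (q ^ 3) ^ nat r * (q / y)) * qpoch_inf ((q ^ 3) ^ Suc (nat r) * (q / y)) (q ^ 3)"
    using qpoch_inf_split[OF norm_power3_less_1[OF assms(1)], of "q / y" "Suc (nat r)"] by (simp add: qpoch_Suc)
  show ?thesis using True nz assms(4) unfolding appell_reg_term_def appell_term_def e f by (simp del: power_Suc)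
next
  case False
  then show ?thesis unfolding appell_reg_term_def appell_term_def by simp
qed

lemma norm_q_powi_3:
  fixes q :: complex
  assumes "norm q < 1" "q \<noteq> 0" "r < 0"
  shows "norm q powi (- 2) \<le> norm (q powi (3 * r + 1))"
  unfolding norm_power_int using assms by (intro power_int_decreasing) auto

text \<open>For r \<ge> 0 no denominator is left; for r < 0 the pole has modulus at least |q|^(-2) >
  b, which keeps the denominator away from 0 uniformly in r.\<close>

lemma appell_reg_term_bound:
  assumes "norm q < 1" "q \<noteq> 0" "0 < a" "b < norm q powi (- 2)" "a \<le> norm y" "norm y \<le> b"
  shows "norm (appell_reg_term q r y) \<le>
    (exp (norm q / a / (1 - norm q ^ 3)) * exp (norm q / a / (1 - norm q ^ 3)) + exp (norm q / a / (1 - norm q ^ 3)) * (1 / (norm q powi (- 2) / b - 1)))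
      * (norm ((q * y) powi r) * (norm q ^ 3) powi (tri r))"
    (is "_ \<le> (?e * ?e + ?e * ?k) * _")
proof -
  have b: "b > 0" using assms by linarith
  have k: "?k > 0" using assms b by (simp add: divide_simps)
  have q3: "norm (q ^ 3) < 1" by (rule norm_power3_less_1) fact
  have qy: "norm (q / y) \<le> norm q / a" using assms by (simp add: norm_divide frac_le)
  have e: "norm (qpoch (q / y) (q ^ 3) n) \<le> ?e" "norm (qpoch_inf (q / y) (q ^ 3)) \<le> ?e" for n
    using norm_qpoch_le[OF q3 qy] norm_qpoch_inf_le[OF q3 qy] by (simp_all add: norm_power)
  have e2: "norm (qpoch_inf ((q ^ 3) ^ Suc n * (q / y)) (q ^ 3)) \<le> ?e" for n
  proof -
    have "norm ((q ^ 3) ^ Suc n * (q / y)) \<le> 1 * (norm q / a)"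
      unfolding norm_mult[of "(q ^ 3) ^ Suc n"] norm_power[of "q ^ 3"] using q3 qy
      by (intro mult_mono power_le_one) auto
    then show ?thesis using norm_qpoch_inf_le[OF q3, of "(q ^ 3) ^ Suc n * (q / y)" "norm q / a"] by (simp add: norm_power)
  qed
  let ?F = "if r \<ge> 0 then qpoch (q / y) (q ^ 3) (nat r) * qpoch_inf ((q ^ 3) ^ Suc (nat r) * (q / y)) (q ^ 3)
      else qpoch_inf (q / y) (q ^ 3) / (1 - q powi (3 * r + 1) / y)"
  have F: "norm ?F \<le> ?e * ?e + ?e * ?k"
  proof (cases "r \<ge> 0")
    case True
    then have "norm ?F \<le> ?e * ?e" using e(1) e2 by (simp add: norm_mult mult_mono del: power_Suc)
    also have "\<dots> \<le> ?e * ?e + ?e * ?k" using k by (simp add: less_imp_le)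
    finally show ?thesis .
  next
    case False
    have y0: "0 < norm y" using assms by linarith
    have "norm q powi (- 2) / b \<le> norm (q powi (3 * r + 1)) / norm y"
      using norm_q_powi_3[OF assms(1,2), of r] False assms y0 by (intro frac_le) auto
    then have "norm q powi (- 2) / b - 1 \<le> norm (q powi (3 * r + 1) / y) - norm (1 :: complex)" by (simp add: norm_divide)
    also have "\<dots> \<le> norm (q powi (3 * r + 1) / y - 1)" by (rule norm_triangle_ineq2)
    finally have "norm q powi (- 2) / b - 1 \<le> norm (1 - q powi (3 * r + 1) / y)" by (simp add: norm_minus_commute)
    then have "1 / norm (1 - q powi (3 * r + 1) / y) \<le> ?k" using k by (intro frac_le) auto
    then have "norm (qpoch_inf (q / y) (q ^ 3)) * (1 / norm (1 - q powi (3 * r + 1) / y)) \<le> ?e * ?k"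
      using e(2) by (intro mult_mono) auto
    then have "norm ?F \<le> ?e * ?k" using False by (simp add: norm_divide)
    also have "\<dots> \<le> ?e * ?e + ?e * ?k" by simp
    finally show ?thesis .
  qed
  have "norm (appell_reg_term q r y) = norm ((q * y) powi r) * (norm q ^ 3) powi (tri r) * norm ?F"
    unfolding appell_reg_term_def norm_mult[of "_ powi r * _"] norm_mult[of "_ powi r"]
    by (simp only: norm_power_int norm_minus_cancel norm_power)
  also have "\<dots> \<le> norm ((q * y) powi r) * (norm q ^ 3) powi (tri r) * (?e * ?e + ?e * ?k)"
    by (rule mult_left_mono[OF F]) simp
  finally show ?thesis by (simp only: mult.commute)
qed

lemma appell_reg_local_bound:
  assumes "norm q < 1" "q \<noteq> 0" "y \<in> ball 0 (norm q powi (- 2)) - {0}"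
  shows "\<exists>d>0. \<exists>K. \<forall>w\<in>cball y d. \<forall>r. norm (appell_reg_term q r w) \<le> K * (norm ((q * w) powi r) * (norm q ^ 3) powi (tri r))"
proof -
  define a b where "a = norm y / 2" and "b = (norm y + norm q powi (- 2)) / 2"
  define d where "d = min (norm y / 2) ((norm q powi (- 2) - norm y) / 2)"
  have y: "0 < norm y" "norm y < norm q powi (- 2)" using assms(3) by auto
  have a: "0 < a" "b < norm q powi (- 2)" using y by (auto simp: a_def b_def)
  have "a \<le> norm w" "norm w \<le> b" if "w \<in> cball y d" for w
    using that norm_triangle_ineq2[of y w] norm_triangle_ineq2[of w y]
    by (auto simp: d_def a_def b_def dist_norm norm_minus_commute field_simps)
  then have "\<exists>K. \<forall>w\<in>cball y d. \<forall>r. norm (appell_reg_term q r w) \<le> K * (norm ((q * w) powi r) * (norm q ^ 3) powi (tri r))"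
    using appell_reg_term_bound[OF assms(1,2) a] by blast
  moreover have "d > 0" using y by (simp add: d_def)
  ultimately show ?thesis by blast
qed

lemma holomorphic_appell_reg:
  assumes "norm q < 1" "q \<noteq> 0"
  shows "appell_reg q holomorphic_on ball 0 (norm q powi (- 2)) - {0}"
proof -
  let ?D = "ball (0 :: complex) (norm q powi (- 2)) - {0}"
  have q3: "norm (q ^ 3) < 1" by (rule norm_power3_less_1) fact
  have hq: "(\<lambda>z. qpoch_inf (f z) (q ^ 3)) holomorphic_on S" if "f holomorphic_on S" for f S
    using holomorphic_on_compose_gen[OF that holomorphic_qpoch_inf[OF q3]] by (simp add: o_def)
  have "(\<lambda>w. \<Sum>\<^sub>\<infinity>r. appell_reg_term q r w) holomorphic_on ?D"
  proof (rule holomorphic_gauss_laurent)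
    show "appell_reg_term q r holomorphic_on ?D" for r
    proof (cases "r \<ge> 0")
      case True
      then show ?thesis unfolding appell_reg_term_def
        using assms(2) by (simp del: power_Suc) (intro holomorphic_intros hq; auto)
    next
      case False
      have "1 - q powi (3 * r + 1) / z \<noteq> 0" if "z \<in> ?D" for z
        using norm_q_powi_3[OF assms, of r] False that by (auto simp: field_simps)
      then show ?thesis unfolding appell_reg_term_def
        using assms(2) False by simp (intro holomorphic_intros hq; auto)
    qed
    show "\<exists>d>0. \<exists>K. \<forall>w\<in>cball z d. \<forall>r. norm (appell_reg_term q r w) \<le> K * (norm ((q * w) powi r) * (norm q ^ 3) powi (tri r))"
      if "z \<in> ?D" for z by (rule appell_reg_local_bound[OF assms that])
  qed (use assms q3 in \<open>auto simp: norm_power\<close>)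
  then show ?thesis by (simp add: appell_reg_def[abs_def])
qed

lemma summable_appell_reg:
  assumes "norm q < 1" "q \<noteq> 0" "y \<in> ball 0 (norm q powi (- 2)) - {0}"
  shows "(\<lambda>r. appell_reg_term q r y) summable_on UNIV"
proof -
  obtain d K where d: "d > 0" "\<And>w r. w \<in> cball y d \<Longrightarrow> norm (appell_reg_term q r w) \<le> K * (norm ((q * w) powi r) * (norm q ^ 3) powi (tri r))"
    using appell_reg_local_bound[OF assms] by blast
  show ?thesis
    by (rule summable_gauss_norm[of "norm q ^ 3" "q * y"])
      (use assms norm_power3_less_1[OF assms(1)] d(1) in \<open>auto simp: norm_power intro!: d(2)\<close>)
qed

definition appell :: "complex \<Rightarrow> complex \<Rightarrow> complex" where
  "appell q y = (\<Sum>\<^sub>\<infinity>r. appell_term q r y)"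

lemma appell_reg_eq:
  assumes "norm q < 1" "q \<noteq> 0" "y \<in> ball 0 (norm q powi (- 2)) - {0}" "\<And>r. q powi (3 * r + 1) \<noteq> y"
  shows "appell_reg q y = qpoch_inf (q / y) (q ^ 3) * appell q y"
    "(\<lambda>r. appell_term q r y) summable_on UNIV"
proof -
  have y0: "y \<noteq> 0" using assms(3) by auto
  note t = appell_reg_term_eq[OF assms(1,2,4) y0]
  show "appell_reg q y = qpoch_inf (q / y) (q ^ 3) * appell q y"
    unfolding appell_reg_def appell_def t by (rule infsum_cmult_right')
  have "(q ^ 3) ^ i * (q / y) \<noteq> 1" for i
  proof -
    have "q powi (3 * int i + 1) = (q ^ 3) ^ i * q"
      using assms(2) by (simp add: power_int_add power_int_mult)
    then show ?thesis using assms(4)[of "int i"] y0 by auto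
  qed
  then have nz: "qpoch_inf (q / y) (q ^ 3) \<noteq> 0"
    using qpoch_inf_nonzero_iff[OF norm_power3_less_1[OF assms(1)]] by blast
  have "(\<lambda>r. 1 / qpoch_inf (q / y) (q ^ 3) * appell_reg_term q r y) summable_on UNIV"
    by (intro summable_on_cmult_right summable_appell_reg assms)
  then show "(\<lambda>r. appell_term q r y) summable_on UNIV" unfolding t using nz by simp
qed

text \<open>Replacing y by q^3 y and r by r + 1 leaves Z = q^(3r+1) / y unchanged and multiplies the
  term by -q^2 y^3 Z^2. Then Z^2 / (1 - Z) = 1 / (1 - Z) - 1 - Z returns the Appell sum and two
  theta series.\<close>

lemma appell_functional:
  assumes "norm q < 1" "q \<noteq> 0" "y \<in> ball 0 (norm q powi (- 2)) - {0}" "\<And>r. q powi (3 * r + 1) \<noteq> y"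
  shows "appell q (q ^ 3 * y) = - (q\<^sup>2 * y ^ 3) * (appell q y - (1 - 1 / y\<^sup>2) * theta_j (q * y) (q ^ 3))"
proof -
  have y0: "y \<noteq> 0" using assms(3) by auto
  have q3: "0 < norm (q ^ 3)" "norm (q ^ 3) < 1" "q ^ 3 \<noteq> 0" using assms norm_power3_less_1 by auto
  let ?t = "\<lambda>x r. (- x) powi r * (q ^ 3) powi (tri r)"
  have "appell_term q (r + 1) (q ^ 3 * y) = - (q\<^sup>2 * y ^ 3) * (appell_term q r y + (- ?t (q * y) r + - (q / y) * ?t (q ^ 3 * (q * y)) r))" for r
  proof -
    define V Y X where "V = (q ^ 3) powi (tri r)" and "Y = (- (q * y)) powi r" and "X = q powi r"
    have X: "X \<noteq> 0" using assms by (simp add: X_def)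
    have p: "(q ^ 3) powi r = X ^ 3" "q powi (3 * r) = X ^ 3"
      using power_int_mult[of q 3 r] power_int_mult[of q r 3] by (simp_all add: X_def mult.commute)
    have e1: "q powi (3 * r + 1) = X ^ 3 * q" "q powi (3 * (r + 1) + 1) = X ^ 3 * q ^ 3 * q"
      using assms(2) p by (simp_all add: power_int_add distrib_left) (simp add: power4_eq_xxxx power3_eq_cube)
    have t: "tri (r + 1) = tri r + r" using triangle_add[of r 1] by simp
    have e2: "(q ^ 3) powi (tri (r + 1)) = V * X ^ 3" unfolding t using q3(3) by (simp add: power_int_add V_def p)
    have "(- (q * (q ^ 3 * y))) powi (r + 1) = (q ^ 3 * - (q * y)) powi r * (- (q * (q ^ 3 * y)))"
      using assms(2) y0 by (simp add: power_int_add mult_ac)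
    also have "(q ^ 3 * - (q * y)) powi r = X ^ 3 * Y" by (simp only: power_int_mult_distrib p Y_def)
    finally have e3: "(- (q * (q ^ 3 * y))) powi (r + 1) = X ^ 3 * Y * (- (q * (q ^ 3 * y)))" .
    have e4: "(- (q ^ 3 * (q * y))) powi r = X ^ 3 * Y"
      using power_int_mult_distrib[of "q ^ 3" "- (q * y)" r] by (simp add: p Y_def)
    have nz: "1 - X ^ 3 * q / y \<noteq> 0" using assms(4)[of r] y0 unfolding e1 by auto
    have "X ^ 3 * Y * (- (q * (q ^ 3 * y))) * (V * X ^ 3) / (1 - X ^ 3 * q ^ 3 * q / (q ^ 3 * y)) =
        - (q\<^sup>2 * y ^ 3) * (Y * V / (1 - X ^ 3 * q / y) + (- (Y * V) + - (q / y) * (X ^ 3 * Y * V)))"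
    proof -
      have z: "X ^ 3 * q ^ 3 * q / (q ^ 3 * y) = X ^ 3 * q / y" using assms(2) by simp
      define Z where "Z = X ^ 3 * q / y"
      have x3: "X ^ 3 = Z * y / q" using assms(2) y0 by (simp add: Z_def)
      have nz: "1 - Z \<noteq> 0" using nz by (simp add: Z_def)
      have m1: "X ^ 3 * Y * (- (q * (q ^ 3 * y))) * (V * X ^ 3) = - (q\<^sup>2 * y ^ 3) * (Z\<^sup>2 * (Y * V))"
        unfolding x3 using assms(2) by (simp add: power2_eq_square power3_eq_cube)
      have m2: "Z\<^sup>2 * (Y * V) / (1 - Z) = Y * V / (1 - Z) + (- (Y * V) + - (q / y) * (Z * y / q * Y * V))"
        using nz assms(2) y0 by (simp add: power2_eq_square divide_simps) (simp add: algebra_simps)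
      have "X ^ 3 * Y * (- (q * (q ^ 3 * y))) * (V * X ^ 3) / (1 - Z)
          = - (q\<^sup>2 * y ^ 3) * (Y * V / (1 - Z) + (- (Y * V) + - (q / y) * (X ^ 3 * Y * V)))"
        unfolding m1 times_divide_eq_right[of "- (q\<^sup>2 * y ^ 3)", symmetric] m2 unfolding x3 ..
      then show ?thesis unfolding z Z_def .
    qed
    then show ?thesis unfolding appell_term_def e1 e2 e3 e4 V_def Y_def .
  qed
  then have "(\<Sum>\<^sub>\<infinity>r. appell_term q (r + 1) (q ^ 3 * y)) =
      (\<Sum>\<^sub>\<infinity>r. - (q\<^sup>2 * y ^ 3) * (appell_term q r y + (- ?t (q * y) r + - (q / y) * ?t (q ^ 3 * (q * y)) r)))"
    by (simp only:)
  also have "\<dots> = - (q\<^sup>2 * y ^ 3) * (appell q y + (- theta_j (q * y) (q ^ 3) + - (q / y) * theta_j (q ^ 3 * (q * y)) (q ^ 3)))"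
  proof (intro infsumI has_sum_cmult_right has_sum_add)
    show "((\<lambda>r. appell_term q r y) has_sum appell q y) UNIV"
      unfolding appell_def by (rule has_sum_infsum[OF appell_reg_eq(2)[OF assms]])
    show "((\<lambda>r. - ?t (q * y) r) has_sum - theta_j (q * y) (q ^ 3)) UNIV"
      unfolding has_sum_uminus minus_minus using assms(2) y0 by (intro theta_series q3) auto
    show "(?t (q ^ 3 * (q * y)) has_sum theta_j (q ^ 3 * (q * y)) (q ^ 3)) UNIV"
      using assms(2) y0 by (intro theta_series q3) auto
  qed
  also have "theta_j (q ^ 3 * (q * y)) (q ^ 3) = - theta_j (q * y) (q ^ 3) / (q * y)"
    using assms(2) y0 by (intro theta_shift q3) auto
  also have "appell q y + (- theta_j (q * y) (q ^ 3) + - (q / y) * (- theta_j (q * y) (q ^ 3) / (q * y)))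
      = appell q y - (1 - 1 / y\<^sup>2) * theta_j (q * y) (q ^ 3)"
    using assms(2) y0 by (simp add: power2_eq_square algebra_simps)
  finally show ?thesis
    unfolding appell_def[of q "q ^ 3 * y"] infsum_int_shift[of "\<lambda>r. appell_term q r (q ^ 3 * y)" 1] .
qed

text \<open>Provides an open annulus free of poles, on which the functional equation can be
  checked.\<close>

lemma norm_power_int_gap:
  fixes q :: complex
  assumes "norm q < 1" "q \<noteq> 0" "norm q < norm y" "norm y < 1"
  shows "q powi k \<noteq> y"
proof
  assume "q powi k = y"
  then have n: "norm y = norm q powi k" by (metis norm_power_int)
  show False
  proof (cases "k \<ge> 1")
    case True
    then have "norm q powi k \<le> norm q powi 1" using assms by (intro power_int_decreasing) auto
    then show False using n assms by simp
  next
    case False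
    then have "norm q powi 0 \<le> norm q powi k" using assms by (intro power_int_decreasing) auto
    then show False using n assms by simp
  qed
qed

text \<open>Under y \<mapsto> q^3 y the two theta functions and the Appell sum acquire the factors
  -1/y, -1/(q^2 y) and -q^2 y^3, whose product is -y; \<open>theta_dissect3\<close> identifies the
  inhomogeneous terms. The difference of the two sides thus solves the homogeneous equation.\<close>

lemma phi_laurent_appell:
  assumes "norm q < 1" "q \<noteq> 0" "y \<in> ball 0 (norm q powi (- 2)) - {0}"
  shows "phi_laurent q y = qpoch_inf q q / qpoch_inf (q ^ 3) (q ^ 3) ^ 3 *
    (theta_j y (q ^ 3) * (qpoch_inf (q\<^sup>2 * y) (q ^ 3) * qpoch_inf (q ^ 3) (q ^ 3)) * appell_reg q y)"
proof -
  let ?D = "ball (0 :: complex) (norm q powi (- 2)) - {0}"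
  define C where "C = qpoch_inf q q / qpoch_inf (q ^ 3) (q ^ 3) ^ 3"
  define R where "R = (\<lambda>y. C * (theta_j y (q ^ 3) * (qpoch_inf (q\<^sup>2 * y) (q ^ 3) * qpoch_inf (q ^ 3) (q ^ 3)) * appell_reg q y))"
  define h where "h = (\<lambda>y. phi_laurent q y - R y)"
  have q3: "0 < norm (q ^ 3)" "norm (q ^ 3) < 1" "q ^ 3 \<noteq> 0" using assms norm_power3_less_1 by auto
  have r: "1 < norm q powi (- 2)"
    using power_int_strict_decreasing[of "- 2" 0 "norm q"] assms by simp
  have hq: "(\<lambda>z. qpoch_inf (f z) (q ^ 3)) holomorphic_on S" if "f holomorphic_on S" for f S
    using holomorphic_on_compose_gen[OF that holomorphic_qpoch_inf[OF q3(2)]] by (simp add: o_def)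
  have hol: "h holomorphic_on ?D"
    unfolding h_def R_def theta_j_def
    by (intro holomorphic_intros hq holomorphic_phi_laurent holomorphic_appell_reg assms open_Diff open_ball) auto
  have sub: "q ^ 3 * z \<in> ?D" if "z \<in> ?D" for z
  proof -
    have "norm (q ^ 3 * z) \<le> 1 * norm z" unfolding norm_mult by (intro mult_right_mono) (use q3 in auto)
    then show ?thesis using that assms(2) by auto
  qed
  have Rval: "R z = C * (theta_j z (q ^ 3) * theta_j (q\<^sup>2 * z) (q ^ 3) * appell q z)"
    if "z \<in> ?D" "\<And>r. q powi (3 * r + 1) \<noteq> z" for z
  proof -
    have "q ^ 3 / (q\<^sup>2 * z) = q / z" using assms(2) by (simp add: power2_eq_square power3_eq_cube)
    then show ?thesis unfolding R_def appell_reg_eq(1)[OF assms(1,2) that] theta_j_def[of "q\<^sup>2 * z"] by simp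
  qed
  have heq: "h (q ^ 3 * z) = - z * h z" if z: "z \<in> ?D" "\<And>r. q powi (3 * r + 1) \<noteq> z" for z
  proof -
    have z0: "z \<noteq> 0" using z by auto
    have ns: "q powi (3 * r + 1) \<noteq> q ^ 3 * z" for r
    proof
      assume a: "q powi (3 * r + 1) = q ^ 3 * z"
      have "3 * r + 1 = 3 + (3 * (r - 1) + 1)" by simp
      then have "q powi (3 * r + 1) = q powi 3 * q powi (3 * (r - 1) + 1)"
        using assms(2) by (simp only: power_int_add simp_thms)
      with a have "q powi (3 * (r - 1) + 1) = z" using q3(3) by simp
      with z(2)[of "r - 1"] show False by simp
    qed
    have th1: "theta_j (q ^ 3 * z) (q ^ 3) = - theta_j z (q ^ 3) / z" by (rule theta_shift[OF q3(2,3) z0])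
    have th2: "theta_j (q\<^sup>2 * (q ^ 3 * z)) (q ^ 3) = - theta_j (q\<^sup>2 * z) (q ^ 3) / (q\<^sup>2 * z)"
      using theta_shift[OF q3(2,3), of "q\<^sup>2 * z"] z0 assms(2) by (simp add: mult_ac)
    have dis: "theta_j z q = C * (theta_j z (q ^ 3) * theta_j (q * z) (q ^ 3) * theta_j (q\<^sup>2 * z) (q ^ 3))"
      using theta_dissect3[OF assms(1,2) z0] qpoch_inf_nonzero[OF q3(2,2)] unfolding C_def by (simp add: field_simps)
    have "R (q ^ 3 * z) = C * (- theta_j z (q ^ 3) / z * (- theta_j (q\<^sup>2 * z) (q ^ 3) / (q\<^sup>2 * z)) *
        (- (q\<^sup>2 * z ^ 3) * (appell q z - (1 - 1 / z\<^sup>2) * theta_j (q * z) (q ^ 3))))"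
      unfolding Rval[OF sub[OF z(1)] ns] th1 th2 appell_functional[OF assms(1,2) z] ..
    also have "\<dots> = - z * R z + (z - 1 / z) * theta_j z q"
      unfolding Rval[OF z] dis using z0 assms(2) by (simp add: field_simps power2_eq_square power3_eq_cube)
    finally show ?thesis unfolding h_def phi_laurent_functional[OF assms(1,2) z0] by (simp add: algebra_simps)
  qed
  \<comment> \<open>The equation is known only off the poles; the identity theorem extends it from
    |q| < |z| < 1 to the whole punctured disc, on which both sides are holomorphic.\<close>
  have "h (q ^ 3 * z) + z * h z = 0" if "z \<in> ?D" for z
  proof (rule analytic_continuation_open[of "ball 0 1 - cball 0 (norm q)" ?D "\<lambda>z. h (q ^ 3 * z) + z * h z" "\<lambda>z. 0"])
    show "ball 0 1 - cball 0 (norm q) \<noteq> ({} :: complex set)"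
    proof -
      have "of_real ((1 + norm q) / 2) \<in> ball 0 1 - cball (0 :: complex) (norm q)" using assms(1) by (simp add: norm_divide del: of_real_add)
      then show ?thesis by blast
    qed
    show "connected ?D" by (intro connected_punctured_ball) simp
    show "ball 0 1 - cball 0 (norm q) \<subseteq> ?D" using r by auto
    show "(\<lambda>z. h (q ^ 3 * z) + z * h z) holomorphic_on ?D"
    proof -
      have "(h \<circ> (\<lambda>z. q ^ 3 * z)) holomorphic_on ?D"
        using sub by (intro holomorphic_on_compose_gen[OF _ hol] holomorphic_intros) auto
      then show ?thesis using hol by (intro holomorphic_intros) (simp_all add: o_def)
    qed
    show "h (q ^ 3 * z) + z * h z = 0" if "z \<in> ball 0 1 - cball 0 (norm q)" for z
    proof -
      have "h (q ^ 3 * z) = - z * h z"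
        by (rule heq) (use that r norm_power_int_gap[OF assms(1,2), of z] in auto)
      then show ?thesis by simp
    qed
  qed (use that in auto)
  then have "h (q ^ 3 * z) = - z * h z" if "z \<in> ?D" for z using that by (simp add: add_eq_0_iff)
  then have "h y = 0" by (rule functional_equation_zero[OF q3(1,2) r hol _ assms(3)])
  then show ?thesis unfolding h_def R_def C_def by simp
qed

section \<open>Evaluation at y = -q\<close>

lemma theta_minus_one_nonzero:
  assumes "norm q < 1" "q \<noteq> 0"
  shows "theta_j (- 1) q \<noteq> 0"
  unfolding theta_minus_one(1)[OF assms] using qpoch_inf_nonzero[OF assms(1,1)] qpoch_inf_nonzero[OF assms(1), of "- q"] assms by simp

text \<open>At y = -q the dissection writes j(-1;q) as the prefactor of the Appell sum times one
  more j(-q;q^3), since j(-q^2;q^3) = j(-q;q^3). The common factor j(-1;q) is nonzero and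
  cancels.\<close>

lemma mock_phi_lambert:
  assumes "norm q < 1" "q \<noteq> 0"
  shows "theta_j (- q) (q ^ 3) * mock_phi q = 2 * lambert_P q"
proof -
  have q3: "norm (q ^ 3) < 1" "q ^ 3 \<noteq> 0" using assms norm_power3_less_1 by auto
  have D: "- q \<in> ball 0 (norm q powi (- 2)) - {0}"
    using power_int_strict_decreasing[of "- 2" 1 "norm q"] assms by simp
  have ns: "q powi (3 * r + 1) \<noteq> - q" for r
  proof
    assume "q powi (3 * r + 1) = - q"
    then have "(1 + q powi (3 * r)) * q = 0" using assms(2) by (simp add: power_int_add distrib_right)
    then show False using one_plus_powi_nonzero[OF assms] assms(2) by simp
  qed
  let ?T = "\<lambda>x. theta_j x (q ^ 3)"
  have ap: "appell q (- q) = lambert_P q"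
    unfolding appell_def lambert_P_def
  proof (rule infsum_cong)
    fix r
    have "(- (q * - q)) powi r * (q ^ 3) powi (tri r) = q powi (3 * tri r + 2 * r)"
      using assms(2) power_int_mult[of q 2 r] power_int_mult[of q 3 "tri r"] by (simp add: power_int_add power2_eq_square)
    moreover have "1 - q powi (3 * r + 1) / - q = 1 + q powi (3 * r)"
      using assms(2) by (simp add: power_int_add)
    ultimately show "appell_term q r (- q) = q powi (3 * tri r + 2 * r) / (1 + q powi (3 * r))"
      unfolding appell_term_def by (simp only:)
  qed
  have L: "phi_laurent q (- q) = (\<Sum>\<^sub>\<infinity>r. (- 1) powi r * q powi (3 * (r * r) + r) * phi_sum q r)"
    unfolding phi_laurent_def phi_tail_sum[OF assms]
  proof (rule infsum_cong)
    fix s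
    have "- (3 * tri s + 2 * s) = s + - (3 * tri s + 3 * s)" by simp
    then have "q powi (- (3 * tri s + 2 * s)) = q powi s * q powi (- (3 * tri s + 3 * s))"
      using assms(2) by (simp only: power_int_add simp_thms)
    then show "(- (- q)) powi s * phi_coeff q s = q powi (- (3 * tri s + 2 * s)) * tail_sum q (nat \<bar>s\<bar>)"
      by (simp only: minus_minus mult.assoc)
  qed
  have e: "q ^ 3 / (q\<^sup>2 * - q) = q / - q" using assms(2) by (simp add: power2_eq_square power3_eq_cube)
  have "phi_laurent q (- q) = qpoch_inf q q / qpoch_inf (q ^ 3) (q ^ 3) ^ 3 * (?T (- q) * ?T (q\<^sup>2 * - q)) * lambert_P q"
    unfolding phi_laurent_appell[OF assms D] appell_reg_eq(1)[OF assms D ns] ap theta_j_def[of "q\<^sup>2 * - q"] e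
    by simp
  moreover have "theta_j (- 1) q * mock_phi q = 2 * phi_laurent q (- q)"
    unfolding L by (rule mock_phi_bilateral[OF assms])
  moreover have "theta_j (- 1) q = qpoch_inf q q / qpoch_inf (q ^ 3) (q ^ 3) ^ 3 * (?T (- q) * ?T (q\<^sup>2 * - q)) * ?T (- q)"
  proof -
    have "theta_j (q * - 1) q = theta_j (- 1) q" using theta_shift[OF assms, of "- 1"] by simp
    moreover have "?T (q * - q) = ?T (- q)"
      using theta_symmetric[of "q ^ 3" "- q"] assms(2) by (simp add: power3_eq_cube)
    ultimately show ?thesis
      using theta_dissect3[OF assms, of "- q"] qpoch_inf_nonzero[OF q3(1,1)] assms(2) by (simp add: field_simps)
  qed
  ultimately have "theta_j (- 1) q * (theta_j (- q) (q ^ 3) * mock_phi q) = theta_j (- 1) q * (2 * lambert_P q)"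
    by (simp add: mult_ac)
  then show ?thesis using theta_minus_one_nonzero[OF assms] by simp
qed

text \<open>-B/2 = -P(q) + R(q^3)/2 produces the coefficients -1/2 of phi and 1/4 of mu; the
  alternating Lambert series enters with 1/4 in base q and -1/4 in base q^3, and each equals twice a
  theta quotient.\<close>

lemma fabc_443_plus_mock:
  assumes "norm q < 1" "q \<noteq> 0"
  shows "fabc 4 4 3 (- (q ^ 3)) (- (q\<^sup>2)) q = 1 / 4 * theta_j (- 1) (q ^ 3) * mock_mu (q ^ 3)
     - 1 / 2 * theta_j (- q) (q ^ 3) * mock_phi q
     + (theta_j (- q) (q ^ 3) + 1 / 2 * (qpoch_inf q q ^ 3 / theta_j (- 1) q)
         - 1 / 2 * (qpoch_inf (q ^ 3) (q ^ 3) ^ 3 / theta_j (- 1) (q ^ 3)))"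
proof -
  have q3: "norm (q ^ 3) < 1" "q ^ 3 \<noteq> 0" using assms norm_power3_less_1 by auto
  show ?thesis
    unfolding fabc_443_plus[OF assms] lambert_B_eq[OF assms] lambert_R_eq[OF q3] infsum_mu_alpha[OF assms] infsum_mu_alpha[OF q3]
      mult.assoc[of "1 / 2" "theta_j (- q) (q ^ 3)"] mock_phi_lambert[OF assms]
    by (simp add: field_simps)
qed

text \<open>Needed because (q;q)_\<infinity> must be written as an admissible factor: j(q;q) itself
  would be 0, whereas j(q;q^3) collects the three residue classes.\<close>

lemma theta_j_cube:
  assumes "norm q < 1" "q \<noteq> 0"
  shows "theta_j q (q ^ 3) = qpoch_inf q q"
proof -
  have "q ^ 3 / q = q * q" using assms(2) by (simp add: power3_eq_cube)
  then show ?thesis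
    unfolding theta_j_def qpoch_inf_dissect3[OF assms(1), of q] by (simp add: power2_eq_square power3_eq_cube)
qed

lemma theta_factor_minus_one_nonzero:
  assumes "0 < m" "0 < norm q" "norm q < 1"
  shows "theta_factor (- 1, 0, m) q \<noteq> 0"
  using theta_minus_one_nonzero[of "q ^ m"] norm_power_less_1[OF assms(3,1)] assms(2) by (auto simp: theta_factor_def)

lemma is_theta_quotient_cube:
  assumes "0 < m"
  shows "is_theta_quotient (\<lambda>q. qpoch_inf (q ^ m) (q ^ m) ^ 3 / theta_j (- 1) (q ^ m))"
  unfolding is_theta_quotient_def
proof (rule exI[of _ 0], rule exI[of _ "replicate 3 (1, int m, 3 * m)"], rule exI[of _ "[(- 1, 0, m)]"], intro conjI allI impI ballI)
  fix q :: complex assume q: "0 < norm q \<and> norm q < 1"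
  have "theta_j (q ^ m) ((q ^ m) ^ 3) = qpoch_inf (q ^ m) (q ^ m)"
    using q assms norm_power_less_1 by (intro theta_j_cube) auto
  then have "theta_factor (1, int m, 3 * m) q = qpoch_inf (q ^ m) (q ^ m)"
    by (simp add: theta_factor_def mult.commute flip: power_mult)
  then show "qpoch_inf (q ^ m) (q ^ m) ^ 3 / theta_j (- 1) (q ^ m) =
      q powi 0 * (\<Prod>t\<leftarrow>replicate 3 (1, int m, 3 * m). theta_factor t q) / (\<Prod>t\<leftarrow>[(- 1, 0, m)]. theta_factor t q)"
    by (simp add: prod_list_replicate map_replicate) (simp add: theta_factor_def)
qed (use assms theta_factor_minus_one_nonzero[OF assms] in \<open>auto simp: valid_factor_def\<close>)

theorem theorem9p1:
  shows "(\<forall>q::complex. 0 < norm q \<and> norm q < 1 \<longrightarrow>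
            fabc 4 4 3 (q ^ 3) (q ^ 2) q = theta_J1 1 q * mock_psi q) \<and>
         (\<exists>\<Theta> :: complex \<Rightarrow> complex. is_sum_of_theta_quotients \<Theta> \<and>
            (\<forall>q::complex. 0 < norm q \<and> norm q < 1 \<longrightarrow>
               fabc 4 4 3 (- (q ^ 3)) (- (q ^ 2)) q =
                 1 / 4 * theta_Jbar 0 3 q * mock_mu (q ^ 3)
                 - 1 / 2 * theta_Jbar 1 3 q * mock_phi q + \<Theta> q))"
proof (intro conjI allI impI exI)
  fix q :: complex assume q: "0 < norm q \<and> norm q < 1"
  then have q': "norm q < 1" "q \<noteq> 0" by auto
  show "fabc 4 4 3 (q ^ 3) (q ^ 2) q = theta_J1 1 q * mock_psi q"
    using fabc_443_mock_psi[OF q'] theta_j_cube[OF q'] by (simp add: theta_J1_def theta_J_def)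
next
  let ?E = "\<lambda>m q. qpoch_inf (q ^ m) (q ^ m) ^ 3 / theta_j (- 1) (q ^ m)"
  define G where "G = (\<lambda>i::nat. if i = 0 then \<lambda>q. theta_j (- q) (q ^ 3) else if i = 1 then ?E 1 else ?E 3)"
  define \<Theta> where "\<Theta> = (\<lambda>q. G 0 q + 1 / 2 * G 1 q - 1 / 2 * G 2 q)"
  have "is_theta_quotient (\<lambda>q. theta_j (- q) (q ^ 3))"
    unfolding is_theta_quotient_def
    by (rule exI[of _ 0], rule exI[of _ "[(- 1, 1, 3)]"], rule exI[of _ "[]"])
      (auto simp: valid_factor_def theta_factor_def)
  then have "is_theta_quotient (G i)" for i
    using is_theta_quotient_cube[of 1] is_theta_quotient_cube[of 3] by (simp add: G_def)
  moreover have "\<Theta> q = (\<Sum>i<3. of_rat ([1, 1 / 2, - 1 / 2] ! i) * G i q)" for q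
    by (simp add: \<Theta>_def eval_nat_numeral of_rat_divide of_rat_minus)
  ultimately show "is_sum_of_theta_quotients \<Theta>"
    unfolding is_sum_of_theta_quotients_def by blast
  fix q :: complex assume q: "0 < norm q \<and> norm q < 1"
  then have q': "norm q < 1" "q \<noteq> 0" by auto
  show "fabc 4 4 3 (- (q ^ 3)) (- (q ^ 2)) q =
                 1 / 4 * theta_Jbar 0 3 q * mock_mu (q ^ 3)
                 - 1 / 2 * theta_Jbar 1 3 q * mock_phi q + \<Theta> q"
    using fabc_443_plus_mock[OF q'] by (simp add: theta_Jbar_def \<Theta>_def G_def)
qed

end
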